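(* Let $X$ be a path connected, locally path connected, paracompact Hausdorff space and $x_0\in X$. The following are equivalent: (1) $X$ is $\pi_1$-shape injective; (2) $\pi^{s}(X,x_0)=1$, i.e. the Spanier group of $X$ is trivial; (3) $\pi_1^{qtop}(X,x_0)$ is invariantly separated.
   Context: $\Omega(X,x_0)$ denotes the space of loops $[0,1]\to X$ based at $x_0$ with the compact-open topology. $\pi_1^{qtop}(X,x_0)$ is $\pi_1(X,x_0)$ endowed with the quotient topology with respect to the map $\pi:\Omega(X,x_0)\to\pi_1(X,x_0)$, $\pi(\alpha)=[\alpha]$. It is a quasitopological group, i.e. a group with a topology such that inversion is continuous and multiplication is continuous in each variable separately. Invariantly separated: "invariant subgroup" means normal subgroup. A quasitopological group $G$ is invariantly separated if for every non-identity element $g\in G$ there is an open invariant subgroup $N$ of $G$ with $g\notin N$; equivalently, the intersection of all open invariant subgroups of $G$ is trivial. Spanier group: for an open cover $\mathscr{U}$ of $X$, $\pi^{s}(\mathscr{U},x_0)\le\pi_1(X,x_0)$ is the subgroup generated by all elements $[\alpha][\gamma][\alpha^{-}]$ (i.e. $[\alpha\cdot\gamma\cdot\alpha^{-}]$) where $\alpha$ is a path in $X$ starting at $x_0$ and $\gamma:[0,1]\to U$ is a loop based at $\alpha(1)$ for some $U\in\mathscr{U}$; here $\alpha^{-}$ is the reverse path. The Spanier group of $X$ is $\pi^{s}(X,x_0)=\bigcap_{\mathscr{U}}\pi^{s}(\mathscr{U},x_0)$, the intersection over all open covers. $\pi_1$-shape injectivity (for $X$ paracompact Hausdorff): let $cov(X)$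 be the set, directed by refinement, of pairs $(\mathscr{U},U_0)$ where $\mathscr{U}$ is a locally finite open cover of $X$ and $U_0\in\mathscr{U}$ is a distinguished element containing $x_0$ (a refinement $(\mathscr{V},V_0)$ of $(\mathscr{U},U_0)$ satisfies $V_0\subseteq U_0$). Let $N(\mathscr{U})$ be the nerve of $\mathscr{U}$: the vertex set is $\mathscr{U}$, and finitely many vertices span a simplex iff their intersection is non-empty; $|N(\mathscr{U})|$ is its geometric realization. If $(\mathscr{V},V_0)$ refines $(\mathscr{U},U_0)$, a simplicial map $p_{\mathscr{U}\mathscr{V}}:|N(\mathscr{V})|\to|N(\mathscr{U})|$ is obtained by sending each vertex $V$ to some $U\in\mathscr{U}$ with $V\subseteq U$ (with $V_0\mapsto U_0$) and extending linearly; the induced homomorphism $p_{\mathscr{U}\mathscr{V}*}:\pi_1(|N(\mathscr{V})|,V_0)\to\pi_1(|N(\mathscr{U})|,U_0)$ does not depend on choices. The first shape homotopy group is $\check{\pi}_1(X,x_0)=\varprojlim(\pi_1(|N(\mathscr{U})|,U_0),p_{\mathscr{U}\mathscr{V}*},cov(X))$. Given a partition of unity $\{\phi_U\}_{U\in\mathscr{U}}$ subordinated to $\mathscr{U}$ with $\phi_{U_0}(x_0)=1$, the map $p_{\mathscr{U}}:X\to|N(\mathscr{U})|$ sends $x$ to the point whose barycentric coordinate at $U$ is $\phi_U(x)$. The induced homomorphisms $p_{\mathscr{U}*}$ on $\pi_1$ are compatible with the bonding maps and induce a canonical homomorphism $\psi:\pi_1(X,x_0)\to\check{\pi}_1(X,x_0)$.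 $X$ is $\pi_1$-shape injective if $\psi$ is injective. *)

theory Defs
  imports "HOL-Analysis.Analysis" "HOL-Algebra.Product_Groups"
begin

section \<open>Covers and paracompactness\<close>

definition open_cover :: "'a topology \<Rightarrow> 'a set set \<Rightarrow> bool" where
  "open_cover X \<U> \<longleftrightarrow> (\<forall>U\<in>\<U>. openin X U) \<and> \<Union>\<U> = topspace X"

definition refines :: "'a set set \<Rightarrow> 'a set set \<Rightarrow> bool" where
  "refines \<V> \<U> \<longleftrightarrow> (\<forall>V\<in>\<V>. \<exists>U\<in>\<U>. V \<subseteq> U)"

text \<open>The Hausdorff property is not part of this notion.\<close>

definition paracompact_space :: "'a topology \<Rightarrow> bool" where
  "paracompact_space X \<longleftrightarrow>
     (\<forall>\<U>. open_cover X \<U> \<longrightarrow>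
        (\<exists>\<V>. open_cover X \<V> \<and> locally_finite_in X \<V> \<and> refines \<V> \<U>))"


section \<open>Loop spaces and the fundamental group\<close>

text \<open>
  Paths are parametrised by \<open>top_of_set {0..1}\<close>, as in \<open>pathin\<close>. Maps are made
  extensional so that a map is determined by its values on its domain.
\<close>

definition map_space :: "'b topology \<Rightarrow> 'a topology \<Rightarrow> ('b \<Rightarrow> 'a) set" where
  "map_space Y X = {f \<in> extensional (topspace Y). continuous_map Y X f}"

definition compact_open_topology :: "'b topology \<Rightarrow> 'a topology \<Rightarrow> ('b \<Rightarrow> 'a) topology" where
  "compact_open_topology Y X =
     topology_generated_by {{f \<in> map_space Y X. f ` K \<subseteq> W} | K W. compactin Y K \<and> openin X W}"

definition loops :: "'a topology \<Rightarrow> 'a \<Rightarrow> (real \<Rightarrow> 'a) set" where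
  "loops X x0 = {\<alpha> \<in> map_space (top_of_set {0..1}) X. \<alpha> 0 = x0 \<and> \<alpha> 1 = x0}"

definition loop_space :: "'a topology \<Rightarrow> 'a \<Rightarrow> (real \<Rightarrow> 'a) topology" where
  "loop_space X x0 = subtopology (compact_open_topology (top_of_set {0..1}) X) (loops X x0)"

text \<open>
  The library operations \<open>+++\<close> and \<open>reversepath\<close> are restricted to types in class
  \<open>topological_space\<close>; these are the same operations on arbitrary types.
\<close>

definition path_join :: "(real \<Rightarrow> 'a) \<Rightarrow> (real \<Rightarrow> 'a) \<Rightarrow> real \<Rightarrow> 'a" where
  "path_join \<alpha> \<beta> = (\<lambda>t. if t \<le> 1/2 then \<alpha> (2 * t) else \<beta> (2 * t - 1))"

definition path_rev :: "(real \<Rightarrow> 'a) \<Rightarrow> real \<Rightarrow> 'a" where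
  "path_rev \<alpha> = (\<lambda>t. \<alpha> (1 - t))"

text \<open>
  The representative \<open>\<alpha>\<close> need not be extensional: only its values on \<open>{0..1}\<close> matter.
\<close>

definition loop_class :: "'a topology \<Rightarrow> 'a \<Rightarrow> (real \<Rightarrow> 'a) \<Rightarrow> (real \<Rightarrow> 'a) set" where
  "loop_class X x0 \<alpha> =
     {\<beta> \<in> loops X x0.
        homotopic_with (\<lambda>\<gamma>. \<gamma> 0 = x0 \<and> \<gamma> 1 = x0) (top_of_set {0..1}) X \<alpha> \<beta>}"

text \<open>
  For classes \<open>A\<close> and \<open>B\<close> of loops, all the sets in the union below are equal, so the union is
  the class of the concatenation of any two representatives; similarly for \<open>induced_hom\<close>.
\<close>

definition fundamental_group :: "'a topology \<Rightarrow> 'a \<Rightarrow> (real \<Rightarrow> 'a) set monoid" where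
  "fundamental_group X x0 =
     \<lparr>carrier = loop_class X x0 ` loops X x0,
      monoid.mult = (\<lambda>A B. \<Union>\<alpha>\<in>A. \<Union>\<beta>\<in>B. loop_class X x0 (path_join \<alpha> \<beta>)),
      one = loop_class X x0 (\<lambda>t. x0)\<rparr>"

definition induced_hom ::
    "'b topology \<Rightarrow> 'b \<Rightarrow> ('a \<Rightarrow> 'b) \<Rightarrow> (real \<Rightarrow> 'a) set \<Rightarrow> (real \<Rightarrow> 'b) set" where
  "induced_hom Y y0 f A = (\<Union>\<alpha>\<in>A. loop_class Y y0 (f \<circ> \<alpha>))"


section \<open>The quotient topology on the fundamental group\<close>

definition quotient_topology :: "'a topology \<Rightarrow> ('a \<Rightarrow> 'b) \<Rightarrow> 'b topology" where
  "quotient_topology T q =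
     topology (\<lambda>W. W \<subseteq> q ` topspace T \<and> openin T {x \<in> topspace T. q x \<in> W})"

lemma openin_quotient_topology:
  "openin (quotient_topology T q) W \<longleftrightarrow>
     W \<subseteq> q ` topspace T \<and> openin T {x \<in> topspace T. q x \<in> W}"
proof -
  have "istopology (\<lambda>W. W \<subseteq> q ` topspace T \<and> openin T {x \<in> topspace T. q x \<in> W})"
    unfolding istopology_def
  proof (intro conjI allI impI)
    fix S S'
    assume "S \<subseteq> q ` topspace T \<and> openin T {x \<in> topspace T. q x \<in> S}"
      and "S' \<subseteq> q ` topspace T \<and> openin T {x \<in> topspace T. q x \<in> S'}"
    moreover have "{x \<in> topspace T. q x \<in> S \<inter> S'} =
        {x \<in> topspace T. q x \<in> S} \<inter> {x \<in> topspace T. q x \<in> S'}"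
      by blast
    ultimately show "S \<inter> S' \<subseteq> q ` topspace T" "openin T {x \<in> topspace T. q x \<in> S \<inter> S'}"
      by auto
  next
    fix \<K>
    assume *: "\<forall>K\<in>\<K>. K \<subseteq> q ` topspace T \<and> openin T {x \<in> topspace T. q x \<in> K}"
    have "{x \<in> topspace T. q x \<in> \<Union>\<K>} = (\<Union>K\<in>\<K>. {x \<in> topspace T. q x \<in> K})"
      by blast
    with * show "openin T {x \<in> topspace T. q x \<in> \<Union>\<K>}"
      by auto
    from * show "\<Union>\<K> \<subseteq> q ` topspace T"
      by blast
  qed
  then show ?thesis
    by (simp add: quotient_topology_def)
qed

definition pi1_qtop :: "'a topology \<Rightarrow> 'a \<Rightarrow> (real \<Rightarrow> 'a) set topology" where
  "pi1_qtop X x0 = quotient_topology (loop_space X x0) (loop_class X x0)"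

definition invariantly_separated :: "('g, 'm) monoid_scheme \<Rightarrow> 'g topology \<Rightarrow> bool" where
  "invariantly_separated G T \<longleftrightarrow>
     (\<forall>g \<in> carrier G. g \<noteq> \<one>\<^bsub>G\<^esub> \<longrightarrow> (\<exists>N. N \<lhd> G \<and> openin T N \<and> g \<notin> N))"


section \<open>The Spanier group\<close>

definition spanier_cover :: "'a topology \<Rightarrow> 'a \<Rightarrow> 'a set set \<Rightarrow> (real \<Rightarrow> 'a) set set" where
  "spanier_cover X x0 \<U> =
     generate (fundamental_group X x0)
       {loop_class X x0 (path_join (path_join \<alpha> \<gamma>) (path_rev \<alpha>)) | \<alpha> \<gamma> U.
          pathin X \<alpha> \<and> \<alpha> 0 = x0 \<and> U \<in> \<U> \<and>
          pathin (subtopology X U) \<gamma> \<and> \<gamma> 0 = \<alpha> 1 \<and> \<gamma> 1 = \<alpha> 1}"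

definition spanier_group :: "'a topology \<Rightarrow> 'a \<Rightarrow> (real \<Rightarrow> 'a) set set" where
  "spanier_group X x0 = (\<Inter>\<U> \<in> {\<U>. open_cover X \<U>}. spanier_cover X x0 \<U>)"


section \<open>Nerves and geometric realizations\<close>

text \<open>
  An abstract simplicial complex is given by the set of its (finite, nonempty) simplices. An empty
  member of a cover spans no simplex and hence does not contribute a vertex to the nerve.
\<close>

definition nerve :: "'a set set \<Rightarrow> 'a set set set" where
  "nerve \<U> = {F. finite F \<and> F \<noteq> {} \<and> F \<subseteq> \<U> \<and> \<Inter>F \<noteq> {}}"

text \<open>Points are given by their barycentric coordinates.\<close>

definition geometric_simplex :: "'v set \<Rightarrow> ('v \<Rightarrow> real) set" where
  "geometric_simplex F = {f. (\<forall>v. 0 \<le> f v) \<and> (\<forall>v. v \<notin> F \<longrightarrow> f v = 0) \<and> sum f F = 1}"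

text \<open>
  The realization carries the weak topology. On the geometric simplex of a finite set the
  product topology is the Euclidean one.
\<close>

definition realization :: "'v set set \<Rightarrow> ('v \<Rightarrow> real) topology" where
  "realization K =
     topology (\<lambda>W. W \<subseteq> (\<Union>F\<in>K. geometric_simplex F) \<and>
       (\<forall>F\<in>K. openin (subtopology (powertop_real UNIV) (geometric_simplex F))
                 (W \<inter> geometric_simplex F)))"

lemma openin_realization:
  "openin (realization K) W \<longleftrightarrow>
     W \<subseteq> (\<Union>F\<in>K. geometric_simplex F) \<and>
     (\<forall>F\<in>K. openin (subtopology (powertop_real UNIV) (geometric_simplex F))
               (W \<inter> geometric_simplex F))"
proof -
  have "istopology (\<lambda>W. W \<subseteq> (\<Union>F\<in>K. geometric_simplex F) \<and>
       (\<forall>F\<in>K. openin (subtopology (powertop_real UNIV) (geometric_simplex F))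
                 (W \<inter> geometric_simplex F)))"
    (is "istopology (\<lambda>W. W \<subseteq> ?R \<and> (\<forall>F\<in>K. openin (?T F) (W \<inter> geometric_simplex F)))")
    unfolding istopology_def
  proof (intro conjI allI impI ballI)
    fix S S' F
    assume "S \<subseteq> ?R \<and> (\<forall>F\<in>K. openin (?T F) (S \<inter> geometric_simplex F))"
      and "S' \<subseteq> ?R \<and> (\<forall>F\<in>K. openin (?T F) (S' \<inter> geometric_simplex F))" and "F \<in> K"
    moreover have "S \<inter> S' \<inter> geometric_simplex F =
        (S \<inter> geometric_simplex F) \<inter> (S' \<inter> geometric_simplex F)"
      by blast
    ultimately show "openin (?T F) (S \<inter> S' \<inter> geometric_simplex F)"
      by (metis openin_Int)
  next
    fix \<K> F
    assume *: "\<forall>W\<in>\<K>. W \<subseteq> ?R \<and> (\<forall>F\<in>K. openin (?T F) (W \<inter> geometric_simplex F))" and "F \<in> K"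
    have "\<Union>\<K> \<inter> geometric_simplex F = (\<Union>W\<in>\<K>. W \<inter> geometric_simplex F)"
      by blast
    with * \<open>F \<in> K\<close> show "openin (?T F) (\<Union>\<K> \<inter> geometric_simplex F)"
      by (metis (no_types, lifting) imageE openin_Union)
  qed blast+
  then show ?thesis
    by (simp add: realization_def)
qed

text \<open>The linear extension of a vertex map.\<close>

definition simplicial_extension :: "('v \<Rightarrow> 'w) \<Rightarrow> ('v \<Rightarrow> real) \<Rightarrow> ('w \<Rightarrow> real)" where
  "simplicial_extension r f = (\<lambda>w. \<Sum>v | f v \<noteq> 0 \<and> r v = w. f v)"


section \<open>The first shape homotopy group\<close>

definition cov :: "'a topology \<Rightarrow> 'a \<Rightarrow> ('a set set \<times> 'a set) set" where
  "cov X x0 = {(\<U>, U0). open_cover X \<U> \<and> locally_finite_in X \<U> \<and> U0 \<in> \<U> \<and> x0 \<in> U0}"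

definition cov_refines :: "'a set set \<times> 'a set \<Rightarrow> 'a set set \<times> 'a set \<Rightarrow> bool" where
  "cov_refines = (\<lambda>(\<V>, V0) (\<U>, U0). refines \<V> \<U> \<and> V0 \<subseteq> U0)"

text \<open>The vertex \<open>U0\<close> of the realization is the function \<open>indicator {U0}\<close>.\<close>

definition nerve_group ::
    "'a set set \<times> 'a set \<Rightarrow> (real \<Rightarrow> 'a set \<Rightarrow> real) set monoid" where
  "nerve_group = (\<lambda>(\<U>, U0). fundamental_group (realization (nerve \<U>)) (indicator {U0}))"

definition refining_map ::
    "'a set set \<times> 'a set \<Rightarrow> 'a set set \<times> 'a set \<Rightarrow> ('a set \<Rightarrow> 'a set) \<Rightarrow> bool" where
  "refining_map = (\<lambda>(\<U>, U0) (\<V>, V0) r. (\<forall>V\<in>\<V>. r V \<in> \<U> \<and> V \<subseteq> r V) \<and> r V0 = U0)"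

text \<open>
  The bonding homomorphism from the group of the second argument to that of the first. A vertex map
  is chosen; the homomorphism does not depend on the choice.
\<close>

definition bonding_hom ::
    "'a set set \<times> 'a set \<Rightarrow> 'a set set \<times> 'a set \<Rightarrow>
       (real \<Rightarrow> 'a set \<Rightarrow> real) set \<Rightarrow> (real \<Rightarrow> 'a set \<Rightarrow> real) set" where
  "bonding_hom c d =
     induced_hom (realization (nerve (fst c))) (indicator {snd c})
       (simplicial_extension (SOME r. refining_map c d r))"

definition shape_group ::
    "'a topology \<Rightarrow> 'a \<Rightarrow>
       ('a set set \<times> 'a set \<Rightarrow> (real \<Rightarrow> 'a set \<Rightarrow> real) set) monoid" where
  "shape_group X x0 =
     product_group (cov X x0) nerve_group
       \<lparr>carrier := {s \<in> carrier (product_group (cov X x0) nerve_group).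
          \<forall>c \<in> cov X x0. \<forall>d \<in> cov X x0. cov_refines d c \<longrightarrow> bonding_hom c d (s d) = s c}\<rparr>"

text \<open>
  When \<open>\<U>\<close> is locally finite, so is the family of supports, and the sum below is finite.
\<close>

definition partition_of_unity :: "'a topology \<Rightarrow> 'a set set \<Rightarrow> ('a set \<Rightarrow> 'a \<Rightarrow> real) \<Rightarrow> bool" where
  "partition_of_unity X \<U> \<phi> \<longleftrightarrow>
     (\<forall>U\<in>\<U>. continuous_map X euclideanreal (\<phi> U) \<and>
        (\<forall>x \<in> topspace X. 0 \<le> \<phi> U x) \<and>
        X closure_of {x \<in> topspace X. \<phi> U x \<noteq> 0} \<subseteq> U) \<and>
     (\<forall>x \<in> topspace X. (\<Sum>U | U \<in> \<U> \<and> \<phi> U x \<noteq> 0. \<phi> U x) = 1)"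

definition barycentric_map :: "'a set set \<Rightarrow> ('a set \<Rightarrow> 'a \<Rightarrow> real) \<Rightarrow> 'a \<Rightarrow> 'a set \<Rightarrow> real" where
  "barycentric_map \<U> \<phi> x = (\<lambda>U. if U \<in> \<U> then \<phi> U x else 0)"

text \<open>
  A partition of unity is chosen; different choices give homotopic maps relative to the base point.
\<close>

definition nerve_map :: "'a topology \<Rightarrow> 'a \<Rightarrow> 'a set set \<times> 'a set \<Rightarrow> 'a \<Rightarrow> 'a set \<Rightarrow> real" where
  "nerve_map X x0 = (\<lambda>(\<U>, U0).
     barycentric_map \<U> (SOME \<phi>. partition_of_unity X \<U> \<phi> \<and> \<phi> U0 x0 = 1))"

definition shape_hom ::
    "'a topology \<Rightarrow> 'a \<Rightarrow> (real \<Rightarrow> 'a) set \<Rightarrow>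
       'a set set \<times> 'a set \<Rightarrow> (real \<Rightarrow> 'a set \<Rightarrow> real) set" where
  "shape_hom X x0 A =
     (\<lambda>c \<in> cov X x0.
        induced_hom (realization (nerve (fst c))) (indicator {snd c}) (nerve_map X x0 c) A)"

definition pi1_shape_injective :: "'a topology \<Rightarrow> 'a \<Rightarrow> bool" where
  "pi1_shape_injective X x0 \<longleftrightarrow>
     shape_hom X x0 \<in> mon (fundamental_group X x0) (shape_group X x0)"

end

theory Submission
  imports Defs
begin

text \<open>
  Fix paths from the base point to all points of \<open>X\<close>. They turn the fundamental groupoid into a functor
  on paths with values in the fundamental group, and, for an open cover \<open>\<U>\<close>, modulo the normal subgroup
  of \<open>\<U>\<close> this functor takes equal values on paths with the same ends in a common member of \<open>\<U>\<close>. Choose an open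
  cover \<open>\<C>\<close> by path connected sets such that the union of any two intersecting members lies in a member
  of \<open>\<U>\<close>. Then the value on a path in a member of \<open>\<C>\<close> depends only on its ends, so loops can be compared
  through finitely many sample points.

  Comparing nearby loops in this way shows that Spanier subgroups of covers are open, and a compact-open
  neighbourhood of a lasso shows that every open normal subgroup contains one: this is the equivalence of
  (2) and (3). A Spanier generator whose noose lies in the set where one barycentric coordinate is
  positive dies in the nerve, so the Spanier group lies in the kernel of the shape homomorphism.
  Conversely, if a loop dies in the nerve of a locally finite refinement \<open>\<V>\<close> of \<open>\<C>\<close>, subdivide a null
  homotopy into small squares, each mapped into the open star of a vertex \<open>V\<close>; lifting the grid points
  to points of \<open>X\<close> in the corresponding members of \<open>\<V>\<close> shows that the loop lies in the Spanier subgroup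
  of \<open>\<U>\<close>.
\<close>


section \<open>Paths in abstract topologies\<close>


text \<open>A loop inside a member of a cover need not contract in \<open>X\<close>, and maps into
  the nerve cannot in general be lifted back to \<open>X\<close>. Working modulo the Spanier
  subgroup of \<U> removes both obstacles: there a short path counts only through its ends, so a
  list of sample points replaces a path and a grid of sample points replaces a homotopy. The
  condition on intersecting members of \<C> makes this independent of the member in which a path
  runs: two paths with common ends, one in \<open>C\<close> and one in \<open>D\<close>, close up to
  a loop in \<open>C \<union> D\<close>, hence in a single member of \<U>.

  For open normal subgroups the obstacle is different. A compact-open neighbourhood of a lasso
  controls nooses at one point with one fixed tail, whereas Spanier generators use all base points
  and all tails. Path connectedness of the neighbourhood moves the base point of the noose, and
  normality of the subgroup changes the tail.

  Paracompactness acts through shrinkings of covers: they yield both \<C> and the partitions of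
  unity.\<close>

abbreviation unit_space :: "real topology" where
  "unit_space \<equiv> top_of_set {0..1}"

text \<open>The end condition mentions only \<open>p\<close>: every stage of the homotopy satisfies
  it, so \<open>q\<close> is forced to have the same ends. For based loops this is the relation
  inside \<open>loop_class\<close>.\<close>

definition path_homotopic :: "'a topology \<Rightarrow> (real \<Rightarrow> 'a) \<Rightarrow> (real \<Rightarrow> 'a) \<Rightarrow> bool" where
  "path_homotopic X p q \<longleftrightarrow> homotopic_with (\<lambda>r. r 0 = p 0 \<and> r 1 = p 1) unit_space X p q"

lemma path_homotopic_iff:
  "path_homotopic X p q \<longleftrightarrow>
     (\<exists>h. continuous_map (prod_topology unit_space unit_space) X h \<and>
       (\<forall>t\<in>{0..1}. h (0, t) = p t \<and> h (1, t) = q t) \<and>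
       (\<forall>s\<in>{0..1}. h (s, 0) = p 0 \<and> h (s, 1) = p 1))"
  unfolding path_homotopic_def
  by (subst homotopic_with) auto

lemma path_homotopic_imp_pathin:
  assumes "path_homotopic X p q"
  shows "pathin X p" "pathin X q"
  using homotopic_with_imp_continuous_maps[OF assms[unfolded path_homotopic_def]]
  by (auto simp: pathin_def)

lemma path_homotopic_imp_ends:
  assumes "path_homotopic X p q"
  shows "q 0 = p 0" "q 1 = p 1"
  using assms homotopic_with_imp_property
  unfolding path_homotopic_def by blast+

lemma path_homotopic_refl [simp]: "path_homotopic X p p \<longleftrightarrow> pathin X p"
  by (simp add: path_homotopic_def pathin_def)

lemma path_homotopic_sym:
  assumes "path_homotopic X p q"
  shows "path_homotopic X q p"
  using assms path_homotopic_imp_ends[OF assms]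
  unfolding path_homotopic_def by (simp add: homotopic_with_symD)

lemma path_homotopic_trans [trans]:
  assumes "path_homotopic X p q" "path_homotopic X q r"
  shows "path_homotopic X p r"
  using assms path_homotopic_imp_ends[OF assms(1)] homotopic_with_trans
  unfolding path_homotopic_def by fastforce

text \<open>The square is convex, so \<open>u\<close> and \<open>v\<close> are joined inside it by
  straight segments that keep the common ends fixed; composing with \<open>h\<close> gives the
  homotopy. Both the reparametrisations and the passage from free to based null homotopies reduce to
  this.\<close>

lemma path_homotopic_square:
  fixes h :: "real \<times> real \<Rightarrow> 'a"
  assumes h: "continuous_map (prod_topology unit_space unit_space) X h"
    and "continuous_on {0..1} u" "continuous_on {0..1} v"
    and "u ` {0..1} \<subseteq> {0..1} \<times> {0..1}" "v ` {0..1} \<subseteq> {0..1} \<times> {0..1}"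
    and "u 0 = v 0" "u 1 = v 1"
    and p: "\<And>t. t \<in> {0..1} \<Longrightarrow> p t = h (u t)" and q: "\<And>t. t \<in> {0..1} \<Longrightarrow> q t = h (v t)"
  shows "path_homotopic X p q"
proof -
  let ?S = "{0..1::real} \<times> {0..1::real}"
  define k where "k = (\<lambda>z. (1 - fst z) *\<^sub>R u (snd z) + fst z *\<^sub>R v (snd z))"
  have "convex ?S"
    by (simp add: convex_Times)
  then have "k z \<in> ?S" if "z \<in> ?S" for z
    unfolding k_def using that assms(4,5) by (intro convexD) auto
  moreover have "continuous_on ?S k"
    unfolding k_def
    by (intro continuous_intros continuous_on_compose2[OF assms(2)]
        continuous_on_compose2[OF assms(3)]) auto
  ultimately have "continuous_map (top_of_set ?S) (top_of_set ?S) k"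
    by (simp add: image_subset_iff)
  then have "continuous_map (top_of_set ?S) X (h \<circ> k)"
    using h unfolding prod_topology_subtopology_eu by (rule continuous_map_compose)
  moreover have "k (0, t) = u t" "k (1, t) = v t" "k (s, 0) = u 0" "k (s, 1) = u 1" for s t
    by (simp_all add: k_def assms(6,7) flip: scaleR_left_distrib)
  ultimately show ?thesis
    unfolding path_homotopic_iff
    by (intro exI[of _ "h \<circ> k"]) (simp add: p q)
qed

text \<open>Take \<open>h\<close> independent of its first coordinate. A groupoid law then amounts
  to writing both sides as one path run with two parameters that agree at 0 and 1.\<close>

lemma path_homotopic_reparam:
  assumes "pathin X r" "continuous_on {0..1} u" "continuous_on {0..1} v"
    and "u ` {0..1} \<subseteq> {0..1}" "v ` {0..1} \<subseteq> {0..1}"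
    and "u 0 = v 0" "u 1 = v 1"
    and "\<And>t. t \<in> {0..1} \<Longrightarrow> p t = r (u t)" "\<And>t. t \<in> {0..1} \<Longrightarrow> q t = r (v t)"
  shows "path_homotopic X p q"
proof (rule path_homotopic_square[of X "r \<circ> snd" "\<lambda>t. (0, u t)" "\<lambda>t. (0, v t)"])
  show "continuous_map (prod_topology unit_space unit_space) X (r \<circ> snd)"
    using assms(1) unfolding pathin_def
    by (metis continuous_map_compose continuous_map_snd)
qed (use assms in \<open>auto intro!: continuous_intros\<close>)

lemma path_homotopic_eq:
  assumes "pathin X p" "\<And>t. t \<in> {0..1} \<Longrightarrow> p t = q t"
  shows "path_homotopic X p q"
  by (rule path_homotopic_reparam[OF assms(1), of "\<lambda>t. t" "\<lambda>t. t"])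
     (use assms(2) in \<open>auto intro!: continuous_intros\<close>)

lemma path_homotopic_compose:
  assumes "path_homotopic X p q" "continuous_map X Y f"
  shows "path_homotopic Y (f \<circ> p) (f \<circ> q)"
  unfolding path_homotopic_def
  by (rule homotopic_with_compose_continuous_map_left[OF assms[unfolded path_homotopic_def]]) auto

lemma path_join_simps [simp]:
  "path_join p q 0 = p 0" "path_join p q 1 = q 1" "path_rev p 0 = p 1" "path_rev p 1 = p 0"
  by (auto simp: path_join_def path_rev_def)

lemma path_join_compose: "f \<circ> path_join p q = path_join (f \<circ> p) (f \<circ> q)"
  by (auto simp: path_join_def)

lemma path_rev_compose: "f \<circ> path_rev p = path_rev (f \<circ> p)"
  by (auto simp: path_rev_def)

lemma path_homotopic_join:
  assumes "path_homotopic X p p'" "path_homotopic X q q'" "p 1 = q 0"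
  shows "path_homotopic X (path_join p q) (path_join p' q')"
proof -
  obtain h where h: "continuous_map (prod_topology unit_space unit_space) X h"
    "\<And>t. t \<in> {0..1} \<Longrightarrow> h (0, t) = p t \<and> h (1, t) = p' t"
    "\<And>s. s \<in> {0..1} \<Longrightarrow> h (s, 0) = p 0 \<and> h (s, 1) = p 1"
    using assms(1) unfolding path_homotopic_iff by blast
  obtain k where k: "continuous_map (prod_topology unit_space unit_space) X k"
    "\<And>t. t \<in> {0..1} \<Longrightarrow> k (0, t) = q t \<and> k (1, t) = q' t"
    "\<And>s. s \<in> {0..1} \<Longrightarrow> k (s, 0) = q 0 \<and> k (s, 1) = q 1"
    using assms(2) unfolding path_homotopic_iff by blast
  let ?S = "{0..1::real} \<times> {0..1::real}"
  let ?m = "\<lambda>z. if snd z \<le> 1/2 then (h \<circ> (\<lambda>z. (fst z, 2 * snd z))) z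
                  else (k \<circ> (\<lambda>z. (fst z, 2 * snd z - 1))) z"
  have "continuous_map (top_of_set ?S) X ?m"
  proof (rule continuous_map_cases_le)
    show "continuous_map (subtopology (top_of_set ?S) {x \<in> topspace (top_of_set ?S). snd x \<le> 1 / 2}) X
            (h \<circ> (\<lambda>z. (fst z, 2 * snd z)))"
      by (rule continuous_map_compose[OF _ h(1)])
         (auto simp: subtopology_subtopology intro!: continuous_intros)
    show "continuous_map (subtopology (top_of_set ?S) {x \<in> topspace (top_of_set ?S). 1 / 2 \<le> snd x}) X
            (k \<circ> (\<lambda>z. (fst z, 2 * snd z - 1)))"
      by (rule continuous_map_compose[OF _ k(1)])
         (auto simp: subtopology_subtopology intro!: continuous_intros)
    show "(h \<circ> (\<lambda>z. (fst z, 2 * snd z))) z = (k \<circ> (\<lambda>z. (fst z, 2 * snd z - 1))) z"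
      if "z \<in> topspace (top_of_set ?S)" "snd z = 1 / 2" for z
    proof -
      have "2 * snd z = 1" "fst z \<in> {0..1}"
        using that by auto
      then show ?thesis
        using h(3)[of "fst z"] k(3)[of "fst z"] assms(3) by simp
    qed
  qed (auto intro!: continuous_intros)
  then show ?thesis
    unfolding path_homotopic_iff
    by (intro exI[of _ ?m]) (use h k in \<open>auto simp: path_join_def\<close>)
qed

lemma pathin_join:
  assumes "pathin X p" "pathin X q" "p 1 = q 0"
  shows "pathin X (path_join p q)"
  using path_homotopic_join[of X p p q q] assms by simp

lemma pathin_reparam:
  assumes "pathin X p" "continuous_on {0..1} u" "u ` {0..1} \<subseteq> {0..1}"
  shows "pathin X (p \<circ> u)"
  using path_homotopic_reparam[OF assms(1,2) assms(2,3,3), of "p \<circ> u" "p \<circ> u"] by simp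

lemma pathin_rev:
  assumes "pathin X p"
  shows "pathin X (path_rev p)"
  using pathin_reparam[OF assms, of "\<lambda>t. 1 - t"]
  by (simp add: path_rev_def comp_def continuous_on_diff)

lemma pathin_in_topspace: "pathin X p \<Longrightarrow> t \<in> {0..1} \<Longrightarrow> p t \<in> topspace X"
  unfolding pathin_def continuous_map_def by auto

lemma continuous_on_unit_cases:
  fixes f g :: "real \<Rightarrow> real"
  assumes "continuous_on UNIV f" "continuous_on UNIV g" "f a = g a"
  shows "continuous_on S (\<lambda>t. if t \<le> a then f t else g t)"
proof -
  have "continuous_on UNIV (\<lambda>t. if t \<le> a then f t else g t)"
    by (rule continuous_on_cases_le) (use assms in \<open>auto intro: continuous_on_subset\<close>)
  then show ?thesis
    using continuous_on_subset by blast
qed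

section \<open>Groupoid laws up to homotopy\<close>

lemma path_homotopic_assoc:
  assumes "pathin X p" "pathin X q" "pathin X r" "p 1 = q 0" "q 1 = r 0"
  shows "path_homotopic X (path_join (path_join p q) r) (path_join p (path_join q r))"
proof -
  \<comment> \<open>Sends the break points 1/2 and 3/4 of the right-bracketed join to the break
    points 1/4 and 1/2 of the left-bracketed one.\<close>
  let ?u = "\<lambda>t. if t \<le> 1/2 then t/2 else (if t \<le> 3/4 then t - 1/4 else 2 * t - (1::real))"
  have "path_homotopic X (path_join p (path_join q r)) (path_join (path_join p q) r)"
  proof (rule path_homotopic_reparam)
    show "pathin X (path_join (path_join p q) r)"
      using assms by (intro pathin_join) auto
    show "continuous_on {0..1} ?u"
      by (intro continuous_on_unit_cases continuous_intros) auto
    show "continuous_on {0..1} (\<lambda>t::real. t)"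
      by (intro continuous_intros)
    show "path_join p (path_join q r) t = path_join (path_join p q) r (?u t)" for t
      by (auto simp: path_join_def algebra_simps)
  qed auto
  then show ?thesis by (rule path_homotopic_sym)
qed

lemma path_homotopic_join_rev:
  assumes "pathin X p"
  shows "path_homotopic X (path_join p (path_rev p)) (\<lambda>t. p 0)"
proof (rule path_homotopic_reparam[OF assms(1)])
  show "continuous_on {0..1} (\<lambda>t::real. if t \<le> 1/2 then 2 * t else 2 - 2 * t :: real)"
    by (intro continuous_on_unit_cases continuous_intros) auto
  show "continuous_on {0..1} (\<lambda>t::real. 0::real)"
    by (intro continuous_intros)
qed (use assms in \<open>auto simp: path_join_def path_rev_def\<close>)

lemma path_homotopic_rev_join:
  assumes "pathin X p"
  shows "path_homotopic X (path_join (path_rev p) p) (\<lambda>t. p 1)"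
proof (rule path_homotopic_reparam[OF assms(1)])
  show "continuous_on {0..1} (\<lambda>t::real. if t \<le> 1/2 then 1 - 2 * t else 2 * t - 1 :: real)"
    by (intro continuous_on_unit_cases continuous_intros) auto
  show "continuous_on {0..1} (\<lambda>t::real. 1::real)"
    by (intro continuous_intros)
qed (use assms in \<open>auto simp: path_join_def path_rev_def\<close>)

lemma path_homotopic_const_join:
  assumes "pathin X p" "x = p 0"
  shows "path_homotopic X (path_join (\<lambda>t. x) p) p"
proof (rule path_homotopic_reparam[OF assms(1)])
  show "continuous_on {0..1} (\<lambda>t::real. if t \<le> 1/2 then 0 else 2 * t - 1 :: real)"
    by (intro continuous_on_unit_cases continuous_intros) auto
  show "continuous_on {0..1} (\<lambda>t::real. t::real)"
    by (intro continuous_intros)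
qed (use assms in \<open>auto simp: path_join_def path_rev_def\<close>)

lemma path_homotopic_join_const:
  assumes "pathin X p" "x = p 1"
  shows "path_homotopic X (path_join p (\<lambda>t. x)) p"
proof (rule path_homotopic_reparam[OF assms(1)])
  show "continuous_on {0..1} (\<lambda>t::real. if t \<le> 1/2 then 2 * t else 1 :: real)"
    by (intro continuous_on_unit_cases continuous_intros) auto
  show "continuous_on {0..1} (\<lambda>t::real. t::real)"
    by (intro continuous_intros)
qed (use assms in \<open>auto simp: path_join_def path_rev_def\<close>)

section \<open>Affine subdivision of paths\<close>

definition segment_map :: "real \<Rightarrow> real \<Rightarrow> real \<Rightarrow> real" where
  "segment_map a b t = a + (b - a) * t"

lemma segment_map_simps [simp]: "segment_map a b 0 = a" "segment_map a b 1 = b"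
  by (auto simp: segment_map_def)

lemma segment_map_mem:
  assumes "a \<le> b" "t \<in> {0..1}"
  shows "segment_map a b t \<in> {a..b}"
proof -
  have "(b - a) * t \<le> (b - a) * 1"
    using assms by (intro mult_left_mono) auto
  then show ?thesis
    using assms by (simp add: segment_map_def)
qed

lemma continuous_on_segment_map: "continuous_on S (segment_map a b)"
  unfolding segment_map_def by (intro continuous_intros)

lemma pathin_segment:
  assumes "pathin X p" "0 \<le> a" "a \<le> b" "b \<le> 1"
  shows "pathin X (p \<circ> segment_map a b)"
proof (rule pathin_reparam[OF assms(1) continuous_on_segment_map])
  show "segment_map a b ` {0..1} \<subseteq> {0..1}"
    using segment_map_mem[OF assms(3)] assms(2,4) by fastforce
qed

lemma path_homotopic_segments:
  assumes "pathin X p" "0 \<le> a" "a \<le> b" "b \<le> c" "c \<le> 1"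
  shows "path_homotopic X (path_join (p \<circ> segment_map a b) (p \<circ> segment_map b c))
           (p \<circ> segment_map a c)"
proof (rule path_homotopic_reparam[OF assms(1)])
  let ?u = "\<lambda>t. if t \<le> 1/2 then segment_map a b (2 * t) else segment_map b c (2 * t - 1)"
  show "continuous_on {0..1} ?u"
    by (rule continuous_on_unit_cases)
       (auto simp: segment_map_def intro!: continuous_intros)
  show "?u ` {0..1} \<subseteq> {0..1}"
  proof safe
    fix t :: real assume t: "t \<in> {0..1}"
    show "?u t \<in> {0..1}"
    proof (cases "t \<le> 1/2")
      case True
      then show ?thesis
        using segment_map_mem[of a b "2 * t"] assms t by auto
    next
      case False
      then show ?thesis
        using segment_map_mem[of b c "2 * t - 1"] assms t by auto
    qed
  qed
  show "segment_map a c ` {0..1} \<subseteq> {0..1}"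
    using segment_map_mem[of a c] assms by fastforce
qed (auto simp: path_join_def continuous_on_segment_map)


section \<open>The fundamental group\<close>

text \<open>\<open>loops\<close> asks for extensional maps, which the constant
  \<open>\<lambda>t. x0\<close> and composites \<open>f \<circ> p\<close> need not be. Without that
  condition representatives can be manipulated freely; \<open>restrict\<close> leads back to
  \<open>loops\<close> within the same class.\<close>

definition based_loop :: "'a topology \<Rightarrow> 'a \<Rightarrow> (real \<Rightarrow> 'a) \<Rightarrow> bool" where
  "based_loop X x0 p \<longleftrightarrow> pathin X p \<and> p 0 = x0 \<and> p 1 = x0"

lemma based_loop_restrict: "based_loop X x0 p \<Longrightarrow> restrict p {0..1} \<in> loops X x0"
  by (auto simp: based_loop_def loops_def map_space_def pathin_def intro: continuous_map_eq)

lemma loops_imp_based_loop: "p \<in> loops X x0 \<Longrightarrow> based_loop X x0 p"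
  by (auto simp: based_loop_def loops_def map_space_def pathin_def)

lemma loop_class_iff:
  assumes "based_loop X x0 p"
  shows "q \<in> loop_class X x0 p \<longleftrightarrow> q \<in> loops X x0 \<and> path_homotopic X p q"
  using assms by (auto simp: loop_class_def path_homotopic_def based_loop_def)

lemma path_homotopic_restrict:
  assumes "based_loop X x0 p"
  shows "path_homotopic X p (restrict p {0..1})"
  by (rule path_homotopic_eq) (use assms in \<open>auto simp: based_loop_def\<close>)

lemma restrict_in_loop_class:
  assumes "based_loop X x0 p"
  shows "restrict p {0..1} \<in> loop_class X x0 p"
  using assms by (simp add: loop_class_iff based_loop_restrict path_homotopic_restrict)

lemma loop_class_eq_iff:
  assumes "based_loop X x0 p" "based_loop X x0 q"
  shows "loop_class X x0 p = loop_class X x0 q \<longleftrightarrow> path_homotopic X p q"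
proof
  assume "loop_class X x0 p = loop_class X x0 q"
  then have "path_homotopic X p (restrict q {0..1})"
    using restrict_in_loop_class[OF assms(2)] loop_class_iff[OF assms(1)] by auto
  then show "path_homotopic X p q"
    using path_homotopic_restrict[OF assms(2)] path_homotopic_sym path_homotopic_trans by blast
next
  assume "path_homotopic X p q"
  then show "loop_class X x0 p = loop_class X x0 q"
    using loop_class_iff[OF assms(1)] loop_class_iff[OF assms(2)]
      path_homotopic_sym path_homotopic_trans by blast
qed

lemma loop_class_cong:
  assumes "based_loop X x0 p" "path_homotopic X p q"
  shows "loop_class X x0 p = loop_class X x0 q"
proof -
  have "based_loop X x0 q"
    using assms path_homotopic_imp_ends[OF assms(2)] path_homotopic_imp_pathin[OF assms(2)]
    by (simp add: based_loop_def)
  then show ?thesis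
    using assms by (simp add: loop_class_eq_iff)
qed

lemma based_loop_join:
  assumes "based_loop X x0 p" "based_loop X x0 q"
  shows "based_loop X x0 (path_join p q)"
  using assms by (auto simp: based_loop_def pathin_join)

lemma based_loop_rev: "based_loop X x0 p \<Longrightarrow> based_loop X x0 (path_rev p)"
  by (auto simp: based_loop_def pathin_rev)

lemma based_loop_const: "x0 \<in> topspace X \<Longrightarrow> based_loop X x0 (\<lambda>t. x0)"
  by (auto simp: based_loop_def)

lemma carrier_fundamental_group:
  "carrier (fundamental_group X x0) = loop_class X x0 ` {p. based_loop X x0 p}"
proof -
  have "loop_class X x0 p \<in> loop_class X x0 ` loops X x0" if "based_loop X x0 p" for p
    using loop_class_cong[OF that path_homotopic_restrict[OF that]] based_loop_restrict[OF that]
    by blast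
  then show ?thesis
    unfolding fundamental_group_def using loops_imp_based_loop by fastforce
qed

lemma loop_class_carrier [intro]:
  "based_loop X x0 p \<Longrightarrow> loop_class X x0 p \<in> carrier (fundamental_group X x0)"
  by (auto simp: carrier_fundamental_group)

lemma one_fundamental_group: "\<one>\<^bsub>fundamental_group X x0\<^esub> = loop_class X x0 (\<lambda>t. x0)"
  by (simp add: fundamental_group_def)

lemma loop_class_mult:
  assumes "based_loop X x0 p" "based_loop X x0 q"
  shows "loop_class X x0 p \<otimes>\<^bsub>fundamental_group X x0\<^esub> loop_class X x0 q =
           loop_class X x0 (path_join p q)"
proof -
  have "loop_class X x0 (path_join p' q') = loop_class X x0 (path_join p q)"
    if "p' \<in> loop_class X x0 p" "q' \<in> loop_class X x0 q" for p' q'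
  proof -
    have "path_homotopic X (path_join p q) (path_join p' q')"
      using that assms by (auto simp: loop_class_iff based_loop_def intro!: path_homotopic_join)
    then show ?thesis
      using assms by (metis based_loop_join loop_class_cong)
  qed
  \<comment> \<open>The union defining the product runs over equal sets, so it equals each of them
    only because both classes are nonempty.\<close>
  moreover have "loop_class X x0 p \<noteq> {}" "loop_class X x0 q \<noteq> {}"
    using restrict_in_loop_class[OF assms(1)] restrict_in_loop_class[OF assms(2)] by auto
  ultimately show ?thesis
    by (auto simp: fundamental_group_def)
qed

lemma group_fundamental_group:
  assumes "x0 \<in> topspace X"
  shows "group (fundamental_group X x0)"
proof (rule groupI)
  let ?G = "fundamental_group X x0"
  note c = based_loop_const[OF assms]
  show "\<one>\<^bsub>?G\<^esub> \<in> carrier ?G"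
    using c by (auto simp: one_fundamental_group)
  show "a \<otimes>\<^bsub>?G\<^esub> b \<in> carrier ?G" if "a \<in> carrier ?G" "b \<in> carrier ?G" for a b
    using that by (auto simp: carrier_fundamental_group loop_class_mult based_loop_join)
  show "a \<otimes>\<^bsub>?G\<^esub> b \<otimes>\<^bsub>?G\<^esub> d = a \<otimes>\<^bsub>?G\<^esub> (b \<otimes>\<^bsub>?G\<^esub> d)"
    if "a \<in> carrier ?G" "b \<in> carrier ?G" "d \<in> carrier ?G" for a b d
    using that unfolding carrier_fundamental_group
    by (clarsimp simp: loop_class_mult based_loop_join loop_class_eq_iff)
       (simp add: based_loop_def path_homotopic_assoc)
  show "\<one>\<^bsub>?G\<^esub> \<otimes>\<^bsub>?G\<^esub> a = a" if "a \<in> carrier ?G" for a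
    using that c unfolding carrier_fundamental_group one_fundamental_group
    by (clarsimp simp: loop_class_mult based_loop_join loop_class_eq_iff)
       (simp add: based_loop_def path_homotopic_const_join)
  show "\<exists>b\<in>carrier ?G. b \<otimes>\<^bsub>?G\<^esub> a = \<one>\<^bsub>?G\<^esub>" if a: "a \<in> carrier ?G" for a
  proof -
    obtain p where p: "based_loop X x0 p" "a = loop_class X x0 p"
      using a by (auto simp: carrier_fundamental_group)
    moreover have "path_homotopic X (path_join (path_rev p) p) (\<lambda>t. x0)"
      using path_homotopic_rev_join[of X p] p by (simp add: based_loop_def)
    ultimately show ?thesis
      using c by (intro bexI[of _ "loop_class X x0 (path_rev p)"])
        (auto simp: one_fundamental_group loop_class_mult based_loop_join based_loop_rev
            loop_class_eq_iff)
  qed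
qed

lemma based_loop_compose:
  assumes "based_loop X x0 p" "continuous_map X Y f" "f x0 = y0"
  shows "based_loop Y y0 (f \<circ> p)"
  using assms by (auto simp: based_loop_def pathin_def continuous_map_compose)

lemma induced_hom_loop_class:
  assumes "continuous_map X Y f" "f x0 = y0" "based_loop X x0 p"
  shows "induced_hom Y y0 f (loop_class X x0 p) = loop_class Y y0 (f \<circ> p)"
proof -
  have "loop_class Y y0 (f \<circ> q) = loop_class Y y0 (f \<circ> p)" if "q \<in> loop_class X x0 p" for q
    using that loop_class_cong[OF based_loop_compose[OF assms(3,1,2)] path_homotopic_compose]
      assms(1) loop_class_iff[OF assms(3)] by blast
  then show ?thesis
    unfolding induced_hom_def using restrict_in_loop_class[OF assms(3)] by blast
qed

lemma induced_hom_hom: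
  assumes "continuous_map X Y f" "f x0 = y0"
  shows "induced_hom Y y0 f \<in> hom (fundamental_group X x0) (fundamental_group Y y0)"
proof (rule homI)
  show "induced_hom Y y0 f a \<in> carrier (fundamental_group Y y0)"
    if "a \<in> carrier (fundamental_group X x0)" for a
    using that assms
    by (auto simp: carrier_fundamental_group induced_hom_loop_class based_loop_compose)
  show "induced_hom Y y0 f (a \<otimes>\<^bsub>fundamental_group X x0\<^esub> b) =
      induced_hom Y y0 f a \<otimes>\<^bsub>fundamental_group Y y0\<^esub> induced_hom Y y0 f b"
    if "a \<in> carrier (fundamental_group X x0)" "b \<in> carrier (fundamental_group X x0)" for a b
    using that assms unfolding carrier_fundamental_group
    by (clarsimp simp: loop_class_mult based_loop_join induced_hom_loop_class
        based_loop_compose path_join_compose)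
qed



section \<open>Group-valued functors on paths\<close>

text \<open>The groups need not be abelian, so the factors are kept in the order in which a path
  meets its segments.\<close>

primrec seq_prod :: "('g, 'm) monoid_scheme \<Rightarrow> (nat \<Rightarrow> 'g) \<Rightarrow> nat \<Rightarrow> 'g" where
  "seq_prod G a 0 = \<one>\<^bsub>G\<^esub>"
| "seq_prod G a (Suc n) = seq_prod G a n \<otimes>\<^bsub>G\<^esub> a n"

lemma (in monoid) seq_prod_closed:
  "(\<And>i. i < n \<Longrightarrow> a i \<in> carrier G) \<Longrightarrow> seq_prod G a n \<in> carrier G"
  by (induction n) auto

lemma (in monoid) seq_prod_one:
  "(\<And>i. i < n \<Longrightarrow> a i = \<one>) \<Longrightarrow> seq_prod G a n = \<one>"
  by (induction n) auto

lemma seq_prod_cong: "(\<And>i. i < n \<Longrightarrow> a i = b i) \<Longrightarrow> seq_prod G a n = seq_prod G b n"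
  by (induction n) auto

text \<open>A row of \<open>n\<close> commuting squares with horizontal sides \<open>a\<close>, \<open>b\<close> and vertical sides \<open>v\<close>.\<close>

lemma (in monoid) seq_prod_ladder:
  assumes "\<And>i. i < n \<Longrightarrow> a i \<in> carrier G" "\<And>i. i < n \<Longrightarrow> b i \<in> carrier G"
    and "\<And>i. i \<le> n \<Longrightarrow> v i \<in> carrier G"
    and "\<And>i. i < n \<Longrightarrow> a i \<otimes> v (Suc i) = v i \<otimes> b i"
  shows "seq_prod G a n \<otimes> v n = v 0 \<otimes> seq_prod G b n"
  using assms
proof (induction n)
  case (Suc n)
  have cl: "seq_prod G a n \<in> carrier G" "seq_prod G b n \<in> carrier G"
    using Suc.prems by (auto intro!: seq_prod_closed)
  have IH: "seq_prod G a n \<otimes> v n = v 0 \<otimes> seq_prod G b n"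
    using Suc by simp
  have "seq_prod G a (Suc n) \<otimes> v (Suc n) = seq_prod G a n \<otimes> (a n \<otimes> v (Suc n))"
    using cl Suc.prems by (simp add: m_assoc)
  also have "\<dots> = (seq_prod G a n \<otimes> v n) \<otimes> b n"
    using cl Suc.prems by (simp add: m_assoc)
  also have "\<dots> = v 0 \<otimes> seq_prod G b (Suc n)"
    using cl Suc.prems by (simp add: IH m_assoc)
  finally show ?case .
qed auto

text \<open>A functor from the fundamental groupoid to a group, given on representatives. It is
  instantiated by \<open>path_elt\<close> with values in the fundamental group and by
  \<open>quotient_elt\<close> with values modulo a Spanier subgroup.\<close>

locale path_functor = group Q for Q (structure) +
  fixes X :: "'a topology" and f :: "(real \<Rightarrow> 'a) \<Rightarrow> _"
  assumes functor_closed [simp]: "pathin X p \<Longrightarrow> f p \<in> carrier Q"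
    and functor_homotopic: "path_homotopic X p q \<Longrightarrow> f p = f q"
    and functor_join: "\<lbrakk>pathin X p; pathin X q; p 1 = q 0\<rbrakk> \<Longrightarrow> f (path_join p q) = f p \<otimes> f q"
begin

text \<open>A constant path is homotopic to its join with itself, so its value is an idempotent of a
  group.\<close>

lemma functor_const: "x \<in> topspace X \<Longrightarrow> f (\<lambda>t. x) = \<one>"
  using functor_join[of "\<lambda>t. x" "\<lambda>t. x"] functor_homotopic[OF path_homotopic_const_join[of X "\<lambda>t. x" x]]
    functor_closed[of "\<lambda>t. x"]
  by simp

lemma functor_rev: "pathin X p \<Longrightarrow> f (path_rev p) = inv (f p)"
  using functor_join[of "path_rev p" p] functor_homotopic[OF path_homotopic_rev_join[of X p]]
    functor_const[of "p 1"] pathin_in_topspace[of X p 1]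
  by (intro inv_equality[symmetric]) (auto simp: pathin_rev)

lemma functor_segments:
  fixes n :: nat
  assumes p: "pathin X p" and "n > 0"
  shows "f p = seq_prod Q (\<lambda>i. f (p \<circ> segment_map (i / n) (Suc i / n))) n"
proof -
  have "f (p \<circ> segment_map 0 (k / n)) = seq_prod Q (\<lambda>i. f (p \<circ> segment_map (i / n) (Suc i / n))) k"
    if "k \<le> n" for k
    using that
  proof (induction k)
    case 0
    have "p \<circ> segment_map 0 0 = (\<lambda>t. p 0)"
      by (auto simp: segment_map_def)
    then show ?case
      using pathin_in_topspace[OF p, of 0] by (simp add: functor_const)
  next
    case (Suc k)
    have le: "0 \<le> k / n" "k / n \<le> Suc k / n" "Suc k / n \<le> 1"
      using Suc.prems by (auto simp: divide_simps)
    have "f (p \<circ> segment_map 0 (Suc k / n)) =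
        f (path_join (p \<circ> segment_map 0 (k / n)) (p \<circ> segment_map (k / n) (Suc k / n)))"
      using functor_homotopic[OF path_homotopic_segments[OF p, of 0 "k / n" "Suc k / n"]] le by simp
    also have "\<dots> = f (p \<circ> segment_map 0 (k / n)) \<otimes> f (p \<circ> segment_map (k / n) (Suc k / n))"
      using le p by (intro functor_join pathin_segment) auto
    finally show ?case
      using Suc by (simp add: comp_def)
  qed
  from this[of n] \<open>n > 0\<close> show ?thesis
    by (simp add: segment_map_def comp_def)
qed

end

section \<open>Functors that see only the ends of short paths\<close>

lemma ex_inverse_less:
  fixes e :: real
  assumes "e > 0"
  obtains n :: nat where "n > 0" "1 / n < e"
proof -
  obtain n where n: "1 / real (Suc n) < e"
    using nat_approx_posE[OF assms] by blast
  show ?thesis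
    using that[of "Suc n"] n by simp
qed

text \<open>Two members \<open>C\<close> and \<open>D\<close> occur in the last assumption because
  \<open>transport\<close> below forgets in which member its path was chosen.\<close>

locale locally_trivial_functor = path_functor +
  fixes \<C>
  assumes cover: "open_cover X \<C>"
    and path_connected_members: "C \<in> \<C> \<Longrightarrow> path_connectedin X C"
    and locally_trivial:
      "\<lbrakk>C \<in> \<C>; D \<in> \<C>; pathin X p; p \<in> {0..1} \<rightarrow> C; pathin X q; q \<in> {0..1} \<rightarrow> D; p 0 = q 0; p 1 = q 1\<rbrakk>
        \<Longrightarrow> f p = f q"
begin

text \<open>Local triviality makes the value independent of the chosen path. If no member contains a
  path from \<open>x\<close> to \<open>y\<close>, the value is arbitrary; it is used only for points
  with a common member.\<close>

definition transport where
  "transport x y = f (SOME p. pathin X p \<and> (\<exists>C\<in>\<C>. p \<in> {0..1} \<rightarrow> C) \<and> p 0 = x \<and> p 1 = y)"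

lemma functor_eq_transport:
  assumes "pathin X p" "C \<in> \<C>" "p \<in> {0..1} \<rightarrow> C"
  shows "f p = transport (p 0) (p 1)"
proof -
  let ?P = "\<lambda>r. pathin X r \<and> (\<exists>C\<in>\<C>. r \<in> {0..1} \<rightarrow> C) \<and> r 0 = p 0 \<and> r 1 = p 1"
  have "?P (SOME r. ?P r)"
    by (rule someI[of ?P p]) (use assms in blast)
  then obtain D where "pathin X (SOME r. ?P r)" "D \<in> \<C>" "(SOME r. ?P r) \<in> {0..1} \<rightarrow> D"
    "(SOME r. ?P r) 0 = p 0" "(SOME r. ?P r) 1 = p 1"
    by blast
  then show ?thesis
    unfolding transport_def using assms by (intro locally_trivial[of C D]) auto
qed

lemma transport_path:
  assumes "C \<in> \<C>" "x \<in> C" "y \<in> C"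
  obtains p where "pathin X p" "p \<in> {0..1} \<rightarrow> C" "p 0 = x" "p 1 = y" "f p = transport x y"
proof -
  obtain p where "pathin X p" "p \<in> {0..1} \<rightarrow> C" "p 0 = x" "p 1 = y"
    using path_connected_members[OF assms(1)] assms(2,3) unfolding path_connectedin by blast
  then show ?thesis
    using that[of p] functor_eq_transport[of p C] assms(1) by simp
qed

lemma transport_closed: "\<lbrakk>C \<in> \<C>; x \<in> C; y \<in> C\<rbrakk> \<Longrightarrow> transport x y \<in> carrier Q"
  using transport_path functor_closed by metis

lemma transport_trans:
  assumes "C \<in> \<C>" "x \<in> C" "y \<in> C" "z \<in> C"
  shows "transport x y \<otimes> transport y z = transport x z"
proof -
  obtain p where p: "pathin X p" "p \<in> {0..1} \<rightarrow> C" "p 0 = x" "p 1 = y" "f p = transport x y"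
    using transport_path assms by metis
  obtain q where q: "pathin X q" "q \<in> {0..1} \<rightarrow> C" "q 0 = y" "q 1 = z" "f q = transport y z"
    using transport_path assms by metis
  have "path_join p q \<in> {0..1} \<rightarrow> C"
    using p(2) q(2) by (auto simp: path_join_def Pi_iff)
  then have "f (path_join p q) = transport x z"
    using functor_eq_transport[of "path_join p q" C] p q assms by (simp add: pathin_join)
  then show ?thesis
    using functor_join[of p q] p q by simp
qed

lemma transport_refl: "x \<in> topspace X \<Longrightarrow> transport x x = \<one>"
proof -
  assume "x \<in> topspace X"
  then obtain C where "C \<in> \<C>" "x \<in> C"
    using cover by (auto simp: open_cover_def)
  then show ?thesis
    using transport_trans[of C x x x] transport_closed[of C x x] by simp
qed

text \<open>Subdivision rewrites \<open>f p\<close> in terms of sample points alone. This is what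
  later allows a null homotopy to be replaced by a discontinuous map.\<close>

lemma functor_eq_transports:
  fixes n :: nat
  assumes p: "pathin X p" and "n > 0"
    and "\<And>i. i < n \<Longrightarrow> \<exists>C\<in>\<C>. p ` {i / n..Suc i / n} \<subseteq> C"
  shows "f p = seq_prod Q (\<lambda>i. transport (p (i / n)) (p (Suc i / n))) n"
proof -
  have "f (p \<circ> segment_map (i / n) (Suc i / n)) = transport (p (i / n)) (p (Suc i / n))"
    if i: "i < n" for i
  proof -
    have le: "0 \<le> i / n" "i / n \<le> Suc i / n" "Suc i / n \<le> 1"
      using i by (auto simp: divide_simps)
    obtain C where C: "C \<in> \<C>" "p ` {i / n..Suc i / n} \<subseteq> C"
      using assms(3) i by blast
    then have "p \<circ> segment_map (i / n) (Suc i / n) \<in> {0..1} \<rightarrow> C"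
      using segment_map_mem[OF le(2)] by fastforce
    then show ?thesis
      using functor_eq_transport[OF pathin_segment[OF p le] C(1)] by simp
  qed
  then show ?thesis
    unfolding functor_segments[OF assms(1,2)] by (intro seq_prod_cong) blast
qed

text \<open>The sample points of the two paths form a ladder. Each cell has its corners in one
  member, so it commutes by \<open>transport_trans\<close>; the common ends make the outer rungs
  trivial.\<close>

lemma functor_eq_of_close:
  fixes n :: nat
  assumes "pathin X p" "pathin X q" "p 0 = q 0" "p 1 = q 1" and "n > 0"
    and C: "\<And>i. i < n \<Longrightarrow> \<exists>C\<in>\<C>. p ` {i / n..Suc i / n} \<union> q ` {i / n..Suc i / n} \<subseteq> C"
  shows "f p = f q"
proof -
  let ?a = "\<lambda>i. transport (p (real i / n)) (p (Suc i / n))"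
  let ?b = "\<lambda>i. transport (q (real i / n)) (q (Suc i / n))"
  let ?v = "\<lambda>i. transport (p (real i / n)) (q (real i / n))"
  have mem: "\<exists>C\<in>\<C>. {p (i / n), p (Suc i / n), q (i / n), q (Suc i / n)} \<subseteq> C" if i: "i < n" for i
  proof -
    obtain D where D: "D \<in> \<C>" "p ` {i / n..Suc i / n} \<union> q ` {i / n..Suc i / n} \<subseteq> D"
      using C[OF i] by (elim bexE)
    have "i / n \<in> {i / n..Suc i / n}" "Suc i / n \<in> {i / n..Suc i / n}"
      by (auto simp: divide_simps)
    then show ?thesis
      using D by (intro bexI[of _ D]) (simp_all add: image_subset_iff)
  qed
  have "seq_prod Q ?a n \<otimes> ?v n = ?v 0 \<otimes> seq_prod Q ?b n"
  proof (rule seq_prod_ladder)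
    fix i assume i: "i < n"
    obtain C where C: "C \<in> \<C>" "{p (i / n), p (Suc i / n), q (i / n), q (Suc i / n)} \<subseteq> C"
      using mem[OF i] by blast
    then show "?a i \<in> carrier Q" "?b i \<in> carrier Q"
      by (auto intro: transport_closed)
    show "?a i \<otimes> ?v (Suc i) = ?v i \<otimes> ?b i"
      using C transport_trans[OF C(1)] by simp
  next
    \<comment> \<open>A rung with \<open>i > 0\<close> is seen as the far side of cell
      \<open>i - 1\<close>, since no cell starts at rung \<open>n\<close>.\<close>
    fix i assume "i \<le> n"
    show "?v i \<in> carrier Q"
    proof (cases i)
      case 0
      then show ?thesis
        using mem[of 0] \<open>n > 0\<close> by (auto intro: transport_closed)
    next
      case (Suc j)
      then show ?thesis
        using mem[of j] \<open>i \<le> n\<close> by (auto intro: transport_closed)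
    qed
  qed
  moreover have "?v n = \<one>" "?v 0 = \<one>"
    using assms(1-5) pathin_in_topspace[of X q 0] pathin_in_topspace[of X q 1]
    by (auto simp: transport_refl)
  moreover have "\<exists>C\<in>\<C>. p ` {i / n..Suc i / n} \<subseteq> C" "\<exists>C\<in>\<C>. q ` {i / n..Suc i / n} \<subseteq> C"
    if "i < n" for i
    using C[OF that] by (auto simp only: Un_subset_iff)
  then have "f p = seq_prod Q ?a n" "f q = seq_prod Q ?b n"
    by (intro functor_eq_transports assms; blast)+
  ultimately show ?thesis
    using functor_closed[OF assms(1)] functor_closed[OF assms(2)] by (metis l_one r_one)
qed

text \<open>
  The map \<open>\<xi>\<close> need not be continuous: it suffices that it sends small subsets of the square into
  members of the cover. This is a discrete form of the triviality of \<open>f\<close> on null-homotopic loops.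
\<close>

lemma functor_trivial_of_grid:
  fixes \<xi> :: "real \<times> real \<Rightarrow> _"
  assumes p: "pathin X p" and "x0 \<in> topspace X" and "e > 0"
    and small: "\<And>z. z \<in> {0..1} \<times> {0..1} \<Longrightarrow> \<exists>C\<in>\<C>. \<forall>z'\<in>{0..1}\<times>{0..1}. dist z z' < e \<longrightarrow> \<xi> z' \<in> C"
    and bottom: "\<And>t. t \<in> {0..1} \<Longrightarrow> \<xi> (0, t) = p t"
    and top: "\<And>t. t \<in> {0..1} \<Longrightarrow> \<xi> (1, t) = x0"
    and sides: "\<And>s. s \<in> {0..1} \<Longrightarrow> \<xi> (s, 0) = x0" "\<And>s. s \<in> {0..1} \<Longrightarrow> \<xi> (s, 1) = x0"
  shows "f p = \<one>"
proof -
  \<comment> \<open>Half of \<open>e\<close> for each coordinate: a point of a cell differs from its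
    lower corner by at most \<open>1 / n\<close> in both.\<close>
  obtain n :: nat where n: "n > 0" "1 / n < e / 2"
    using ex_inverse_less[of "e / 2"] \<open>e > 0\<close> by auto
  define z where "z j i = (real j / n, real i / n)" for j i
  have box: "\<exists>C\<in>\<C>. \<forall>s\<in>{j / n..Suc j / n}. \<forall>t\<in>{i / n..Suc i / n}. \<xi> (s, t) \<in> C"
    if "j < n" "i < n" for i j
  proof -
    have le: "0 \<le> i / n" "Suc i / n \<le> 1" "0 \<le> j / n" "Suc j / n \<le> 1" "i / n \<le> 1" "j / n \<le> 1"
      using that by (auto simp: divide_simps)
    then have "z j i \<in> {0..1} \<times> {0..1}"
      by (auto simp: z_def)
    from small[OF this] obtain C
      where C: "C \<in> \<C>" "\<forall>z'\<in>{0..1}\<times>{0..1}. dist (z j i) z' < e \<longrightarrow> \<xi> z' \<in> C"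
      by (elim bexE)
    have "\<xi> (s, t) \<in> C" if st: "s \<in> {j / n..Suc j / n}" "t \<in> {i / n..Suc i / n}" for s t
    proof -
      have "\<bar>j / n - s\<bar> \<le> 1 / n" "\<bar>i / n - t\<bar> \<le> 1 / n"
        using st by (auto simp: add_divide_distrib)
      moreover have "dist (z j i) (s, t) \<le> \<bar>j / n - s\<bar> + \<bar>i / n - t\<bar>"
        using sqrt_sum_squares_le_sum_abs by (simp add: z_def dist_Pair_Pair dist_real_def)
      ultimately have "dist (z j i) (s, t) < e"
        using n(2) by simp
      then show ?thesis
        using C(2) order_trans[OF le(3), of s] order_trans[OF le(1), of t]
          order_trans[OF _ le(4), of s] order_trans[OF _ le(2), of t] st by auto
    qed
    then show ?thesis
      using C(1) by blast
  qed
  have corners: "\<exists>C\<in>\<C>. {\<xi> (z j i), \<xi> (z (Suc j) i), \<xi> (z j (Suc i)), \<xi> (z (Suc j) (Suc i))} \<subseteq> C"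
    if "j < n" "i < n" for i j
  proof -
    from box[OF that] obtain C
      where C: "C \<in> \<C>" "\<forall>s\<in>{j / n..Suc j / n}. \<forall>t\<in>{i / n..Suc i / n}. \<xi> (s, t) \<in> C"
      by (elim bexE)
    have "i / n \<in> {i / n..Suc i / n}" "Suc i / n \<in> {i / n..Suc i / n}" for i
      by (auto simp: divide_simps)
    then show ?thesis
      using C unfolding z_def by (intro bexI[OF _ C(1)]) (simp add: Ball_def)
  qed
  let ?h = "\<lambda>j i. transport (\<xi> (z j i)) (\<xi> (z j (Suc i)))"
  let ?v = "\<lambda>j i. transport (\<xi> (z j i)) (\<xi> (z (Suc j) i))"
  have h_closed: "?h j i \<in> carrier Q" if "j \<le> n" "i < n" for i j
  \<comment> \<open>No cell starts at row \<open>n\<close>, which is only the far side of the cells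
    starting at row \<open>n - 1\<close>.\<close>
  proof (cases "j = n")
    case True
    then show ?thesis
      using corners[of "n - 1" i] that n by (auto intro: transport_closed)
  next
    case False
    then show ?thesis
      using corners[of j i] that by (auto intro: transport_closed)
  qed
  have v_closed: "?v j i \<in> carrier Q" if "j < n" "i \<le> n" for i j
  proof (cases "i = n")
    case True
    then show ?thesis
      using corners[of j "n - 1"] that n by (auto intro: transport_closed)
  next
    case False
    then show ?thesis
      using corners[of j i] that by (auto intro: transport_closed)
  qed
  \<comment> \<open>Adjacent rows form a ladder whose outer rungs are transports from
    \<open>x0\<close> to itself, so all rows have the same product.\<close>
  have row: "seq_prod Q (?h j) n = seq_prod Q (?h (Suc j)) n" if j: "j < n" for j
  proof -
    have "seq_prod Q (?h j) n \<otimes> ?v j n = ?v j 0 \<otimes> seq_prod Q (?h (Suc j)) n"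
    proof (rule seq_prod_ladder)
      fix i assume i: "i < n"
      obtain C where "C \<in> \<C>"
        "{\<xi> (z j i), \<xi> (z (Suc j) i), \<xi> (z j (Suc i)), \<xi> (z (Suc j) (Suc i))} \<subseteq> C"
        using corners[OF j i] by blast
      then show "?h j i \<otimes> ?v j (Suc i) = ?v j i \<otimes> ?h (Suc j) i"
        by (simp add: transport_trans)
    qed (use j h_closed v_closed in auto)
    moreover have "\<xi> (z j' n) = x0" "\<xi> (z j' 0) = x0" if "j' \<le> n" for j'
      using sides n(1) that by (auto simp: z_def)
    then have "?v j n = \<one>" "?v j 0 = \<one>"
      using j \<open>x0 \<in> topspace X\<close> by (auto simp: transport_refl)
    moreover have "seq_prod Q (?h j) n \<in> carrier Q" "seq_prod Q (?h (Suc j)) n \<in> carrier Q"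
      using h_closed j by (auto intro!: seq_prod_closed)
    ultimately show ?thesis by simp
  qed
  have "f p = seq_prod Q (\<lambda>i. transport (p (i / n)) (p (Suc i / n))) n"
  proof (rule functor_eq_transports[OF p n(1)])
    fix i assume i: "i < n"
    have sub: "{i / n..Suc i / n} \<subseteq> {0..1}"
      using i by (auto simp: divide_simps)
    from box[OF n(1) i] obtain C
      where C: "C \<in> \<C>" "\<forall>s\<in>{real 0 / n..Suc 0 / n}. \<forall>t\<in>{i / n..Suc i / n}. \<xi> (s, t) \<in> C"
      by (elim bexE)
    show "\<exists>C\<in>\<C>. p ` {i / n..Suc i / n} \<subseteq> C"
    proof (intro bexI)
      show "p ` {i / n..Suc i / n} \<subseteq> C"
      proof (rule image_subsetI)
        fix t assume "t \<in> {i / n..Suc i / n}"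
        then show "p t \<in> C"
          using bottom[of t] bspec[OF bspec[OF C(2), of 0], of t] subsetD[OF sub, of t] by simp
      qed
    qed (rule C)
  qed
  also have "\<dots> = seq_prod Q (?h 0) n"
    by (intro seq_prod_cong) (use bottom in \<open>auto simp: z_def\<close>)
  also have "\<dots> = seq_prod Q (?h j) n" if "j \<le> n" for j
    using that by (induction j) (auto simp: row)
  also have "seq_prod Q (?h n) n = \<one>"
  proof (rule seq_prod_one)
    fix i assume i: "i < n"
    then have "\<xi> (z n i) = x0" "\<xi> (z n (Suc i)) = x0"
      using top n(1) by (auto simp: z_def)
    then show "?h n i = \<one>"
      using \<open>x0 \<in> topspace X\<close> by (simp add: transport_refl)
  qed
  finally show ?thesis by simp
qed

end


section \<open>Spanier groups\<close>

text \<open>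
  A choice of paths from the base point turns the fundamental groupoid into a functor with values
  in the fundamental group, in which all path algebra can then be done.
\<close>

locale path_choice =
  fixes X :: "'a topology" and x0 :: 'a and \<tau> :: "'a \<Rightarrow> real \<Rightarrow> 'a"
  assumes base: "x0 \<in> topspace X" and \<tau>_base: "\<tau> x0 = (\<lambda>t. x0)"
    and \<tau>_path: "x \<in> topspace X \<Longrightarrow> pathin X (\<tau> x)"
    and \<tau>_start: "x \<in> topspace X \<Longrightarrow> \<tau> x 0 = x0" and \<tau>_end: "x \<in> topspace X \<Longrightarrow> \<tau> x 1 = x"
begin

abbreviation "\<pi>\<^sub>1 \<equiv> fundamental_group X x0"

text \<open>The bracketing is that of the Spanier generators, so for a loop in a member of a cover
  \<open>path_elt\<close> is literally the class of a generator.\<close>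

definition based :: "(real \<Rightarrow> 'a) \<Rightarrow> (real \<Rightarrow> 'a)" where
  "based p = path_join (path_join (\<tau> (p 0)) p) (path_rev (\<tau> (p 1)))"

definition path_elt :: "(real \<Rightarrow> 'a) \<Rightarrow> (real \<Rightarrow> 'a) set" where
  "path_elt p = loop_class X x0 (based p)"

lemma based_loop_based: "pathin X p \<Longrightarrow> based_loop X x0 (based p)"
  using pathin_in_topspace[of X p 0] pathin_in_topspace[of X p 1]
  by (auto simp: based_def based_loop_def \<tau>_path \<tau>_start \<tau>_end intro!: pathin_join pathin_rev)

lemma path_homotopic_based:
  assumes "path_homotopic X p q"
  shows "path_homotopic X (based p) (based q)"
  using path_homotopic_imp_pathin[OF assms] path_homotopic_imp_ends[OF assms] assms
    pathin_in_topspace[of X p 0] pathin_in_topspace[of X p 1]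
  unfolding based_def
  by (auto intro!: path_homotopic_join pathin_rev simp: \<tau>_path \<tau>_end)

text \<open>The return path of the first factor cancels against the outgoing path of the second:
  both are the chosen path to the point \<open>p 1 = q 0\<close>.\<close>

lemma path_homotopic_based_join:
  assumes "pathin X p" "pathin X q" "p 1 = q 0"
  shows "path_homotopic X (path_join (based p) (based q)) (based (path_join p q))"
proof -
  define a b c where "a = \<tau> (p 0)" and "b = \<tau> (q 0)" and "c = path_rev (\<tau> (q 1))"
  define b' where "b' = path_rev b"
  have paths: "pathin X a" "pathin X b" "pathin X c" "pathin X b'"
    and ends: "a 1 = p 0" "b 1 = q 0" "b 0 = x0" "c 0 = q 1" "b' 0 = q 0" "b' 1 = x0"
    using pathin_in_topspace[OF assms(1), of 0] pathin_in_topspace[OF assms(2), of 0]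
      pathin_in_topspace[OF assms(2), of 1]
    by (auto simp: a_def b_def b'_def c_def \<tau>_path \<tau>_start \<tau>_end pathin_rev)
  note simps = paths ends assms pathin_join
  have "path_homotopic X (path_join b' (path_join (path_join b q) c)) (path_join b' (path_join b (path_join q c)))"
    by (intro path_homotopic_join path_homotopic_assoc) (simp_all add: simps)
  also have "path_homotopic X \<dots> (path_join (path_join b' b) (path_join q c))"
    by (intro path_homotopic_sym[OF path_homotopic_assoc]) (simp_all add: simps)
  also have "path_homotopic X \<dots> (path_join (\<lambda>t. q 0) (path_join q c))"
    using path_homotopic_rev_join[OF paths(2)]
    by (intro path_homotopic_join) (simp_all add: simps b'_def)
  also have "path_homotopic X \<dots> (path_join q c)"
    by (intro path_homotopic_const_join) (simp_all add: simps)
  finally have *: "path_homotopic X (path_join b' (path_join (path_join b q) c)) (path_join q c)" .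
  have "path_homotopic X (path_join (path_join (path_join a p) b') (path_join (path_join b q) c))
      (path_join (path_join a p) (path_join b' (path_join (path_join b q) c)))"
    by (intro path_homotopic_assoc) (simp_all add: simps)
  also have "path_homotopic X \<dots> (path_join (path_join a p) (path_join q c))"
    by (intro path_homotopic_join *) (simp_all add: simps)
  also have "path_homotopic X \<dots> (path_join (path_join (path_join a p) q) c)"
    by (intro path_homotopic_sym[OF path_homotopic_assoc]) (simp_all add: simps)
  also have "path_homotopic X \<dots> (path_join (path_join a (path_join p q)) c)"
    by (intro path_homotopic_join path_homotopic_assoc) (simp_all add: simps)
  finally show ?thesis
    using assms(3) by (simp add: based_def a_def b_def b'_def c_def)
qed

sublocale G: group \<pi>\<^sub>1
  by (rule group_fundamental_group[OF base])

sublocale G: path_functor \<pi>\<^sub>1 X path_elt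
proof
  show "path_elt p \<in> carrier \<pi>\<^sub>1" if "pathin X p" for p
    using based_loop_based[OF that] by (auto simp: path_elt_def)
  show "path_elt p = path_elt q" if "path_homotopic X p q" for p q
    using path_homotopic_based[OF that] based_loop_based path_homotopic_imp_pathin[OF that]
    by (simp add: path_elt_def loop_class_eq_iff)
  show "path_elt (path_join p q) = path_elt p \<otimes>\<^bsub>\<pi>\<^sub>1\<^esub> path_elt q"
    if "pathin X p" "pathin X q" "p 1 = q 0" for p q
    using path_homotopic_based_join[OF that] that based_loop_based[OF pathin_join[OF that]]
    by (simp add: path_elt_def loop_class_mult loop_class_eq_iff based_loop_based based_loop_join
        path_homotopic_sym)
qed

text \<open>Here the constant choice of path at \<open>x0\<close> matters: for a loop at
  \<open>x0\<close>, \<open>based\<close> adds only constant paths.\<close>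

lemma path_elt_loop:
  assumes "based_loop X x0 p"
  shows "path_elt p = loop_class X x0 p"
proof -
  have p: "pathin X p" "p 0 = x0" "p 1 = x0"
    using assms by (auto simp: based_loop_def)
  have c: "path_rev (\<lambda>t. x0) = (\<lambda>t. x0)"
    by (auto simp: path_rev_def)
  have "path_homotopic X (path_join (path_join (\<lambda>t. x0) p) (\<lambda>t. x0)) (path_join (\<lambda>t. x0) p)"
    using p base by (intro path_homotopic_join_const pathin_join) auto
  also have "path_homotopic X \<dots> p"
    using p by (intro path_homotopic_const_join) auto
  finally have "path_homotopic X (based p) p"
    by (simp add: based_def p \<tau>_base c)
  then show ?thesis
    using assms p by (simp add: path_elt_def loop_class_eq_iff based_loop_based)
qed

lemma carrier_eq_path_elt: "carrier \<pi>\<^sub>1 = path_elt ` {p. based_loop X x0 p}"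
  by (auto simp: carrier_fundamental_group path_elt_loop image_iff)

section \<open>Spanier subgroups in terms of path classes\<close>

definition spanier_generators :: "'a set set \<Rightarrow> (real \<Rightarrow> 'a) set set" where
  "spanier_generators \<U> =
     {path_elt \<alpha> \<otimes>\<^bsub>\<pi>\<^sub>1\<^esub> path_elt \<gamma> \<otimes>\<^bsub>\<pi>\<^sub>1\<^esub> inv\<^bsub>\<pi>\<^sub>1\<^esub> path_elt \<alpha> | \<alpha> \<gamma> U.
        pathin X \<alpha> \<and> \<alpha> 0 = x0 \<and> U \<in> \<U> \<and>
        pathin (subtopology X U) \<gamma> \<and> \<gamma> 0 = \<alpha> 1 \<and> \<gamma> 1 = \<alpha> 1}"

text \<open>Although \<alpha> and \<gamma> need not be loops at \<open>x0\<close>, functoriality of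
  \<open>path_elt\<close> turns the class of a lasso into a conjugate inside the group.\<close>

lemma loop_class_conj:
  assumes "pathin X \<alpha>" "\<alpha> 0 = x0" "pathin X \<gamma>" "\<gamma> 0 = \<alpha> 1" "\<gamma> 1 = \<alpha> 1"
  shows "based_loop X x0 (path_join (path_join \<alpha> \<gamma>) (path_rev \<alpha>))"
    and "loop_class X x0 (path_join (path_join \<alpha> \<gamma>) (path_rev \<alpha>)) =
      path_elt \<alpha> \<otimes>\<^bsub>\<pi>\<^sub>1\<^esub> path_elt \<gamma> \<otimes>\<^bsub>\<pi>\<^sub>1\<^esub> inv\<^bsub>\<pi>\<^sub>1\<^esub> path_elt \<alpha>"
proof -
  show *: "based_loop X x0 (path_join (path_join \<alpha> \<gamma>) (path_rev \<alpha>))"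
    using assms by (auto simp: based_loop_def intro!: pathin_join pathin_rev)
  show "loop_class X x0 (path_join (path_join \<alpha> \<gamma>) (path_rev \<alpha>)) =
      path_elt \<alpha> \<otimes>\<^bsub>\<pi>\<^sub>1\<^esub> path_elt \<gamma> \<otimes>\<^bsub>\<pi>\<^sub>1\<^esub> inv\<^bsub>\<pi>\<^sub>1\<^esub> path_elt \<alpha>"
    using assms by (simp add: path_elt_loop[OF *, symmetric] G.functor_join G.functor_rev pathin_join pathin_rev)
qed

lemma spanier_cover_eq: "spanier_cover X x0 \<U> = generate \<pi>\<^sub>1 (spanier_generators \<U>)"
proof -
  have "{loop_class X x0 (path_join (path_join \<alpha> \<gamma>) (path_rev \<alpha>)) | \<alpha> \<gamma> U.
          pathin X \<alpha> \<and> \<alpha> 0 = x0 \<and> U \<in> \<U> \<and>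
          pathin (subtopology X U) \<gamma> \<and> \<gamma> 0 = \<alpha> 1 \<and> \<gamma> 1 = \<alpha> 1} = spanier_generators \<U>"
    unfolding spanier_generators_def
    by (intro Collect_cong ex_cong1 iffI; elim conjE; simp add: loop_class_conj(2) pathin_subtopology)
  then show ?thesis
    by (simp add: spanier_cover_def)
qed

lemma spanier_generators_carrier: "spanier_generators \<U> \<subseteq> carrier \<pi>\<^sub>1"
proof
  fix g assume "g \<in> spanier_generators \<U>"
  then obtain \<alpha> \<gamma> where "pathin X \<alpha>" "pathin X \<gamma>"
    "g = path_elt \<alpha> \<otimes>\<^bsub>\<pi>\<^sub>1\<^esub> path_elt \<gamma> \<otimes>\<^bsub>\<pi>\<^sub>1\<^esub> inv\<^bsub>\<pi>\<^sub>1\<^esub> path_elt \<alpha>"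
    unfolding spanier_generators_def pathin_subtopology by blast
  then show "g \<in> carrier \<pi>\<^sub>1"
    by simp
qed

text \<open>The generators are already closed under conjugation: conjugating by the class of a loop
  \<beta> replaces the tail \<alpha> by the join of \<beta> and \<alpha>.\<close>

lemma spanier_cover_normal: "spanier_cover X x0 \<U> \<lhd> \<pi>\<^sub>1"
  unfolding spanier_cover_eq
proof (rule G.normal_generateI[OF spanier_generators_carrier])
  fix h g
  assume "h \<in> spanier_generators \<U>" and g: "g \<in> carrier \<pi>\<^sub>1"
  then obtain \<alpha> \<gamma> U where h: "h = path_elt \<alpha> \<otimes>\<^bsub>\<pi>\<^sub>1\<^esub> path_elt \<gamma> \<otimes>\<^bsub>\<pi>\<^sub>1\<^esub> inv\<^bsub>\<pi>\<^sub>1\<^esub> path_elt \<alpha>"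
    "pathin X \<alpha>" "\<alpha> 0 = x0" "U \<in> \<U>" "pathin (subtopology X U) \<gamma>" "\<gamma> 0 = \<alpha> 1" "\<gamma> 1 = \<alpha> 1"
    by (auto simp: spanier_generators_def)
  obtain \<beta> where \<beta>: "pathin X \<beta>" "\<beta> 0 = x0" "\<beta> 1 = x0" "g = path_elt \<beta>"
    using g by (auto simp: carrier_eq_path_elt based_loop_def)
  have \<gamma>: "pathin X \<gamma>"
    using h by (simp add: pathin_subtopology)
  have "g \<otimes>\<^bsub>\<pi>\<^sub>1\<^esub> h \<otimes>\<^bsub>\<pi>\<^sub>1\<^esub> inv\<^bsub>\<pi>\<^sub>1\<^esub> g = path_elt (path_join \<beta> \<alpha>) \<otimes>\<^bsub>\<pi>\<^sub>1\<^esub> path_elt \<gamma> \<otimes>\<^bsub>\<pi>\<^sub>1\<^esub>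
      inv\<^bsub>\<pi>\<^sub>1\<^esub> path_elt (path_join \<beta> \<alpha>)"
    using h \<beta> \<gamma> by (simp add: G.functor_join G.m_assoc G.inv_mult_group)
  then show "g \<otimes>\<^bsub>\<pi>\<^sub>1\<^esub> h \<otimes>\<^bsub>\<pi>\<^sub>1\<^esub> inv\<^bsub>\<pi>\<^sub>1\<^esub> g \<in> spanier_generators \<U>"
    unfolding spanier_generators_def using h \<beta>
    by (intro CollectI exI[of _ "path_join \<beta> \<alpha>"] exI[of _ \<gamma>] exI[of _ U])
       (simp add: pathin_join)
qed

lemma path_elt_loop_in_spanier_cover:
  assumes "U \<in> \<U>" "pathin X \<gamma>" "\<gamma> \<in> {0..1} \<rightarrow> U" "\<gamma> 0 = \<gamma> 1"
  shows "path_elt \<gamma> \<in> spanier_cover X x0 \<U>"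
proof -
  let ?\<alpha> = "\<tau> (\<gamma> 0)"
  have y: "\<gamma> 0 \<in> topspace X"
    using pathin_in_topspace[OF assms(2)] by simp
  have "path_elt \<gamma> = loop_class X x0 (path_join (path_join ?\<alpha> \<gamma>) (path_rev ?\<alpha>))"
    using assms(4) by (simp add: path_elt_def based_def)
  also have "\<dots> = path_elt ?\<alpha> \<otimes>\<^bsub>\<pi>\<^sub>1\<^esub> path_elt \<gamma> \<otimes>\<^bsub>\<pi>\<^sub>1\<^esub> inv\<^bsub>\<pi>\<^sub>1\<^esub> path_elt ?\<alpha>"
    using y assms by (intro loop_class_conj) (auto simp: \<tau>_path \<tau>_start \<tau>_end)
  also have "\<dots> \<in> spanier_generators \<U>"
    unfolding spanier_generators_def using y assms
    by (intro CollectI exI[of _ ?\<alpha>] exI[of _ \<gamma>] exI[of _ U])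
       (auto simp: \<tau>_path \<tau>_start \<tau>_end pathin_subtopology)
  finally show ?thesis
    unfolding spanier_cover_eq by (rule generate.incl)
qed

lemma path_elt_diff_in_spanier_cover:
  assumes "U \<in> \<U>" "pathin X p" "p \<in> {0..1} \<rightarrow> U" "pathin X q" "q \<in> {0..1} \<rightarrow> U"
    and "p 0 = q 0" "p 1 = q 1"
  shows "path_elt p \<otimes>\<^bsub>\<pi>\<^sub>1\<^esub> inv\<^bsub>\<pi>\<^sub>1\<^esub> path_elt q \<in> spanier_cover X x0 \<U>"
proof -
  have "path_join p (path_rev q) \<in> {0..1} \<rightarrow> U"
    using assms(3,5) by (auto simp: path_join_def path_rev_def Pi_iff)
  then have "path_elt (path_join p (path_rev q)) \<in> spanier_cover X x0 \<U>"
    using assms by (intro path_elt_loop_in_spanier_cover) (auto intro: pathin_join pathin_rev)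
  then show ?thesis
    using assms by (simp add: G.functor_join G.functor_rev pathin_rev)
qed

definition quotient_elt :: "'a set set \<Rightarrow> (real \<Rightarrow> 'a) \<Rightarrow> (real \<Rightarrow> 'a) set set" where
  "quotient_elt \<U> p = spanier_cover X x0 \<U> #>\<^bsub>\<pi>\<^sub>1\<^esub> path_elt p"

lemma locally_trivial_quotient_elt:
  assumes "open_cover X \<C>" "\<And>C. C \<in> \<C> \<Longrightarrow> path_connectedin X C"
    and star: "\<And>C D. C \<in> \<C> \<Longrightarrow> D \<in> \<C> \<Longrightarrow> C \<inter> D \<noteq> {} \<Longrightarrow> \<exists>U\<in>\<U>. C \<union> D \<subseteq> U"
  shows "locally_trivial_functor (\<pi>\<^sub>1 Mod spanier_cover X x0 \<U>) X (quotient_elt \<U>) \<C>"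
proof -
  let ?N = "spanier_cover X x0 \<U>"
  interpret N: normal ?N \<pi>\<^sub>1
    by (rule spanier_cover_normal)
  show ?thesis
  proof (intro locally_trivial_functor.intro path_functor.intro N.factorgroup_is_group
      path_functor_axioms.intro locally_trivial_functor_axioms.intro assms)
    show "quotient_elt \<U> p \<in> carrier (\<pi>\<^sub>1 Mod ?N)" if "pathin X p" for p
      using that by (auto simp: quotient_elt_def carrier_FactGroup)
    show "quotient_elt \<U> p = quotient_elt \<U> q" if "path_homotopic X p q" for p q
      using G.functor_homotopic[OF that] by (simp add: quotient_elt_def)
    show "quotient_elt \<U> (path_join p q) = quotient_elt \<U> p \<otimes>\<^bsub>\<pi>\<^sub>1 Mod ?N\<^esub> quotient_elt \<U> q"
      if "pathin X p" "pathin X q" "p 1 = q 0" for p q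
      using that by (simp add: quotient_elt_def G.functor_join N.rcos_sum)
    show "quotient_elt \<U> p = quotient_elt \<U> q"
      if C: "C \<in> \<C>" "D \<in> \<C>" and p: "pathin X p" "p \<in> {0..1} \<rightarrow> C" and q: "pathin X q" "q \<in> {0..1} \<rightarrow> D"
        and ends: "p 0 = q 0" "p 1 = q 1" for C D p q
    proof -
      \<comment> \<open>The common starting point shows that the two members meet, as
        \<open>star\<close> requires.\<close>
      have "p 0 \<in> C \<inter> D"
        using funcset_mem[OF p(2), of 0] funcset_mem[OF q(2), of 0] ends by simp
      then obtain U where "U \<in> \<U>" "C \<union> D \<subseteq> U"
        using star[OF C] by blast
      then have "path_elt p \<otimes>\<^bsub>\<pi>\<^sub>1\<^esub> inv\<^bsub>\<pi>\<^sub>1\<^esub> path_elt q \<in> ?N"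
        using p q ends by (intro path_elt_diff_in_spanier_cover[of U]) auto
      then have "path_elt p \<in> ?N #>\<^bsub>\<pi>\<^sub>1\<^esub> path_elt q"
        using N.rcos_module_rev p q by simp
      then show ?thesis
        unfolding quotient_elt_def using G.repr_independence N.subgroup_axioms q by simp
    qed
  qed
qed

lemma quotient_elt_eq_one_iff:
  assumes "based_loop X x0 p"
  shows "quotient_elt \<U> p = \<one>\<^bsub>\<pi>\<^sub>1 Mod spanier_cover X x0 \<U>\<^esub> \<longleftrightarrow>
    loop_class X x0 p \<in> spanier_cover X x0 \<U>"
proof -
  interpret N: normal "spanier_cover X x0 \<U>" \<pi>\<^sub>1
    by (rule spanier_cover_normal)
  show ?thesis
    using G.coset_join1[OF _ _ N.subgroup_axioms] G.coset_join2[OF _ N.subgroup_axioms]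
      loop_class_carrier[OF assms]
    by (metis one_FactGroup path_elt_loop[OF assms] quotient_elt_def)
qed

end

lemma path_choice_exists:
  assumes "path_connected_space X" "x0 \<in> topspace X"
  shows "\<exists>\<tau>. path_choice X x0 \<tau>"
proof -
  have "\<exists>p. pathin X p \<and> p 0 = x0 \<and> p 1 = x \<and> (x = x0 \<longrightarrow> p = (\<lambda>t. x0))" if "x \<in> topspace X" for x
  proof (cases "x = x0")
    case True
    then show ?thesis
      using assms(2) by (intro exI[of _ "\<lambda>t. x0"]) simp
  next
    case False
    then show ?thesis
      using assms that unfolding path_connected_space_def by blast
  qed
  then obtain \<tau> where "\<forall>x\<in>topspace X. pathin X (\<tau> x) \<and> \<tau> x 0 = x0 \<and> \<tau> x 1 = x \<and>
      (x = x0 \<longrightarrow> \<tau> x = (\<lambda>t. x0))"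
    by metis
  then show ?thesis
    using assms(2) by (intro exI[of _ \<tau>]) (unfold_locales; simp)
qed



section \<open>Paracompact Hausdorff spaces\<close>

text \<open>Passes from separating points of \<open>A\<close> to separating \<open>A\<close> itself;
  regularity is the case of a one-point \<open>B\<close>, and normality then follows from regularity
  by a second use. Members of the refinement that meet \<open>A\<close> avoid the first set of the
  cover, so their closures miss \<open>B\<close>, and local finiteness makes the closure of their
  union the union of their closures.\<close>

lemma paracompact_separation:
  assumes "paracompact_space X" "closedin X A"
    and sep: "\<And>a. a \<in> A \<Longrightarrow> \<exists>U. openin X U \<and> a \<in> U \<and> disjnt B (X closure_of U)"
  shows "\<exists>U. openin X U \<and> A \<subseteq> U \<and> disjnt B (X closure_of U)"
proof -
  let ?\<U> = "insert (topspace X - A) {U. openin X U \<and> disjnt B (X closure_of U)}"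
  have "open_cover X ?\<U>"
    unfolding open_cover_def
  proof (intro conjI ballI)
    show "\<Union>?\<U> = topspace X"
      using sep openin_subset by fastforce
  qed (use assms(2) in auto)
  then obtain \<V> where \<V>: "open_cover X \<V>" "locally_finite_in X \<V>" "refines \<V> ?\<U>"
    using assms(1) unfolding paracompact_space_def by blast
  let ?\<W> = "{V\<in>\<V>. V \<inter> A \<noteq> {}}"
  have "disjnt B (X closure_of V)" if V: "V \<in> ?\<W>" for V
  proof -
    obtain U where U: "U \<in> ?\<U>" "V \<subseteq> U"
      using \<V>(3) V unfolding refines_def by blast
    moreover have "U \<noteq> topspace X - A"
      using V U(2) by blast
    ultimately have "disjnt B (X closure_of U)"
      by simp
    then show ?thesis
      using closure_of_mono[OF U(2), of X] by (rule disjnt_subset2)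
  qed
  moreover have "locally_finite_in X ?\<W>"
    using \<V>(2) by (rule locally_finite_in_subset) blast
  ultimately have "disjnt B (X closure_of \<Union>?\<W>)"
    by (auto simp: closure_of_locally_finite_Union disjnt_def)
  moreover have "openin X (\<Union>?\<W>)" "A \<subseteq> \<Union>?\<W>"
    using \<V>(1) closedin_subset[OF assms(2)] unfolding open_cover_def by blast+
  ultimately show ?thesis
    by blast
qed

lemma paracompact_Hausdorff_imp_regular_space:
  assumes "paracompact_space X" "Hausdorff_space X"
  shows "regular_space X"
  unfolding regular_space_def
proof clarify
  fix C a
  assume C: "closedin X C" and a: "a \<in> topspace X" "a \<notin> C"
  have "\<exists>U. openin X U \<and> c \<in> U \<and> disjnt {a} (X closure_of U)" if c: "c \<in> C" for c
  proof -
    have "c \<in> topspace X" "c \<noteq> a"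
      using C c a closedin_subset by blast+
    then obtain U V where UV: "openin X U" "openin X V" "c \<in> U" "a \<in> V" "disjnt U V"
      using assms(2) a unfolding Hausdorff_space_def by metis
    then have "X closure_of U \<inter> V = {}"
      by (simp add: disjnt_def Int_commute openin_Int_closure_of_eq_empty)
    then show ?thesis
      using UV by (intro exI[of _ U]) (auto simp: disjnt_def)
  qed
  then obtain U where U: "openin X U" "C \<subseteq> U" "disjnt {a} (X closure_of U)"
    using paracompact_separation[OF assms(1) C] by blast
  moreover have "U \<subseteq> X closure_of U"
    using U by (simp add: closure_of_subset openin_subset)
  ultimately show "\<exists>U V. openin X U \<and> openin X V \<and> a \<in> U \<and> C \<subseteq> V \<and> disjnt U V"
    using a by (intro exI[of _ "topspace X - X closure_of U"] exI[of _ U]) (auto simp: disjnt_def)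
qed

lemma paracompact_Hausdorff_imp_normal_space:
  assumes "paracompact_space X" "Hausdorff_space X"
  shows "normal_space X"
  unfolding normal_space
proof clarify
  fix S T
  assume ST: "closedin X S" "closedin X T" "disjnt S T"
  have "\<exists>U. openin X U \<and> s \<in> U \<and> disjnt T (X closure_of U)" if "s \<in> S" for s
  proof -
    have "s \<in> topspace X - T"
      using ST(3) that closedin_subset[OF ST(1)] by (auto simp: disjnt_def)
    then show ?thesis
      using paracompact_Hausdorff_imp_regular_space[OF assms] ST(2) unfolding regular_space by simp
  qed
  then show "\<exists>U. openin X U \<and> S \<subseteq> U \<and> disjnt T (X closure_of U)"
    using paracompact_separation[OF assms(1) ST(1)] by blast
qed

text \<open>Regularity gives small open sets with closures inside members. A locally finite
  refinement of these is sorted by the member \<open>g w\<close> chosen for each \<open>w\<close>,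
  and local finiteness keeps the closure of each pile inside its member.\<close>

lemma shrink_cover:
  assumes "paracompact_space X" "Hausdorff_space X" "open_cover X \<U>"
  obtains W where "\<And>U. U \<in> \<U> \<Longrightarrow> openin X (W U)" "\<And>U. U \<in> \<U> \<Longrightarrow> X closure_of W U \<subseteq> U"
    "\<Union>(W ` \<U>) = topspace X"
proof -
  let ?\<O> = "{Q. openin X Q \<and> (\<exists>U\<in>\<U>. X closure_of Q \<subseteq> U)}"
  have "x \<in> \<Union>?\<O>" if x: "x \<in> topspace X" for x
  proof -
    obtain U where U: "U \<in> \<U>" "x \<in> U" "openin X U"
      using assms(3) x unfolding open_cover_def by blast
    then have "closedin X (topspace X - U)" "x \<in> topspace X - (topspace X - U)"
      using x by auto
    then obtain Q where "openin X Q" "x \<in> Q" "disjnt (topspace X - U) (X closure_of Q)"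
      using paracompact_Hausdorff_imp_regular_space[OF assms(1,2)] unfolding regular_space by blast
    moreover have "X closure_of Q \<subseteq> topspace X"
      by (rule closure_of_subset_topspace)
    ultimately show ?thesis
      using U by (auto simp: disjnt_def)
  qed
  moreover have "\<Union>?\<O> \<subseteq> topspace X"
    by (intro Union_least) (auto dest: openin_subset)
  ultimately have "open_cover X ?\<O>"
    unfolding open_cover_def by (simp add: subset_antisym subset_iff)
  then obtain \<W> where \<W>: "open_cover X \<W>" "locally_finite_in X \<W>" "refines \<W> ?\<O>"
    using assms(1) unfolding paracompact_space_def by blast
  have "\<exists>U\<in>\<U>. X closure_of w \<subseteq> U" if "w \<in> \<W>" for w
    using \<W>(3) that closure_of_mono unfolding refines_def by (smt (verit) mem_Collect_eq order_trans)
  then obtain g where g: "\<And>w. w \<in> \<W> \<Longrightarrow> g w \<in> \<U>" "\<And>w. w \<in> \<W> \<Longrightarrow> X closure_of w \<subseteq> g w"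
    by metis
  define W where "W U = \<Union>{w\<in>\<W>. g w = U}" for U
  show ?thesis
  proof
    show "openin X (W U)" for U
      using \<W>(1) unfolding W_def open_cover_def by blast
    show "X closure_of W U \<subseteq> U" for U
    proof -
      have "locally_finite_in X {w\<in>\<W>. g w = U}"
        using \<W>(2) by (rule locally_finite_in_subset) blast
      then show ?thesis
        using g(2) unfolding W_def by (auto simp: closure_of_locally_finite_Union)
    qed
    show "\<Union>(W ` \<U>) = topspace X"
    proof -
      have "\<Union>(W ` \<U>) = \<Union>\<W>"
        using g(1) by (auto simp: W_def)
      then show ?thesis
        using \<W>(1) by (simp add: open_cover_def)
    qed
  qed
qed

text \<open>The standard construction of barycentric refinements. If \<open>y\<close> lies in
  \<open>B x1\<close>, in \<open>B x2\<close> and in \<open>F V\<close>, then \<open>x1\<close> and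
  \<open>x2\<close> lie in \<open>F V\<close> too, since otherwise \<open>F V\<close> would have
  been removed; hence both sets are contained in \<open>V\<close>.\<close>

lemma open_cover_pairwise_refinement:
  assumes "paracompact_space X" "Hausdorff_space X" "open_cover X \<U>"
  obtains \<B> where "open_cover X \<B>"
    "\<And>B D. \<lbrakk>B \<in> \<B>; D \<in> \<B>; B \<inter> D \<noteq> {}\<rbrakk> \<Longrightarrow> \<exists>U\<in>\<U>. B \<union> D \<subseteq> U"
proof -
  obtain \<V> where \<V>: "open_cover X \<V>" "locally_finite_in X \<V>" "refines \<V> \<U>"
    using assms(1,3) unfolding paracompact_space_def by blast
  obtain W where W: "\<And>V. V \<in> \<V> \<Longrightarrow> openin X (W V)" "\<And>V. V \<in> \<V> \<Longrightarrow> X closure_of W V \<subseteq> V"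
    "\<Union>(W ` \<V>) = topspace X"
    using shrink_cover[OF assms(1,2) \<V>(1)] by blast
  define F where "F V = X closure_of W V" for V
  have F_sub: "F V \<subseteq> V" if "V \<in> \<V>" for V
    using W(2)[OF that] by (simp add: F_def)
  have F_cover: "\<exists>V\<in>\<V>. x \<in> F V" if x: "x \<in> topspace X" for x
  proof -
    obtain V where "V \<in> \<V>" "x \<in> W V"
      using W(3) x by blast
    moreover from this have "W V \<subseteq> F V"
      unfolding F_def by (intro closure_of_subset openin_subset W)
    ultimately show ?thesis
      by blast
  qed
  define B where "B x = \<Inter>{V\<in>\<V>. x \<in> F V} - \<Union>(F ` {V\<in>\<V>. x \<notin> F V})" for x
  \<comment> \<open>Local finiteness makes the intersection finite and the removed union of closed
    sets closed; the sets \<open>F V\<close> cover, so the intersection is not over the empty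
    family.\<close>
  have openB: "openin X (B x)" if x: "x \<in> topspace X" for x
    unfolding B_def
  proof (rule openin_diff)
    obtain N where "openin X N" "x \<in> N" and fin: "finite {V\<in>\<V>. V \<inter> N \<noteq> {}}"
      using \<V>(2) x unfolding locally_finite_in_def by blast
    then have "{V\<in>\<V>. x \<in> F V} \<subseteq> {V\<in>\<V>. V \<inter> N \<noteq> {}}"
      using F_sub by blast
    then have "finite {V\<in>\<V>. x \<in> F V}"
      using fin finite_subset by blast
    then show "openin X (\<Inter>{V\<in>\<V>. x \<in> F V})"
      using F_cover[OF x] \<V>(1) unfolding open_cover_def by (intro openin_Inter) auto
    have "locally_finite_in X (F ` \<V>)"
      using \<V>(2) F_sub by (rule locally_finite_in_refinement)
    then have "locally_finite_in X (F ` {V\<in>\<V>. x \<notin> F V})"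
      by (rule locally_finite_in_subset) blast
    then show "closedin X (\<Union>(F ` {V\<in>\<V>. x \<notin> F V}))"
      by (intro closedin_locally_finite_Union) (auto simp: F_def)
  qed
  show ?thesis
  proof
    show "open_cover X (B ` topspace X)"
      unfolding open_cover_def
    proof (intro conjI)
      have "x \<in> B x" if "x \<in> topspace X" for x
        using F_sub unfolding B_def by blast
      moreover have "B x \<subseteq> topspace X" if "x \<in> topspace X" for x
        using openB[OF that] openin_subset by blast
      ultimately show "\<Union>(B ` topspace X) = topspace X"
        by blast
    qed (use openB in blast)
  next
    fix B1 B2
    assume "B1 \<in> B ` topspace X" "B2 \<in> B ` topspace X" "B1 \<inter> B2 \<noteq> {}"
    then obtain x1 x2 y where *: "x1 \<in> topspace X" "x2 \<in> topspace X" "B1 = B x1" "B2 = B x2"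
      "y \<in> B x1" "y \<in> B x2"
      by blast
    then have "y \<in> topspace X"
      using openB openin_subset by blast
    then obtain V where V: "V \<in> \<V>" "y \<in> F V"
      using F_cover by blast
    then have "x1 \<in> F V" "x2 \<in> F V"
      using *(5,6) unfolding B_def by blast+
    then have "B x1 \<union> B x2 \<subseteq> V"
      using V unfolding B_def by blast
    moreover obtain U where "U \<in> \<U>" "V \<subseteq> U"
      using \<V>(3) V(1) unfolding refines_def by blast
    ultimately show "\<exists>U\<in>\<U>. B1 \<union> B2 \<subseteq> U"
      using *(3,4) by (intro bexI[of _ U]) auto
  qed
qed

text \<open>The condition on intersecting members passes to smaller sets, so the members may be cut
  down to path connected open sets.\<close>

lemma path_connected_pairwise_refinement:
  assumes "paracompact_space X" "Hausdorff_space X" "locally_path_connected_space X"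
    and "open_cover X \<U>"
  obtains \<C> where "open_cover X \<C>" "\<And>C. C \<in> \<C> \<Longrightarrow> path_connectedin X C"
    "\<And>C D. \<lbrakk>C \<in> \<C>; D \<in> \<C>; C \<inter> D \<noteq> {}\<rbrakk> \<Longrightarrow> \<exists>U\<in>\<U>. C \<union> D \<subseteq> U"
proof -
  obtain \<B> where \<B>: "open_cover X \<B>"
    "\<And>B D. \<lbrakk>B \<in> \<B>; D \<in> \<B>; B \<inter> D \<noteq> {}\<rbrakk> \<Longrightarrow> \<exists>U\<in>\<U>. B \<union> D \<subseteq> U"
    using open_cover_pairwise_refinement[OF assms(1,2,4)] by blast
  let ?\<C> = "{C. openin X C \<and> path_connectedin X C \<and> (\<exists>B\<in>\<B>. C \<subseteq> B)}"
  show ?thesis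
  proof
    have "x \<in> \<Union>?\<C>" if "x \<in> topspace X" for x
    proof -
      obtain B where "B \<in> \<B>" "openin X B" "x \<in> B"
        using \<B>(1) \<open>x \<in> topspace X\<close> unfolding open_cover_def by blast
      then show ?thesis
        using assms(3) unfolding locally_path_connected_space by blast
    qed
    moreover have "\<Union>?\<C> \<subseteq> topspace X"
      by (intro Union_least) (auto dest: openin_subset)
    ultimately show "open_cover X ?\<C>"
      unfolding open_cover_def by (simp add: subset_antisym subset_iff)
  next
    fix C D
    assume "C \<in> ?\<C>" "D \<in> ?\<C>" "C \<inter> D \<noteq> {}"
    then obtain B B' where B: "B \<in> \<B>" "B' \<in> \<B>" "C \<subseteq> B" "D \<subseteq> B'" "B \<inter> B' \<noteq> {}"
      by blast
    then show "\<exists>U\<in>\<U>. C \<union> D \<subseteq> U"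
      using \<B>(2)[OF B(1,2,5)] by blast
  qed blast
qed


section \<open>Partitions of unity\<close>

text \<open>The index set of the sum varies with \<open>x\<close>. Near a point it can be enlarged
  by zero terms to one fixed finite set, and the local sums are pasted.\<close>

lemma continuous_map_locally_finite_sum:
  fixes h :: "'a set \<Rightarrow> 'a \<Rightarrow> real"
  assumes "locally_finite_in X \<U>"
    and h: "\<And>U. U \<in> \<U> \<Longrightarrow> continuous_map X euclideanreal (h U)"
    and supp: "\<And>U x. U \<in> \<U> \<Longrightarrow> x \<in> topspace X \<Longrightarrow> h U x \<noteq> 0 \<Longrightarrow> x \<in> U"
  shows "continuous_map X euclideanreal (\<lambda>x. \<Sum>U | U \<in> \<U> \<and> h U x \<noteq> 0. h U x)"
proof -
  have "\<forall>x\<in>topspace X. \<exists>V. openin X V \<and> x \<in> V \<and> finite {U \<in> \<U>. U \<inter> V \<noteq> {}}"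
    using assms(1) unfolding locally_finite_in_def by blast
  from bchoice[OF this] obtain N where "\<forall>x\<in>topspace X. openin X (N x) \<and> x \<in> N x \<and>
      finite {U \<in> \<U>. U \<inter> N x \<noteq> {}}" ..
  then have N: "\<And>x. x \<in> topspace X \<Longrightarrow> openin X (N x)" "\<And>x. x \<in> topspace X \<Longrightarrow> x \<in> N x"
    "\<And>x. x \<in> topspace X \<Longrightarrow> finite {U \<in> \<U>. U \<inter> N x \<noteq> {}}"
    by simp_all
  have eq: "(\<Sum>U | U \<in> \<U> \<and> h U y \<noteq> 0. h U y) = (\<Sum>U | U \<in> \<U> \<and> U \<inter> N x \<noteq> {}. h U y)"
    if "x \<in> topspace X" "y \<in> topspace X" "y \<in> N x" for x y
  proof (rule sum.mono_neutral_left)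
    show "finite {U \<in> \<U>. U \<inter> N x \<noteq> {}}"
      using N(3) that(1) .
    show "{U \<in> \<U>. h U y \<noteq> 0} \<subseteq> {U \<in> \<U>. U \<inter> N x \<noteq> {}}"
      using supp[OF _ that(2)] that(3) by blast
  qed simp
  show ?thesis
  proof (rule pasting_lemma[where I = "topspace X" and T = N
        and f = "\<lambda>x y. \<Sum>U | U \<in> \<U> \<and> U \<inter> N x \<noteq> {}. h U y"])
    show "continuous_map (subtopology X (N x)) euclideanreal (\<lambda>y. \<Sum>U | U \<in> \<U> \<and> U \<inter> N x \<noteq> {}. h U y)"
      if "x \<in> topspace X" for x
      using h by (intro continuous_map_sum N(3) that continuous_map_from_subtopology) auto
    show "\<exists>j. j \<in> topspace X \<and> x \<in> N j \<and>
        (\<Sum>U | U \<in> \<U> \<and> h U x \<noteq> 0. h U x) = (\<Sum>U | U \<in> \<U> \<and> U \<inter> N j \<noteq> {}. h U x)"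
      if "x \<in> topspace X" for x
      using that N eq by blast
    show "(\<Sum>U | U \<in> \<U> \<and> U \<inter> N i \<noteq> {}. h U x) = (\<Sum>U | U \<in> \<U> \<and> U \<inter> N j \<noteq> {}. h U x)"
      if "i \<in> topspace X" "j \<in> topspace X" "x \<in> topspace X \<inter> N i \<inter> N j" for i j x
      using eq[of i x] eq[of j x] that by auto
  qed (rule N)
qed

text \<open>Bump functions equal to 1 on a shrinking of the cover have a positive locally finite
  sum, by which they are normalised. The value 1 at \<open>x0\<close> makes the nerve map send
  \<open>x0\<close> to a vertex.\<close>

lemma partition_of_unity_exists:
  assumes X: "paracompact_space X" "Hausdorff_space X"
    and \<U>: "open_cover X \<U>" "locally_finite_in X \<U>" "U0 \<in> \<U>" "x0 \<in> U0"
  shows "\<exists>\<phi>. partition_of_unity X \<U> \<phi> \<and> \<phi> U0 x0 = 1"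
proof -
  note normal = paracompact_Hausdorff_imp_normal_space[OF X]
  have bump: "\<exists>h. continuous_map X euclideanreal h \<and> (\<forall>x\<in>topspace X. 0 \<le> h x \<and> h x \<le> 1) \<and>
      (\<forall>x\<in>S. h x = 1) \<and> X closure_of {x \<in> topspace X. h x \<noteq> 0} \<subseteq> U"
    if SU: "closedin X S" "openin X U" "S \<subseteq> U" for S U
  proof -
    obtain V where V: "openin X V" "S \<subseteq> V" "X closure_of V \<subseteq> U"
      using normal[unfolded normal_space_alt, rule_format, of S U] SU by auto
    have "closedin X (topspace X - V)" "disjnt (topspace X - V) S"
      using V(1,2) by (auto simp: disjnt_def)
    then obtain h where h: "continuous_map X (top_of_set {0..1}) h" "h ` (topspace X - V) \<subseteq> {0}" "h ` S \<subseteq> {1::real}"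
      by (rule Urysohn_lemma[OF normal _ SU(1) _ zero_le_one, of "topspace X - V"])
    have "{x \<in> topspace X. h x \<noteq> 0} \<subseteq> V"
      using h(2) by blast
    then have "X closure_of {x \<in> topspace X. h x \<noteq> 0} \<subseteq> U"
      using V(3) closure_of_mono by blast
    moreover have "0 \<le> h x \<and> h x \<le> 1" if "x \<in> topspace X" for x
      using continuous_map_image_subset_topspace[OF h(1)] that by auto
    moreover have "h x = 1" if "x \<in> S" for x
      using h(3) that by auto
    ultimately show ?thesis
      using continuous_map_into_fulltopology[OF h(1)] by (intro exI[of _ h] conjI ballI) simp_all
  qed
  obtain W where W: "\<And>U. U \<in> \<U> \<Longrightarrow> openin X (W U)" "\<And>U. U \<in> \<U> \<Longrightarrow> X closure_of W U \<subseteq> U"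
    "\<Union>(W ` \<U>) = topspace X"
    using shrink_cover[OF X \<U>(1)] by blast
  have op: "openin X U" if "U \<in> \<U>" for U
    using \<U>(1) that by (simp add: open_cover_def)
  have "\<forall>U\<in>\<U>. \<exists>h. continuous_map X euclideanreal h \<and> (\<forall>x\<in>topspace X. 0 \<le> h x \<and> h x \<le> 1) \<and>
      (\<forall>x\<in>X closure_of W U. h x = 1) \<and> X closure_of {x \<in> topspace X. h x \<noteq> 0} \<subseteq> U"
    using bump op W(2) by simp
  from bchoice[OF this] obtain h where "\<forall>U\<in>\<U>. continuous_map X euclideanreal (h U) \<and>
      (\<forall>x\<in>topspace X. 0 \<le> h U x \<and> h U x \<le> 1) \<and>
      (\<forall>x\<in>X closure_of W U. h U x = 1) \<and> X closure_of {x \<in> topspace X. h U x \<noteq> 0} \<subseteq> U" ..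
  then have h: "\<And>U. U \<in> \<U> \<Longrightarrow> continuous_map X euclideanreal (h U)"
    "\<And>U x. U \<in> \<U> \<Longrightarrow> x \<in> topspace X \<Longrightarrow> 0 \<le> h U x"
    "\<And>U x. U \<in> \<U> \<Longrightarrow> x \<in> X closure_of W U \<Longrightarrow> h U x = 1"
    "\<And>U. U \<in> \<U> \<Longrightarrow> X closure_of {x \<in> topspace X. h U x \<noteq> 0} \<subseteq> U"
    by simp_all
  have x0: "x0 \<in> topspace X"
    using openin_subset[OF op[OF \<U>(3)]] \<U>(4) by blast
  then have "closedin X {x0}"
    using closedin_Hausdorff_singleton[OF X(2)] by simp
  then obtain k where k: "continuous_map X euclideanreal k" "\<And>x. x \<in> topspace X \<Longrightarrow> 0 \<le> k x \<and> k x \<le> 1"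
    "k x0 = 1" "X closure_of {x \<in> topspace X. k x \<noteq> 0} \<subseteq> U0"
    using bump[of "{x0}" U0] op[OF \<U>(3)] \<U>(4) by auto
  \<comment> \<open>Concentrate all the weight at \<open>x0\<close> on the vertex \<open>U0\<close> before normalising.\<close>
  define w where "w U x = (if U = U0 then h U x + k x else h U x * (1 - k x))" for U x
  define S where "S x = (\<Sum>U | U \<in> \<U> \<and> w U x \<noteq> 0. w U x)" for x
  define \<phi> where "\<phi> U x = w U x / S x" for U x
  have w_cont: "continuous_map X euclideanreal (w U)" if "U \<in> \<U>" for U
  proof (cases "U = U0")
    case True
    then show ?thesis
      unfolding w_def using h(1)[OF that] k(1) by (simp add: continuous_map_add)
  next
    case False
    then show ?thesis
      unfolding w_def using h(1)[OF that] k(1)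
      by (simp add: continuous_map_diff continuous_map_real_mult)
  qed
  have w_nonneg: "0 \<le> w U x" if "U \<in> \<U>" "x \<in> topspace X" for U x
    using h(2)[OF that] k(2)[OF that(2)] by (auto simp: w_def)
  have w_supp: "X closure_of {x \<in> topspace X. w U x \<noteq> 0} \<subseteq> U" if U: "U \<in> \<U>" for U
  proof (cases "U = U0")
    case True
    have "{x \<in> topspace X. w U x \<noteq> 0} \<subseteq> {x \<in> topspace X. h U x \<noteq> 0} \<union> {x \<in> topspace X. k x \<noteq> 0}"
      by (auto simp: w_def)
    then have "X closure_of {x \<in> topspace X. w U x \<noteq> 0} \<subseteq>
        X closure_of {x \<in> topspace X. h U x \<noteq> 0} \<union> X closure_of {x \<in> topspace X. k x \<noteq> 0}"
      unfolding closure_of_Un[symmetric] by (rule closure_of_mono)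
    then show ?thesis
      using h(4)[OF U] k(4) True by blast
  next
    case False
    then have "{x \<in> topspace X. w U x \<noteq> 0} \<subseteq> {x \<in> topspace X. h U x \<noteq> 0}"
      by (auto simp: w_def)
    then show ?thesis
      using h(4)[OF U] closure_of_mono by blast
  qed
  have w_mem: "x \<in> U" if "U \<in> \<U>" "x \<in> topspace X" "w U x \<noteq> 0" for U x
    using w_supp[OF that(1)] closure_of_subset[of "{x \<in> topspace X. w U x \<noteq> 0}" X] that by blast
  have fin: "finite {U. U \<in> \<U> \<and> w U x \<noteq> 0}" if x: "x \<in> topspace X" for x
  proof -
    obtain N where N: "x \<in> N" "finite {U \<in> \<U>. U \<inter> N \<noteq> {}}"
      using \<U>(2) x unfolding locally_finite_in_def by blast
    have "{U. U \<in> \<U> \<and> w U x \<noteq> 0} \<subseteq> {U \<in> \<U>. U \<inter> N \<noteq> {}}"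
      using w_mem N(1) x by blast
    then show ?thesis
      using N(2) finite_subset by blast
  qed
  have S_pos: "0 < S x" if x: "x \<in> topspace X" for x
  proof -
    obtain U where U: "U \<in> \<U>" "x \<in> W U"
      using W(3) x by blast
    then have "x \<in> X closure_of W U"
      using closure_of_subset[of "W U" X] openin_subset[OF W(1)[OF U(1)]] by blast
    then have hU: "h U x = 1"
      using h(3) U by blast
    \<comment> \<open>The factor \<open>1 - k x\<close> can destroy a positive weight only where
      \<open>k x = 1\<close>, and there the weight of \<open>U0\<close> is at least 1.\<close>
    have "\<exists>V\<in>\<U>. w V x \<noteq> 0"
    proof (cases "U = U0 \<or> k x \<noteq> 1")
      case True
      then show ?thesis
        using U(1) hU k(2)[OF x] by (intro bexI[of _ U]) (auto simp: w_def)
    next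
      case False
      then show ?thesis
        using \<U>(3) h(2)[OF \<U>(3) x] by (intro bexI[of _ U0]) (auto simp: w_def)
    qed
    then obtain V where "V \<in> \<U>" "w V x \<noteq> 0"
      by blast
    then show ?thesis
      unfolding S_def using fin[OF x] w_nonneg[OF _ x]
      by (intro sum_pos2[of _ V]) (auto simp: less_le)
  qed
  have S_cont: "continuous_map X euclideanreal S"
    unfolding S_def using \<U>(2) w_cont w_mem by (rule continuous_map_locally_finite_sum)
  have \<phi>_iff: "\<phi> U x \<noteq> 0 \<longleftrightarrow> w U x \<noteq> 0" if "x \<in> topspace X" for U x
    using S_pos[OF that] by (simp add: \<phi>_def)
  have "partition_of_unity X \<U> \<phi>"
    unfolding partition_of_unity_def
  proof (intro conjI ballI)
    show "continuous_map X euclideanreal (\<phi> U)" if "U \<in> \<U>" for U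
      unfolding \<phi>_def using S_pos
      by (intro continuous_map_real_divide w_cont that S_cont) (simp add: less_imp_neq[symmetric])
    show "0 \<le> \<phi> U x" if "U \<in> \<U>" "x \<in> topspace X" for U x
      using w_nonneg[OF that] S_pos[OF that(2)] by (simp add: \<phi>_def)
    show "X closure_of {x \<in> topspace X. \<phi> U x \<noteq> 0} \<subseteq> U" if "U \<in> \<U>" for U
    proof -
      have "{x \<in> topspace X. \<phi> U x \<noteq> 0} = {x \<in> topspace X. w U x \<noteq> 0}"
        using \<phi>_iff by auto
      then show ?thesis
        using w_supp[OF that] by simp
    qed
    show "(\<Sum>U | U \<in> \<U> \<and> \<phi> U x \<noteq> 0. \<phi> U x) = 1" if x: "x \<in> topspace X" for x
    proof -
      have "(\<Sum>U | U \<in> \<U> \<and> \<phi> U x \<noteq> 0. \<phi> U x) = (\<Sum>U | U \<in> \<U> \<and> w U x \<noteq> 0. w U x / S x)"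
        using \<phi>_iff[OF x] by (simp add: \<phi>_def)
      also have "\<dots> = S x / S x"
        unfolding sum_divide_distrib[symmetric] by (simp only: S_def)
      finally show ?thesis
        using S_pos[OF x] by simp
    qed
  qed
  moreover have "\<phi> U0 x0 = 1"
  proof -
    have "w U x0 = 0" if "U \<noteq> U0" for U
      using that k(3) by (simp add: w_def)
    moreover have "w U0 x0 \<noteq> 0"
      using h(2)[OF \<U>(3) x0] k(3) by (simp add: w_def)
    ultimately have "{U. U \<in> \<U> \<and> w U x0 \<noteq> 0} = {U0}"
      using \<U>(3) by auto
    then show ?thesis
      using \<open>w U0 x0 \<noteq> 0\<close> by (simp add: \<phi>_def S_def)
  qed
  ultimately show ?thesis
    by blast
qed



section \<open>Maps into and out of geometric realizations\<close>

lemma topspace_powertop_real [simp]: "topspace (powertop_real UNIV) = UNIV"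
  by auto

lemma continuous_map_powertop_coordinate:
  "continuous_map (powertop_real UNIV) euclideanreal (\<lambda>f. f v)"
  by (rule continuous_map_product_projection) simp

lemma topspace_realization: "topspace (realization K) = (\<Union>F\<in>K. geometric_simplex F)"
proof
  show "topspace (realization K) \<subseteq> (\<Union>F\<in>K. geometric_simplex F)"
    using openin_realization[of K "topspace (realization K)"] by simp
  have "openin (subtopology (powertop_real UNIV) (geometric_simplex F))
      ((\<Union>F\<in>K. geometric_simplex F) \<inter> geometric_simplex F)" if "F \<in> K" for F
  proof -
    have "(\<Union>F\<in>K. geometric_simplex F) \<inter> geometric_simplex F = geometric_simplex F"
      using that by blast
    then show ?thesis
      using openin_topspace[of "subtopology (powertop_real UNIV) (geometric_simplex F)"] by simp
  qed
  then have "openin (realization K) (\<Union>F\<in>K. geometric_simplex F)"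
    by (simp add: openin_realization)
  then show "(\<Union>F\<in>K. geometric_simplex F) \<subseteq> topspace (realization K)"
    by (rule openin_subset)
qed

text \<open>The universal property of the weak topology: continuity is tested on closed
  simplices.\<close>

lemma continuous_map_from_realization:
  assumes "\<And>F. F \<in> K \<Longrightarrow> continuous_map (subtopology (powertop_real UNIV) (geometric_simplex F)) Z g"
  shows "continuous_map (realization K) Z g"
  unfolding continuous_map_def
proof (intro conjI allI impI)
  show "g \<in> topspace (realization K) \<rightarrow> topspace Z"
    using assms unfolding continuous_map_def topspace_realization by auto
  fix W assume W: "openin Z W"
  have "openin (subtopology (powertop_real UNIV) (geometric_simplex F))
          ({x \<in> topspace (realization K). g x \<in> W} \<inter> geometric_simplex F)" if F: "F \<in> K" for F
  proof -
    have "{x \<in> topspace (realization K). g x \<in> W} \<inter> geometric_simplex F =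
        {x \<in> topspace (subtopology (powertop_real UNIV) (geometric_simplex F)). g x \<in> W}"
      using F by (auto simp: topspace_realization)
    then show ?thesis
      using openin_continuous_map_preimage[OF assms[OF F] W] by simp
  qed
  then show "openin (realization K) {x \<in> topspace (realization K). g x \<in> W}"
    by (auto simp: openin_realization topspace_realization)
qed

lemma continuous_map_coordinate: "continuous_map (realization K) euclideanreal (\<lambda>f. f v)"
  by (intro continuous_map_from_realization continuous_map_from_subtopology
      continuous_map_powertop_coordinate)

lemma continuous_map_simplex_inclusion:
  assumes "F \<in> K"
  shows "continuous_map (subtopology (powertop_real UNIV) (geometric_simplex F)) (realization K) (\<lambda>x. x)"
  unfolding continuous_map_def
proof (intro conjI allI impI)
  fix W assume "openin (realization K) W"
  then have "openin (subtopology (powertop_real UNIV) (geometric_simplex F)) (W \<inter> geometric_simplex F)"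
    using assms by (simp add: openin_realization)
  moreover have "{x \<in> topspace (subtopology (powertop_real UNIV) (geometric_simplex F)). x \<in> W} =
      W \<inter> geometric_simplex F"
    by auto
  ultimately show "openin (subtopology (powertop_real UNIV) (geometric_simplex F))
      {x \<in> topspace (subtopology (powertop_real UNIV) (geometric_simplex F)). x \<in> W}"
    by simp
qed (use assms in \<open>auto simp: topspace_realization\<close>)

text \<open>Closedness permits pasting along the finitely many simplices that occur near a
  point.\<close>

lemma closedin_geometric_simplex: "closedin (powertop_real UNIV) (geometric_simplex F)"
proof -
  have coord: "closedin (powertop_real UNIV) {f. f v \<in> S}" if "closed S" for v and S :: "real set"
    using closedin_continuous_map_preimage[OF continuous_map_powertop_coordinate[of v], of S] that
    by simp
  have total: "closedin (powertop_real UNIV) {f. sum f F \<in> {1}}"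
  \<comment> \<open>For infinite \<open>F\<close> the sum is 0 by convention, and the set is
    empty.\<close>
  proof (cases "finite F")
    case True
    then have "continuous_map (powertop_real UNIV) euclideanreal (\<lambda>f. sum f F)"
      by (intro continuous_map_sum continuous_map_powertop_coordinate)
    from closedin_continuous_map_preimage[OF this, of "{1}"] show ?thesis
      by simp
  qed simp
  have *: "f v \<in> (if v \<in> F then {0..} else {0}) \<longleftrightarrow> 0 \<le> f v \<and> (v \<notin> F \<longrightarrow> f v = 0)"
    for f :: "'a \<Rightarrow> real" and v
    by auto
  have "geometric_simplex F =
      (\<Inter>v. {f. f v \<in> (if v \<in> F then {0..} else {0})}) \<inter> {f. sum f F \<in> {1}}"
    unfolding set_eq_iff geometric_simplex_def mem_Collect_eq Int_iff INT_iff * singleton_iff by blast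
  moreover have "closedin (powertop_real UNIV) {f. f v \<in> (if v \<in> F then {0..} else {0})}" for v
    by (rule coord) simp
  then have "closedin (powertop_real UNIV) (\<Inter>v. {f. f v \<in> (if v \<in> F then {0..} else {0})})"
    by (rule closedin_INT[rotated]) simp
  ultimately show ?thesis
    using closedin_Int[OF _ total] by simp
qed

text \<open>
  Near each point only finitely many closed simplices matter, so the weak topology cannot be told
  apart from the topology of coordinatewise convergence.
\<close>

lemma continuous_map_into_realization:
  assumes coord: "\<And>v. continuous_map Y euclideanreal (\<lambda>y. f y v)"
    and local: "\<And>y. y \<in> topspace Y \<Longrightarrow> \<exists>N S. openin Y N \<and> y \<in> N \<and> finite S \<and>
      (\<forall>z\<in>N. \<exists>F\<in>K. F \<subseteq> S \<and> f z \<in> geometric_simplex F)"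
  shows "continuous_map Y (realization K) f"
proof -
  have "\<forall>y\<in>topspace Y. \<exists>NS. openin Y (fst NS) \<and> y \<in> fst NS \<and> finite (snd NS) \<and>
      (\<forall>z\<in>fst NS. \<exists>F\<in>K. F \<subseteq> snd NS \<and> f z \<in> geometric_simplex F)"
    using local by simp
  from bchoice[OF this] obtain NS where NS: "\<forall>y\<in>topspace Y. openin Y (fst (NS y)) \<and>
      y \<in> fst (NS y) \<and> finite (snd (NS y)) \<and>
      (\<forall>z\<in>fst (NS y). \<exists>F\<in>K. F \<subseteq> snd (NS y) \<and> f z \<in> geometric_simplex F)" ..
  define N S where "N y = fst (NS y)" and "S y = snd (NS y)" for y
  have N: "\<And>y. y \<in> topspace Y \<Longrightarrow> openin Y (N y)" "\<And>y. y \<in> topspace Y \<Longrightarrow> y \<in> N y"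
    and S: "\<And>y. y \<in> topspace Y \<Longrightarrow> finite (S y)"
    and NS: "\<And>y z. y \<in> topspace Y \<Longrightarrow> z \<in> N y \<Longrightarrow> \<exists>F\<in>K. F \<subseteq> S y \<and> f z \<in> geometric_simplex F"
    unfolding N_def S_def using bspec[OF NS] by blast+
  have pow: "continuous_map Y (powertop_real UNIV) f"
    using coord by (simp add: continuous_map_componentwise_UNIV)
  \<comment> \<open>A finite \<open>S y\<close> has finitely many subsets, so the preimages of their
    simplices form a finite closed cover of \<open>N y\<close>; on each of them the map factors
    through one simplex.\<close>
  have "continuous_map (subtopology Y (N y)) (realization K) f" if y: "y \<in> topspace Y" for y
  proof (rule pasting_lemma_closed[where I = "{F\<in>K. F \<subseteq> S y}" and f = "\<lambda>_. f" and
        T = "\<lambda>F. {z \<in> topspace (subtopology Y (N y)). f z \<in> geometric_simplex F}"])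
    show "finite {F \<in> K. F \<subseteq> S y}"
      using S[OF y] by simp
    show "closedin (subtopology Y (N y)) {z \<in> topspace (subtopology Y (N y)). f z \<in> geometric_simplex F}" for F
      by (rule closedin_continuous_map_preimage[OF continuous_map_from_subtopology[OF pow]
            closedin_geometric_simplex])
    show "continuous_map (subtopology (subtopology Y (N y))
        {z \<in> topspace (subtopology Y (N y)). f z \<in> geometric_simplex F}) (realization K) f"
      if "F \<in> {F \<in> K. F \<subseteq> S y}" for F
    proof -
      let ?A = "subtopology (subtopology Y (N y)) {z \<in> topspace (subtopology Y (N y)). f z \<in> geometric_simplex F}"
      have "continuous_map ?A (subtopology (powertop_real UNIV) (geometric_simplex F)) f"
        using pow by (auto simp: continuous_map_in_subtopology intro!: continuous_map_from_subtopology)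
      then have "continuous_map ?A (realization K) ((\<lambda>x. x) \<circ> f)"
        by (rule continuous_map_compose[OF _ continuous_map_simplex_inclusion]) (use that in simp)
      then show ?thesis
        by (simp add: comp_def)
    qed
  qed (use NS[OF y] in auto)
  then show ?thesis
    by (rule pasting_lemma[where I = "topspace Y" and T = N and f = "\<lambda>_. f", rotated])
       (use N in auto)
qed

lemma geometric_simplex_mono:
  assumes "F \<subseteq> F'" "finite F'"
  shows "geometric_simplex F \<subseteq> geometric_simplex F'"
proof
  fix f :: "'a \<Rightarrow> real" assume f: "f \<in> geometric_simplex F"
  have "sum f F' = sum f F"
    by (rule sum.mono_neutral_right) (use f assms in \<open>auto simp: geometric_simplex_def\<close>)
  then show "f \<in> geometric_simplex F'"
    using f assms by (auto simp: geometric_simplex_def)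
qed

lemma geometric_simplex_convex:
  assumes "f \<in> geometric_simplex F" "g \<in> geometric_simplex F" "s \<in> {0..1}"
  shows "(\<lambda>v. (1 - s) * f v + s * g v) \<in> geometric_simplex F"
  using assms by (auto simp: geometric_simplex_def sum.distrib simp flip: sum_distrib_left)

lemma indicator_in_geometric_simplex:
  assumes "v \<in> F" "finite F"
  shows "indicator {v} \<in> geometric_simplex F"
  using assms by (auto simp: geometric_simplex_def indicator_def)

lemma simplicial_extension_eq_sum:
  assumes "f \<in> geometric_simplex F" "finite F"
  shows "simplicial_extension r f w = (\<Sum>v | v \<in> F \<and> r v = w. f v)"
  unfolding simplicial_extension_def
  by (rule sum.mono_neutral_left) (use assms in \<open>auto simp: geometric_simplex_def\<close>)

lemma simplicial_extension_in_simplex: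
  assumes "f \<in> geometric_simplex F" "finite F"
  shows "simplicial_extension r f \<in> geometric_simplex (r ` F)"
proof -
  have f: "\<And>v. 0 \<le> f v" "sum f F = 1"
    using assms(1) by (auto simp: geometric_simplex_def)
  have "0 \<le> simplicial_extension r f w" for w
    unfolding simplicial_extension_def by (intro sum_nonneg f)
  moreover have "simplicial_extension r f w = 0" if "w \<notin> r ` F" for w
  proof -
    have "{v. v \<in> F \<and> r v = w} = {}"
      using that by blast
    then show ?thesis
      by (simp only: simplicial_extension_eq_sum[OF assms] sum.empty)
  qed
  moreover have "sum (simplicial_extension r f) (r ` F) = 1"
    unfolding simplicial_extension_eq_sum[OF assms] f(2)[symmetric]
    using sum.image_gen[OF assms(2), of f r] by simp
  ultimately show ?thesis
    by (simp add: geometric_simplex_def)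
qed

lemma continuous_map_simplicial_extension:
  assumes K: "\<And>F. F \<in> K \<Longrightarrow> finite F" and r: "\<And>F. F \<in> K \<Longrightarrow> r ` F \<in> L"
  shows "continuous_map (realization K) (realization L) (simplicial_extension r)"
proof (rule continuous_map_from_realization)
  fix F assume F: "F \<in> K"
  let ?T = "subtopology (powertop_real UNIV) (geometric_simplex F)"
  show "continuous_map ?T (realization L) (simplicial_extension r)"
  proof (rule continuous_map_into_realization)
    fix w
    have "continuous_map ?T euclideanreal (\<lambda>f. \<Sum>v | v \<in> F \<and> r v = w. f v)"
      by (intro continuous_map_sum continuous_map_from_subtopology continuous_map_powertop_coordinate)
        (use K[OF F] in auto)
    then show "continuous_map ?T euclideanreal (\<lambda>f. simplicial_extension r f w)"
      by (rule continuous_map_eq) (simp add: simplicial_extension_eq_sum K[OF F])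
  next
    show "\<exists>N S. openin ?T N \<and> f \<in> N \<and> finite S \<and>
        (\<forall>g\<in>N. \<exists>G\<in>L. G \<subseteq> S \<and> simplicial_extension r g \<in> geometric_simplex G)"
      if "f \<in> topspace ?T" for f
      using that K[OF F] r[OF F] simplicial_extension_in_simplex[of _ F r] openin_topspace[of ?T]
      by (intro exI[of _ "topspace ?T"] exI[of _ "r ` F"]) (auto intro!: bexI[of _ "r ` F"])
  qed
qed

lemma simplicial_extension_indicator:
  "simplicial_extension r (indicator {v}) = indicator {r v}"
proof
  fix w
  have "{u. indicator {v} u \<noteq> (0::real) \<and> r u = w} = (if r v = w then {v} else {})"
    by (auto simp: indicator_def split: if_splits)
  then show "simplicial_extension r (indicator {v}) w = indicator {r v} w"
    by (auto simp: simplicial_extension_def)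
qed


section \<open>Maps to nerves\<close>

definition members_at :: "'a set set \<Rightarrow> 'a \<Rightarrow> 'a set set" where
  "members_at \<U> x = {U\<in>\<U>. x \<in> U}"

lemma
  assumes "locally_finite_in X \<U>" "open_cover X \<U>" "x \<in> topspace X"
  shows members_at_nerve: "members_at \<U> x \<in> nerve \<U>"
    and finite_members_at: "finite (members_at \<U> x)"
proof -
  obtain N where N: "x \<in> N" "finite {U \<in> \<U>. U \<inter> N \<noteq> {}}"
    using assms(1,3) unfolding locally_finite_in_def by blast
  have "members_at \<U> x \<subseteq> {U \<in> \<U>. U \<inter> N \<noteq> {}}"
    using N(1) by (auto simp: members_at_def)
  then show *: "finite (members_at \<U> x)"
    using N(2) finite_subset by blast
  show "members_at \<U> x \<in> nerve \<U>"
    using * assms(2,3) by (auto simp: nerve_def members_at_def open_cover_def)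
qed

text \<open>The map \<open>f\<close> is carried by a map \<xi> into \<open>X\<close>: the
  coordinates of \<open>f y\<close> live on the members containing \<open>\<xi> y\<close>. Local
  finiteness at \<open>\<xi> y\<close> supplies the finite vertex set that
  \<open>continuous_map_into_realization\<close> needs.\<close>

lemma continuous_map_into_nerve:
  assumes "locally_finite_in X \<U>" "open_cover X \<U>" "continuous_map Y X \<xi>"
    and "\<And>U. continuous_map Y euclideanreal (\<lambda>y. f y U)"
    and "\<And>y. y \<in> topspace Y \<Longrightarrow> f y \<in> geometric_simplex (members_at \<U> (\<xi> y))"
  shows "continuous_map Y (realization (nerve \<U>)) f"
proof (rule continuous_map_into_realization[OF assms(4)])
  fix y assume y: "y \<in> topspace Y"
  then have "\<xi> y \<in> topspace X"
    using assms(3) by (auto simp: continuous_map_def)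
  then obtain N where N: "openin X N" "\<xi> y \<in> N" "finite {U \<in> \<U>. U \<inter> N \<noteq> {}}"
    using assms(1) unfolding locally_finite_in_def by blast
  let ?N = "{z \<in> topspace Y. \<xi> z \<in> N}" and ?S = "{U \<in> \<U>. U \<inter> N \<noteq> {}}"
  have "\<exists>F\<in>nerve \<U>. F \<subseteq> ?S \<and> f z \<in> geometric_simplex F" if z: "z \<in> ?N" for z
  proof (intro bexI conjI)
    have "\<xi> z \<in> topspace X"
      using assms(3) z by (auto simp: continuous_map_def)
    then show "members_at \<U> (\<xi> z) \<in> nerve \<U>"
      by (rule members_at_nerve[OF assms(1,2)])
    show "members_at \<U> (\<xi> z) \<subseteq> ?S"
      using z by (auto simp: members_at_def)
    show "f z \<in> geometric_simplex (members_at \<U> (\<xi> z))"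
      using assms(5) z by blast
  qed
  then show "\<exists>N S. openin Y N \<and> y \<in> N \<and> finite S \<and>
      (\<forall>z\<in>N. \<exists>F\<in>nerve \<U>. F \<subseteq> S \<and> f z \<in> geometric_simplex F)"
    using N y openin_continuous_map_preimage[OF assms(3) N(1)]
    by (intro exI[of _ ?N] exI[of _ ?S]) auto
qed

text \<open>During a contraction to a vertex of the nerve the base point moves. The two sides of the
  square follow the same path, so a free contraction can be corrected to one fixing the
  ends.\<close>

lemma path_homotopic_const_of_free:
  fixes h :: "real \<times> real \<Rightarrow> 'a"
  assumes h: "continuous_map (prod_topology unit_space unit_space) X h"
    and "\<And>t. t \<in> {0..1} \<Longrightarrow> h (1, t) = y"
    and "\<And>s. s \<in> {0..1} \<Longrightarrow> h (s, 1) = h (s, 0)"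
    and "\<And>t. t \<in> {0..1} \<Longrightarrow> p t = h (0, t)"
  shows "path_homotopic X p (\<lambda>t. p 0)"
proof -
  \<comment> \<open>Push \<open>p\<close> to the other three sides of the square, along which \<open>h\<close> retraces its trace path.\<close>
  let ?w = "\<lambda>t. min (min (3 * t) 1) (3 - 3 * t) :: real"
  let ?v = "\<lambda>t. (?w t, max 0 (min 1 (3 * t - 1)))"
  let ?\<sigma> = "\<lambda>s. h (s, 0)"
  have "path_homotopic X p (h \<circ> ?v)"
    by (rule path_homotopic_square[OF h, of "\<lambda>t. (0, t)" ?v])
       (auto simp: assms(4) intro!: continuous_intros)
  moreover have "path_homotopic X (h \<circ> ?v) (\<lambda>t. p 0)"
  proof (rule path_homotopic_reparam)
    show "pathin X ?\<sigma>"
      using path_homotopic_square[OF h, of "\<lambda>t. (t, 0)" "\<lambda>t. (t, 0)" ?\<sigma> ?\<sigma>]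
      by (simp add: image_subset_iff continuous_on_Pair)
    show "continuous_on {0..1} ?w"
      by (intro continuous_intros)
    show "(h \<circ> ?v) t = ?\<sigma> (?w t)" if "t \<in> {0..1}" for t
    proof -
      \<comment> \<open>The three thirds of the interval run along the sides where the second
        coordinate is 0, the first is 1, and the second is 1.\<close>
      consider "3 * t \<le> 1" | "1 \<le> 3 * t" "3 * t \<le> 2" | "2 \<le> 3 * t"
        by linarith
      then show ?thesis
      proof cases
        case 1
        then show ?thesis by (simp add: max_def)
      next
        case 2
        then have "?w t = 1" "max 0 (min 1 (3 * t - 1)) = 3 * t - 1"
          by auto
        then show ?thesis
          using 2 by (simp add: assms(2))
      next
        case 3
        then have "?w t = 3 - 3 * t" "max 0 (min 1 (3 * t - 1)) = 1" "3 - 3 * t \<in> {0..1}"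
          using that by auto
        then show ?thesis
          using assms(3)[of "3 - 3 * t"] by simp
      qed
    qed
    show "continuous_on {0..1} (\<lambda>t::real. 0::real)"
      by simp
  qed (use assms(4) in auto)
  ultimately show ?thesis
    by (rule path_homotopic_trans)
qed

section \<open>The map to the nerve of a pointed cover\<close>

locale pointed_cover =
  fixes X :: "'a topology" and x0 :: 'a and \<U> :: "'a set set" and U0 :: "'a set"
  assumes paracompact: "paracompact_space X" and Hausdorff: "Hausdorff_space X"
    and in_cov: "(\<U>, U0) \<in> cov X x0"
begin

abbreviation "R \<equiv> realization (nerve \<U>)"
abbreviation "e \<equiv> indicator {U0} :: 'a set \<Rightarrow> real"
abbreviation "p \<equiv> nerve_map X x0 (\<U>, U0)"

lemma open_cover: "open_cover X \<U>" and locally_finite: "locally_finite_in X \<U>"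
  and U0: "U0 \<in> \<U>" "x0 \<in> U0"
  using in_cov by (auto simp: cov_def)

lemma base_in_topspace: "x0 \<in> topspace X"
  using open_cover U0 by (auto simp: open_cover_def)

lemma p_coordinate:
  "continuous_map X euclideanreal (\<lambda>x. p x U)"
  "x \<in> topspace X \<Longrightarrow> p x \<in> geometric_simplex (members_at \<U> x)"
  "p x0 = e"
proof -
  let ?\<phi> = "SOME \<phi>. partition_of_unity X \<U> \<phi> \<and> \<phi> U0 x0 = 1"
  have \<phi>: "partition_of_unity X \<U> ?\<phi>" "?\<phi> U0 x0 = 1"
    using someI_ex[OF partition_of_unity_exists[OF paracompact Hausdorff open_cover locally_finite U0]]
    by auto
  have p: "p x U = (if U \<in> \<U> then ?\<phi> U x else 0)" for x U
    by (simp add: nerve_map_def barycentric_map_def)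
  show "continuous_map X euclideanreal (\<lambda>x. p x U)"
    using \<phi>(1) by (cases "U \<in> \<U>") (auto simp: p partition_of_unity_def)
  have simplex: "p x \<in> geometric_simplex (members_at \<U> x)" if x: "x \<in> topspace X" for x
  proof -
    have mem: "x \<in> U" if "U \<in> \<U>" "?\<phi> U x \<noteq> 0" for U
    proof -
      have "{y \<in> topspace X. ?\<phi> U y \<noteq> 0} \<subseteq> X closure_of {y \<in> topspace X. ?\<phi> U y \<noteq> 0}"
        by (intro closure_of_subset) blast
      then show ?thesis
        using \<phi>(1) that x unfolding partition_of_unity_def by blast
    qed
    have "sum (p x) (members_at \<U> x) = (\<Sum>U | U \<in> \<U> \<and> ?\<phi> U x \<noteq> 0. ?\<phi> U x)"
      by (rule sum.mono_neutral_cong_right[OF finite_members_at[OF locally_finite open_cover x]])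
         (use mem in \<open>auto simp: members_at_def p\<close>)
    also have "\<dots> = 1"
      using \<phi>(1) x by (auto simp: partition_of_unity_def)
    finally show ?thesis
      using \<phi>(1) x mem by (auto simp: geometric_simplex_def p members_at_def partition_of_unity_def)
  qed
  then show "x \<in> topspace X \<Longrightarrow> p x \<in> geometric_simplex (members_at \<U> x)"
    by blast
  show "p x0 = e"
  proof
    fix U
    have s: "p x0 \<in> geometric_simplex (members_at \<U> x0)"
      by (rule simplex[OF base_in_topspace])
    have one: "p x0 U0 = 1"
      using \<phi>(2) U0 by (simp add: p)
    show "p x0 U = e U"
    \<comment> \<open>The weights at \<open>x0\<close> sum to 1 and \<open>U0\<close> takes all of
      it, so another member containing \<open>x0\<close> gets weight 0.\<close>
    proof (cases "U = U0 \<or> U \<notin> members_at \<U> x0")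
      case True
      then show ?thesis
        using s one U0 by (auto simp: geometric_simplex_def members_at_def indicator_def)
    next
      case False
      then have U: "U0 \<noteq> U"
        by blast
      from False have "sum (p x0) {U0, U} \<le> sum (p x0) (members_at \<U> x0)"
        using s U0 finite_members_at[OF locally_finite open_cover base_in_topspace]
        by (intro sum_mono2) (auto simp: geometric_simplex_def members_at_def)
      moreover have "0 \<le> p x0 U"
        using s by (simp add: geometric_simplex_def)
      ultimately show ?thesis
        using s one U by (simp add: geometric_simplex_def)
    qed
  qed
qed

lemma p_pos_imp_mem: "x \<in> topspace X \<Longrightarrow> p x U > 0 \<Longrightarrow> U \<in> \<U> \<and> x \<in> U"
  using p_coordinate(2)[of x] by (force simp: geometric_simplex_def members_at_def)

lemma continuous_map_p: "continuous_map X R p"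
  by (rule continuous_map_into_nerve[OF locally_finite open_cover, of X "\<lambda>x. x"])
     (simp_all add: p_coordinate)

lemma e_in_topspace: "e \<in> topspace R"
proof -
  have "p x0 \<in> topspace R"
    using continuous_map_p base_in_topspace by (auto simp: continuous_map_def)
  then show ?thesis
    unfolding p_coordinate(3) .
qed

text \<open>At each parameter both maps lie in the simplex spanned by the members containing the
  same point \<open>\<xi> t\<close>, so the segment between them stays in that simplex.\<close>

lemma continuous_map_linear_homotopy:
  assumes \<xi>: "pathin X \<xi>"
    and f: "\<And>U. continuous_map unit_space euclideanreal (\<lambda>t. f t U)"
      "\<And>t. t \<in> {0..1} \<Longrightarrow> f t \<in> geometric_simplex (members_at \<U> (\<xi> t))"
    and g: "\<And>U. continuous_map unit_space euclideanreal (\<lambda>t. g t U)"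
      "\<And>t. t \<in> {0..1} \<Longrightarrow> g t \<in> geometric_simplex (members_at \<U> (\<xi> t))"
  shows "continuous_map (prod_topology unit_space unit_space) R
    (\<lambda>z U. (1 - fst z) * f (snd z) U + fst z * g (snd z) U)"
proof (rule continuous_map_into_nerve[OF locally_finite open_cover])
  let ?I = "prod_topology unit_space unit_space"
  show "continuous_map ?I X (\<xi> \<circ> snd)"
    using \<xi> continuous_map_snd unfolding pathin_def by (rule continuous_map_compose[rotated])
  fix U
  have "continuous_map ?I euclideanreal ((\<lambda>t. f t U) \<circ> snd)" "continuous_map ?I euclideanreal ((\<lambda>t. g t U) \<circ> snd)"
    by (rule continuous_map_compose[OF continuous_map_snd f(1)])
       (rule continuous_map_compose[OF continuous_map_snd g(1)])
  moreover have "continuous_map ?I euclideanreal fst"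
    by (simp add: continuous_on_fst)
  ultimately show "continuous_map ?I euclideanreal (\<lambda>z. (1 - fst z) * f (snd z) U + fst z * g (snd z) U)"
    unfolding comp_def
    by (intro continuous_map_add continuous_map_real_mult continuous_map_diff) (auto simp: continuous_on_const)
next
  fix z assume "z \<in> topspace (prod_topology unit_space unit_space)"
  then show "(\<lambda>U. (1 - fst z) * f (snd z) U + fst z * g (snd z) U) \<in> geometric_simplex (members_at \<U> ((\<xi> \<circ> snd) z))"
    using f(2) g(2) by (auto intro!: geometric_simplex_convex)
qed

text \<open>All points \<open>p (\<gamma> t)\<close> lie in simplices having \<open>U\<close> as a
  vertex, so straight lines contract the loop to that vertex. The base point moves along, hence the
  appeal to \<open>path_homotopic_const_of_free\<close>.\<close>

lemma p_null_of_star: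
  assumes \<gamma>: "pathin X \<gamma>" "\<gamma> 1 = \<gamma> 0" and U: "\<And>t. t \<in> {0..1} \<Longrightarrow> p (\<gamma> t) U > 0"
  shows "path_homotopic R (p \<circ> \<gamma>) (\<lambda>t. p (\<gamma> 0))"
proof -
  let ?h = "\<lambda>z V. (1 - fst z) * p (\<gamma> (snd z)) V + fst z * indicator {U} V"
  have top: "\<gamma> t \<in> topspace X" if "t \<in> {0..1}" for t
    using pathin_in_topspace[OF \<gamma>(1) that] .
  have "continuous_map unit_space euclideanreal ((\<lambda>x. p x V) \<circ> \<gamma>)" for V
    using \<gamma>(1) p_coordinate(1) unfolding pathin_def by (rule continuous_map_compose)
  moreover have "indicator {U} \<in> geometric_simplex (members_at \<U> (\<gamma> t))" if "t \<in> {0..1}" for t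
    using p_pos_imp_mem[OF top[OF that] U[OF that]] finite_members_at[OF locally_finite open_cover top[OF that]]
    by (intro indicator_in_geometric_simplex) (auto simp: members_at_def)
  ultimately have h: "continuous_map (prod_topology unit_space unit_space) R ?h"
    using p_coordinate(2) top
    by (intro continuous_map_linear_homotopy[OF \<gamma>(1)]) (auto simp: comp_def)
  show ?thesis
    using path_homotopic_const_of_free[OF h, of "indicator {U}" "p \<circ> \<gamma>"] \<gamma>(2) by simp
qed

lemma p_lasso_null:
  assumes \<alpha>: "pathin X \<alpha>" "\<alpha> 0 = x0" and \<gamma>: "pathin X \<gamma>" "\<gamma> 0 = \<alpha> 1" "\<gamma> 1 = \<alpha> 1"
    and U: "\<And>t. t \<in> {0..1} \<Longrightarrow> p (\<gamma> t) U > 0"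
  shows "path_homotopic R (p \<circ> path_join (path_join \<alpha> \<gamma>) (path_rev \<alpha>)) (\<lambda>t. e)"
proof -
  have a: "pathin R (p \<circ> \<alpha>)"
    using \<alpha>(1) continuous_map_p unfolding pathin_def by (rule continuous_map_compose)
  have *: "path_homotopic R (p \<circ> \<gamma>) (\<lambda>t. (p \<circ> \<alpha>) 1)"
    using p_null_of_star[OF \<gamma>(1) _ U] \<gamma> by simp
  have "path_homotopic R (path_join (p \<circ> \<alpha>) (p \<circ> \<gamma>)) (path_join (p \<circ> \<alpha>) (\<lambda>t. (p \<circ> \<alpha>) 1))"
    using a \<gamma>(2) * by (intro path_homotopic_join) simp_all
  also have "path_homotopic R \<dots> (p \<circ> \<alpha>)"
    by (rule path_homotopic_join_const[OF a refl])
  finally have "path_homotopic R (path_join (path_join (p \<circ> \<alpha>) (p \<circ> \<gamma>)) (path_rev (p \<circ> \<alpha>)))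
      (path_join (p \<circ> \<alpha>) (path_rev (p \<circ> \<alpha>)))"
    using pathin_rev[OF a] \<gamma>(3) by (intro path_homotopic_join) simp_all
  also have "path_homotopic R \<dots> (\<lambda>t. (p \<circ> \<alpha>) 0)"
    by (rule path_homotopic_join_rev[OF a])
  finally show ?thesis
    by (simp add: path_join_compose path_rev_compose \<alpha>(2) p_coordinate(3) del: comp_apply)
       (simp add: \<alpha>(2) p_coordinate(3))
qed

text \<open>These are the preimages of the open vertex stars. They replace the members of \<U>,
  because a loop in \<open>U\<close> may leave the set where the coordinate at \<open>U\<close> is
  positive.\<close>

lemma positive_cover: "open_cover X {{x \<in> topspace X. p x U > 0} | U. U \<in> \<U>}"
  unfolding open_cover_def
proof (intro conjI ballI)
  fix W assume "W \<in> {{x \<in> topspace X. p x U > 0} | U. U \<in> \<U>}"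
  then obtain U where "W = {x \<in> topspace X. p x U \<in> {0<..}}"
    by auto
  then show "openin X W"
    using openin_continuous_map_preimage[OF p_coordinate(1)[of U], of "{0<..}"] by simp
next
  have "\<exists>U\<in>\<U>. p x U > 0" if x: "x \<in> topspace X" for x
  proof (rule ccontr)
    assume "\<not> ?thesis"
    then have "sum (p x) (members_at \<U> x) \<le> 0"
      by (intro sum_nonpos) (auto simp: members_at_def not_less)
    then show False
      using p_coordinate(2)[OF x] by (simp add: geometric_simplex_def)
  qed
  then show "\<Union>{{x \<in> topspace X. p x U > 0} | U. U \<in> \<U>} = topspace X"
    by blast
qed

lemma group_nerve_group: "group (nerve_group (\<U>, U0))"
  by (simp add: nerve_group_def group_fundamental_group e_in_topspace)

lemma induced_p_hom: "induced_hom R e p \<in> hom (fundamental_group X x0) (nerve_group (\<U>, U0))"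
  using induced_hom_hom[OF continuous_map_p p_coordinate(3)] by (simp add: nerve_group_def)

lemma induced_p_spanier:
  assumes "g \<in> spanier_cover X x0 {{x \<in> topspace X. p x U > 0} | U. U \<in> \<U>}"
  shows "g \<in> carrier (fundamental_group X x0)" "induced_hom R e p g = \<one>\<^bsub>nerve_group (\<U>, U0)\<^esub>"
proof -
  let ?G = "fundamental_group X x0"
  interpret h: group_hom ?G "nerve_group (\<U>, U0)" "induced_hom R e p"
    by (intro group_hom.intro group_hom_axioms.intro group_fundamental_group base_in_topspace
        group_nerve_group induced_p_hom)
  let ?S = "{loop_class X x0 (path_join (path_join \<alpha> \<gamma>) (path_rev \<alpha>)) | \<alpha> \<gamma> W.
      pathin X \<alpha> \<and> \<alpha> 0 = x0 \<and> W \<in> {{x \<in> topspace X. p x U > 0} | U. U \<in> \<U>} \<and>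
      pathin (subtopology X W) \<gamma> \<and> \<gamma> 0 = \<alpha> 1 \<and> \<gamma> 1 = \<alpha> 1}"
  have "?S \<subseteq> kernel ?G (nerve_group (\<U>, U0)) (induced_hom R e p)"
  proof
    fix g assume "g \<in> ?S"
    then obtain \<alpha> \<gamma> W where g: "g = loop_class X x0 (path_join (path_join \<alpha> \<gamma>) (path_rev \<alpha>))"
      and \<alpha>: "pathin X \<alpha>" "\<alpha> 0 = x0" and \<gamma>: "pathin X \<gamma>" "\<gamma> 0 = \<alpha> 1" "\<gamma> 1 = \<alpha> 1"
      and W: "W \<in> {{x \<in> topspace X. p x U > 0} | U. U \<in> \<U>}" "\<forall>t\<in>{0..1}. \<gamma> t \<in> W"
      unfolding pathin_subtopology by blast
    from W obtain U where U: "\<And>t. t \<in> {0..1} \<Longrightarrow> p (\<gamma> t) U > 0"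
      by fastforce
    let ?l = "path_join (path_join \<alpha> \<gamma>) (path_rev \<alpha>)"
    have l: "based_loop X x0 ?l"
      using \<alpha> \<gamma> by (auto simp: based_loop_def intro!: pathin_join pathin_rev)
    have "loop_class R e (p \<circ> ?l) = loop_class R e (\<lambda>t. e)"
      by (rule loop_class_cong[OF based_loop_compose[OF l continuous_map_p p_coordinate(3)]
            p_lasso_null[OF \<alpha> \<gamma> U]])
    then have "induced_hom R e p g = \<one>\<^bsub>nerve_group (\<U>, U0)\<^esub>"
      by (simp add: g induced_hom_loop_class[OF continuous_map_p p_coordinate(3) l] nerve_group_def
          one_fundamental_group)
    then show "g \<in> kernel ?G (nerve_group (\<U>, U0)) (induced_hom R e p)"
      using l by (auto simp: kernel_def g)
  qed
  then have "spanier_cover X x0 {{x \<in> topspace X. p x U > 0} | U. U \<in> \<U>} \<subseteq>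
      kernel ?G (nerve_group (\<U>, U0)) (induced_hom R e p)"
    unfolding spanier_cover_def
    by (rule group.generate_subgroup_incl[OF group_fundamental_group[OF base_in_topspace] _ h.subgroup_kernel])
  then show "g \<in> carrier ?G" "induced_hom R e p g = \<one>\<^bsub>nerve_group (\<U>, U0)\<^esub>"
    using assms by (auto simp: kernel_def)
qed

end

text \<open>The two maps are contiguous along \<alpha>: at time \<open>t\<close> both land in the
  simplex of the members of \<U> containing \<open>\<alpha> t\<close>. The linear homotopy fixes the
  ends since both send \<open>x0\<close> to the vertex \<open>U0\<close>.\<close>

lemma simplicial_extension_p_homotopic:
  assumes "pointed_cover X x0 \<U> U0" "pointed_cover X x0 \<V> V0"
    and r: "refining_map (\<U>, U0) (\<V>, V0) r" and \<alpha>: "based_loop X x0 \<alpha>"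
  shows "continuous_map (realization (nerve \<V>)) (realization (nerve \<U>)) (simplicial_extension r)"
    and "path_homotopic (realization (nerve \<U>)) (simplicial_extension r \<circ> (nerve_map X x0 (\<V>, V0) \<circ> \<alpha>))
      (nerve_map X x0 (\<U>, U0) \<circ> \<alpha>)"
proof -
  interpret U: pointed_cover X x0 \<U> U0 by fact
  interpret V: pointed_cover X x0 \<V> V0 by fact
  have rV: "r V \<in> \<U>" "V \<subseteq> r V" if "V \<in> \<V>" for V
    using r that by (auto simp: refining_map_def)
  show ext: "continuous_map V.R U.R (simplicial_extension r)"
  proof (rule continuous_map_simplicial_extension)
    fix F assume F: "F \<in> nerve \<V>"
    then show "finite F"
      by (simp add: nerve_def)
    have "\<Inter>F \<subseteq> \<Inter>(r ` F)"
      using F rV(2) by (fastforce simp: nerve_def)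
    then show "r ` F \<in> nerve \<U>"
      using F rV(1) by (auto simp: nerve_def)
  qed
  have path: "pathin X \<alpha>"
    using \<alpha> by (simp add: based_loop_def)
  let ?f = "simplicial_extension r \<circ> (V.p \<circ> \<alpha>)" and ?g = "U.p \<circ> \<alpha>"
  let ?h = "\<lambda>z U. (1 - fst z) * ?f (snd z) U + fst z * ?g (snd z) U"
  have cf: "continuous_map unit_space U.R ?f"
    using path V.continuous_map_p ext unfolding pathin_def by (metis continuous_map_compose)
  have cg: "continuous_map unit_space U.R ?g"
    using path U.continuous_map_p unfolding pathin_def by (metis continuous_map_compose)
  have coord: "continuous_map unit_space euclideanreal (\<lambda>t. k t U)" if "continuous_map unit_space U.R k" for k U
    using continuous_map_compose[OF that continuous_map_coordinate[of _ U]] by (simp add: comp_def)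
  have f_simplex: "?f t \<in> geometric_simplex (members_at \<U> (\<alpha> t))" if "t \<in> {0..1}" for t
  proof -
    have x: "\<alpha> t \<in> topspace X"
      using pathin_in_topspace[OF path that] .
    have fin: "finite (members_at \<V> (\<alpha> t))" "finite (members_at \<U> (\<alpha> t))"
      using finite_members_at[OF V.locally_finite V.open_cover x]
        finite_members_at[OF U.locally_finite U.open_cover x] by auto
    have "?f t \<in> geometric_simplex (r ` members_at \<V> (\<alpha> t))"
      using simplicial_extension_in_simplex[OF V.p_coordinate(2)[OF x] fin(1)] by simp
    moreover have "r ` members_at \<V> (\<alpha> t) \<subseteq> members_at \<U> (\<alpha> t)"
      using rV by (auto simp: members_at_def)
    ultimately show ?thesis
      using geometric_simplex_mono fin(2) by blast
  qed
  have h: "continuous_map (prod_topology unit_space unit_space) U.R ?h"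
    using coord[OF cf] coord[OF cg] f_simplex U.p_coordinate(2) pathin_in_topspace[OF path]
    by (intro U.continuous_map_linear_homotopy[OF path]) auto
  have ends: "?f t = U.e" "?g t = U.e" if "t = 0 \<or> t = 1" for t
    using that \<alpha> r V.p_coordinate(3) U.p_coordinate(3)
    by (auto simp: based_loop_def simplicial_extension_indicator refining_map_def)
  show "path_homotopic U.R ?f ?g"
    unfolding path_homotopic_iff
  proof (intro exI[of _ ?h] conjI ballI h)
    fix s :: real
    show "?h (s, 0) = ?f 0" "?h (s, 1) = ?f 1"
      unfolding ends by (auto simp: algebra_simps ends simp del: comp_apply)
  qed (auto simp del: comp_apply)
qed

section \<open>The shape homomorphism and its kernel\<close>

context
  fixes X :: "'a topology" and x0 :: 'a
  assumes paracompact: "paracompact_space X" and Hausdorff: "Hausdorff_space X"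
begin

lemma pointed_cover_of_cov: "(\<U>, U0) \<in> cov X x0 \<Longrightarrow> pointed_cover X x0 \<U> U0"
  using paracompact Hausdorff by (intro pointed_cover.intro)

lemma bonding_hom_shape_hom:
  assumes c: "c \<in> cov X x0" and d: "d \<in> cov X x0" and "cov_refines d c"
    and A: "A \<in> carrier (fundamental_group X x0)"
  shows "bonding_hom c d (shape_hom X x0 A d) = shape_hom X x0 A c"
proof -
  obtain \<U> U0 \<V> V0 where cd: "c = (\<U>, U0)" "d = (\<V>, V0)"
    by (metis surj_pair)
  interpret U: pointed_cover X x0 \<U> U0
    using c cd pointed_cover_of_cov by simp
  interpret V: pointed_cover X x0 \<V> V0
    using d cd pointed_cover_of_cov by simp
  have ref: "\<forall>V\<in>\<V>. \<exists>U\<in>\<U>. V \<subseteq> U" "V0 \<subseteq> U0"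
    using assms(3) by (auto simp: cd cov_refines_def refines_def)
  \<comment> \<open>A vertex map sending \<open>V0\<close> to \<open>U0\<close> exists, so the one
    picked by \<open>SOME\<close> in \<open>bonding_hom\<close> is a refining map.\<close>
  have "\<forall>V\<in>\<V>. \<exists>U\<in>\<U>. V \<subseteq> U \<and> (V = V0 \<longrightarrow> U = U0)"
    using ref U.U0(1) by metis
  then obtain r where "\<forall>V\<in>\<V>. r V \<in> \<U> \<and> V \<subseteq> r V \<and> (V = V0 \<longrightarrow> r V = U0)"
    by metis
  then have "refining_map c d r"
    using V.U0(1) by (simp add: refining_map_def cd)
  then have r: "refining_map c d (SOME r. refining_map c d r)"
    by (rule someI[of "refining_map c d"])
  let ?r = "SOME r. refining_map c d r"
  obtain \<alpha> where \<alpha>: "based_loop X x0 \<alpha>" "A = loop_class X x0 \<alpha>"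
    using A by (auto simp: carrier_fundamental_group)
  note * = simplicial_extension_p_homotopic[OF U.pointed_cover_axioms V.pointed_cover_axioms
      r[unfolded cd] \<alpha>(1), folded cd]
  have base: "simplicial_extension ?r V.e = U.e"
    using r by (simp add: simplicial_extension_indicator refining_map_def cd)
  note loop = based_loop_compose[OF \<alpha>(1) V.continuous_map_p V.p_coordinate(3)]
  have "bonding_hom c d (shape_hom X x0 A d) =
      induced_hom U.R U.e (simplicial_extension ?r) (loop_class V.R V.e (V.p \<circ> \<alpha>))"
    using d by (simp add: bonding_hom_def shape_hom_def cd \<alpha>(2)
        induced_hom_loop_class[OF V.continuous_map_p V.p_coordinate(3) \<alpha>(1)])
  also have "\<dots> = loop_class U.R U.e (simplicial_extension ?r \<circ> (V.p \<circ> \<alpha>))"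
    using *(1) base loop by (rule induced_hom_loop_class)
  also have "\<dots> = loop_class U.R U.e (U.p \<circ> \<alpha>)"
  proof (rule loop_class_cong)
    show "based_loop U.R U.e (simplicial_extension ?r \<circ> (V.p \<circ> \<alpha>))"
      using based_loop_compose[OF loop, of U.R "simplicial_extension ?r"] *(1) base by simp
    show "path_homotopic U.R (simplicial_extension ?r \<circ> (V.p \<circ> \<alpha>)) (U.p \<circ> \<alpha>)"
      using *(2) by (simp add: cd)
  qed
  also have "\<dots> = shape_hom X x0 A c"
    using c by (simp add: shape_hom_def cd \<alpha>(2)
        induced_hom_loop_class[OF U.continuous_map_p U.p_coordinate(3) \<alpha>(1)])
  finally show ?thesis .
qed

lemma shape_hom_hom: "shape_hom X x0 \<in> hom (fundamental_group X x0) (shape_group X x0)"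
proof -
  have hom: "(\<lambda>A. shape_hom X x0 A c) \<in> hom (fundamental_group X x0) (nerve_group c)"
    if c: "c \<in> cov X x0" for c
  proof -
    obtain \<U> U0 where cd: "c = (\<U>, U0)"
      by (metis surj_pair)
    interpret pointed_cover X x0 \<U> U0
      using c cd pointed_cover_of_cov by simp
    show ?thesis
      using induced_p_hom c by (simp add: shape_hom_def cd hom_def)
  qed
  show ?thesis
  proof (rule homI)
    fix A assume A: "A \<in> carrier (fundamental_group X x0)"
    have "shape_hom X x0 A \<in> (\<Pi>\<^sub>E c\<in>cov X x0. carrier (nerve_group c))"
    proof (rule PiE_I)
      show "shape_hom X x0 A c \<in> carrier (nerve_group c)" if "c \<in> cov X x0" for c
        using hom_carrier[OF hom[OF that]] A by auto
      show "shape_hom X x0 A c = undefined" if "c \<notin> cov X x0" for c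
        using that by (simp add: shape_hom_def)
    qed
    then show "shape_hom X x0 A \<in> carrier (shape_group X x0)"
      using bonding_hom_shape_hom A by (simp add: shape_group_def)
  next
    fix A B assume AB: "A \<in> carrier (fundamental_group X x0)" "B \<in> carrier (fundamental_group X x0)"
    show "shape_hom X x0 (A \<otimes>\<^bsub>fundamental_group X x0\<^esub> B) =
        shape_hom X x0 A \<otimes>\<^bsub>shape_group X x0\<^esub> shape_hom X x0 B"
    proof
      fix c
      show "shape_hom X x0 (A \<otimes>\<^bsub>fundamental_group X x0\<^esub> B) c =
          (shape_hom X x0 A \<otimes>\<^bsub>shape_group X x0\<^esub> shape_hom X x0 B) c"
      proof (cases "c \<in> cov X x0")
        case True
        then show ?thesis
          using hom_mult[OF hom[OF True] AB] by (simp add: shape_group_def)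
      next
        case False
        then show ?thesis
          by (simp add: shape_group_def shape_hom_def)
      qed
    qed
  qed
qed

lemma spanier_trivial_of_shape_injective:
  assumes "x0 \<in> topspace X" "inj_on (shape_hom X x0) (carrier (fundamental_group X x0))"
  shows "spanier_group X x0 = {\<one>\<^bsub>fundamental_group X x0\<^esub>}"
proof
  let ?G = "fundamental_group X x0"
  interpret G: group ?G
    by (rule group_fundamental_group[OF assms(1)])
  show "{\<one>\<^bsub>?G\<^esub>} \<subseteq> spanier_group X x0"
    by (auto simp: spanier_group_def spanier_cover_def intro: generate.one)
  show "spanier_group X x0 \<subseteq> {\<one>\<^bsub>?G\<^esub>}"
  proof
    fix g assume g: "g \<in> spanier_group X x0"
    have key: "g \<in> carrier ?G \<and> shape_hom X x0 g c = shape_hom X x0 \<one>\<^bsub>?G\<^esub> c" if c: "c \<in> cov X x0" for c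
    proof -
      obtain \<U> U0 where cd: "c = (\<U>, U0)"
        by (metis surj_pair)
      interpret pointed_cover X x0 \<U> U0
        using c cd pointed_cover_of_cov by simp
      have "g \<in> spanier_cover X x0 {{x \<in> topspace X. p x U > 0} | U. U \<in> \<U>}"
        using g positive_cover by (auto simp: spanier_group_def)
      note * = induced_p_spanier[OF this]
      interpret N: group "nerve_group (\<U>, U0)"
        by (rule group_nerve_group)
      have "induced_hom R e p \<one>\<^bsub>?G\<^esub> = \<one>\<^bsub>nerve_group (\<U>, U0)\<^esub>"
        using hom_one[OF induced_p_hom] G.is_group N.is_group by blast
      then show ?thesis
        using * c by (simp add: shape_hom_def cd)
    qed
    \<comment> \<open>Membership of \<open>g\<close> in the carrier comes from \<open>key\<close>,
      which needs at least one element of \<open>cov\<close>.\<close>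
    have "open_cover X {topspace X}" "locally_finite_in X {topspace X}"
      by (auto simp: open_cover_def intro: finite_imp_locally_finite_in)
    then have "({topspace X}, topspace X) \<in> cov X x0"
      using assms(1) by (simp add: cov_def)
    then have carrier: "g \<in> carrier ?G"
      using key by blast
    have "shape_hom X x0 g = shape_hom X x0 \<one>\<^bsub>?G\<^esub>"
      using key by (fastforce simp: shape_hom_def)
    then show "g \<in> {\<one>\<^bsub>?G\<^esub>}"
      using assms(2) carrier by (auto dest: inj_onD)
  qed
qed

end



section \<open>Spanier groups and shape injectivity\<close>

text \<open>The members are only relatively open in \<open>S\<close>, so the covering lemma is
  applied to open sets of the whole space whose traces on \<open>S\<close> lie in members.\<close>

lemma Lebesgue_number_ball:
  fixes S :: "'a::euclidean_space set"
  assumes "compact S" "\<And>z. z \<in> S \<Longrightarrow> \<exists>T\<in>\<T>. z \<in> T" "\<And>T. T \<in> \<T> \<Longrightarrow> openin (top_of_set S) T"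
  shows "\<exists>e>0. \<forall>z\<in>S. \<exists>T\<in>\<T>. S \<inter> ball z e \<subseteq> T"
proof (cases "S = {}")
  case True
  then show ?thesis
    by (intro exI[of _ 1]) simp
next
  case False
  let ?\<O> = "{Q. open Q \<and> (\<exists>T\<in>\<T>. S \<inter> Q \<subseteq> T)}"
  have "\<exists>Q\<in>?\<O>. z \<in> Q" if z: "z \<in> S" for z
  proof -
    obtain T where T: "T \<in> \<T>" "z \<in> T"
      using assms(2)[OF z] by blast
    then obtain Q where "open Q" "T = S \<inter> Q"
      using assms(3)[OF T(1)] by (auto simp: openin_open)
    then show ?thesis
      using T by (intro bexI[of _ Q]) auto
  qed
  then have cov: "S \<subseteq> \<Union>?\<O>"
    by (intro subsetI) (simp only: Union_iff)
  have ne: "?\<O> \<noteq> {}"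
  proof
    assume "?\<O> = {}"
    from cov[unfolded this] show False
      using False by simp
  qed
  have op: "open B" if "B \<in> ?\<O>" for B
    using that by simp
  obtain \<delta> where \<delta>: "\<delta> > 0" "\<And>T. T \<subseteq> S \<Longrightarrow> diameter T < \<delta> \<Longrightarrow> \<exists>B\<in>?\<O>. T \<subseteq> B"
  proof (rule Lebesgue_number_lemma[OF assms(1) ne cov op])
    fix \<delta> assume "0 < \<delta>" "\<And>T. T \<subseteq> S \<Longrightarrow> diameter T < \<delta> \<Longrightarrow> \<exists>B\<in>?\<O>. T \<subseteq> B"
    then show thesis
      by (rule that)
  qed
  \<comment> \<open>A ball of radius \<open>\<delta> / 3\<close> has diameter less than
    \<delta>.\<close>
  have "\<exists>T\<in>\<T>. S \<inter> ball z (\<delta> / 3) \<subseteq> T" for z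
  proof -
    have "diameter (S \<inter> ball z (\<delta> / 3)) \<le> diameter (ball z (\<delta> / 3))"
      by (intro diameter_subset) auto
    also have "\<dots> < \<delta>"
      using \<delta>(1) by simp
    finally obtain Q where "Q \<in> ?\<O>" "S \<inter> ball z (\<delta> / 3) \<subseteq> Q"
      using \<delta>(2)[of "S \<inter> ball z (\<delta> / 3)"] by auto
    then show ?thesis
      by blast
  qed
  then show ?thesis
    using \<delta>(1) by (intro exI[of _ "\<delta> / 3"]) simp
qed

text \<open>
  A null homotopy in the nerve is replaced by a map \<open>\<xi>\<close> into \<open>X\<close>, in general discontinuous,
  that sends each point into the intersection of all members with positive barycentric coordinate.
\<close>

lemma (in locally_trivial_functor) functor_trivial_of_nerve_null:
  assumes "pointed_cover X x0 \<V> V0" "refines \<V> \<C>"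
    and \<gamma>: "based_loop X x0 \<gamma>"
    and null: "path_homotopic (realization (nerve \<V>)) (nerve_map X x0 (\<V>, V0) \<circ> \<gamma>) (\<lambda>t. indicator {V0})"
  shows "f \<gamma> = \<one>"
proof -
  interpret pointed_cover X x0 \<V> V0 by fact
  let ?S = "{0..1::real} \<times> {0..1::real}"
  have path: "pathin X \<gamma>" and ends: "\<gamma> 0 = x0" "\<gamma> 1 = x0"
    using \<gamma> by (auto simp: based_loop_def)
  obtain h where h: "continuous_map (prod_topology unit_space unit_space) R h"
    and h0: "\<And>t. t \<in> {0..1} \<Longrightarrow> h (0, t) = p (\<gamma> t)"
    and h1: "\<And>t. t \<in> {0..1} \<Longrightarrow> h (1, t) = e"
    and hs: "\<And>s. s \<in> {0..1} \<Longrightarrow> h (s, 0) = e" "\<And>s. s \<in> {0..1} \<Longrightarrow> h (s, 1) = e"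
    using null unfolding path_homotopic_iff by (auto simp: ends p_coordinate(3))
  have simplex: "\<exists>F\<in>nerve \<V>. h z \<in> geometric_simplex F" if z: "z \<in> ?S" for z
  proof -
    have "h z \<in> topspace R"
      using h z unfolding continuous_map_def by auto
    then show ?thesis
      by (simp add: topspace_realization)
  qed
  have support: "V \<in> F" if "h z \<in> geometric_simplex F" "h z V > 0" for z V F
    using that by (force simp: geometric_simplex_def)
  have "\<exists>x. (\<forall>V. h z V > 0 \<longrightarrow> x \<in> V) \<and> (fst z = 0 \<longrightarrow> x = \<gamma> (snd z)) \<and>
      (fst z = 1 \<or> snd z = 0 \<or> snd z = 1 \<longrightarrow> x = x0)" if z: "z \<in> ?S" for z
  proof -
    obtain s t where st: "z = (s, t)" "s \<in> {0..1}" "t \<in> {0..1}"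
      using z by blast
    \<comment> \<open>The values prescribed on the sides agree at the corners because \<gamma> is a
      loop at \<open>x0\<close>. Where \<open>h z = e\<close> only \<open>V0\<close> has positive
      weight, and \<open>x0\<close> lies in \<open>V0\<close>. Elsewhere a point exists because the
      members spanning a simplex of the nerve intersect.\<close>
    consider "s = 1 \<or> t = 0 \<or> t = 1" | "s = 0" "t \<noteq> 0" "t \<noteq> 1"
      | "s \<noteq> 0" "s \<noteq> 1" "t \<noteq> 0" "t \<noteq> 1"
      by blast
    then show ?thesis
    proof cases
      case 1
      then have "h z = e"
        using h1 hs st by auto
      moreover have "s = 0 \<longrightarrow> x0 = \<gamma> t"
        using 1 ends by auto
      ultimately show ?thesis
        using U0(2) st(1) by (intro exI[of _ x0]) (auto simp: indicator_def split: if_splits)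
    next
      case 2
      then show ?thesis
        using h0[OF st(3)] p_pos_imp_mem[OF pathin_in_topspace[OF path st(3)]] st(1)
        by (intro exI[of _ "\<gamma> t"]) auto
    next
      case 3
      obtain F where F: "F \<in> nerve \<V>" "h z \<in> geometric_simplex F"
        using simplex[OF z] by blast
      then obtain x where "x \<in> \<Inter>F"
        by (auto simp: nerve_def)
      then show ?thesis
        using 3 st(1) support[OF F(2)] by (intro exI[of _ x]) auto
    qed
  qed
  then have "\<forall>z\<in>?S. \<exists>x. (\<forall>V. h z V > 0 \<longrightarrow> x \<in> V) \<and> (fst z = 0 \<longrightarrow> x = \<gamma> (snd z)) \<and>
      (fst z = 1 \<or> snd z = 0 \<or> snd z = 1 \<longrightarrow> x = x0)"
    by simp
  from bchoice[OF this] obtain \<xi> where \<xi>: "\<forall>z\<in>?S. (\<forall>V. h z V > 0 \<longrightarrow> \<xi> z \<in> V) \<and>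
      (fst z = 0 \<longrightarrow> \<xi> z = \<gamma> (snd z)) \<and> (fst z = 1 \<or> snd z = 0 \<or> snd z = 1 \<longrightarrow> \<xi> z = x0)" ..
  \<comment> \<open>The preimages of open stars under \<open>h\<close>; on the one belonging to
    \<open>V\<close> the map \<xi> takes values in \<open>V\<close>, hence in one member of
    \<C>.\<close>
  let ?\<T> = "{{z \<in> ?S. h z V > 0} | V. V \<in> \<V>}"
  have "\<exists>d>0. \<forall>z\<in>?S. \<exists>T\<in>?\<T>. ?S \<inter> ball z d \<subseteq> T"
  proof (rule Lebesgue_number_ball[of ?S ?\<T>])
    show "compact ?S"
      by (intro compact_Times compact_Icc)
    show "\<exists>T\<in>?\<T>. z \<in> T" if z: "z \<in> ?S" for z
    proof -
      obtain F where F: "F \<in> nerve \<V>" "h z \<in> geometric_simplex F"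
        using simplex[OF z] by blast
      have "\<exists>V\<in>F. h z V > 0"
      proof (rule ccontr)
        assume "\<not> ?thesis"
        then have "sum (h z) F \<le> 0"
          by (intro sum_nonpos) (auto simp: not_less)
        then show False
          using F(2) by (simp add: geometric_simplex_def)
      qed
      then obtain V where "V \<in> \<V>" "h z V > 0"
        using F(1) by (auto simp: nerve_def)
      then have "{z \<in> ?S. h z V > 0} \<in> ?\<T>" "z \<in> {z \<in> ?S. h z V > 0}"
        using z by auto
      then show ?thesis
        by (rule bexI[rotated])
    qed
    show "openin (top_of_set ?S) T" if T: "T \<in> ?\<T>" for T
    proof -
      obtain V where V: "T = {z \<in> ?S. h z V > 0}"
        using T by blast
      have "continuous_map (top_of_set ?S) euclideanreal (\<lambda>z. h z V)"
        using continuous_map_compose[OF h continuous_map_coordinate[of _ V]] by (simp add: comp_def)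
      from openin_continuous_map_preimage[OF this, of "{0<..}"] show ?thesis
        by (simp add: V)
    qed
  qed
  then obtain d where d: "d > 0" "\<forall>z\<in>?S. \<exists>T\<in>?\<T>. ?S \<inter> ball z d \<subseteq> T"
    by (elim exE conjE)
  show ?thesis
  proof (rule functor_trivial_of_grid[OF path base_in_topspace d(1), of \<xi>])
    fix z assume "z \<in> ?S"
    from bspec[OF d(2) this] obtain T where T: "T \<in> ?\<T>" "?S \<inter> ball z d \<subseteq> T"
      by (elim bexE)
    then obtain V where V: "V \<in> \<V>" "T = {z \<in> ?S. h z V > 0}"
      by blast
    then obtain C where C: "C \<in> \<C>" "V \<subseteq> C"
      using assms(2) unfolding refines_def by blast
    have "\<xi> z' \<in> C" if "z' \<in> ?S" "dist z z' < d" for z'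
    proof -
      have "z' \<in> T"
        using T(2) that by auto
      then have "h z' V > 0"
        by (simp add: V(2))
      then have "\<xi> z' \<in> V"
        using bspec[OF \<xi> that(1)] by simp
      then show ?thesis
        using C(2) by blast
    qed
    then show "\<exists>C\<in>\<C>. \<forall>z'\<in>?S. dist z z' < d \<longrightarrow> \<xi> z' \<in> C"
      using C(1) by (intro bexI[of _ C]) simp_all
  next
    show "\<xi> (0, t) = \<gamma> t" if "t \<in> {0..1}" for t
      using bspec[OF \<xi>, of "(0, t)"] that by simp
    show "\<xi> (1, t) = x0" if "t \<in> {0..1}" for t
      using bspec[OF \<xi>, of "(1, t)"] that by simp
    show "\<xi> (s, 0) = x0" if "s \<in> {0..1}" for s
      using bspec[OF \<xi>, of "(s, 0)"] that by simp
    show "\<xi> (s, 1) = x0" if "s \<in> {0..1}" for s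
      using bspec[OF \<xi>, of "(s, 1)"] that by simp
  qed
qed

text \<open>The quotient of \<open>A\<close> by \<open>B\<close> is tested against one cover \<U> at
  a time: for each, a single coordinate of the shape homomorphism, at a fine enough \<V>, puts it
  into the Spanier subgroup of \<U>.\<close>

lemma (in path_choice) shape_injective_of_spanier_trivial:
  assumes "paracompact_space X" "Hausdorff_space X" "locally_path_connected_space X"
    and "spanier_group X x0 = {\<one>\<^bsub>\<pi>\<^sub>1\<^esub>}"
  shows "inj_on (shape_hom X x0) (carrier \<pi>\<^sub>1)"
proof (rule inj_onI)
  fix A B assume AB: "A \<in> carrier \<pi>\<^sub>1" "B \<in> carrier \<pi>\<^sub>1" "shape_hom X x0 A = shape_hom X x0 B"
  have mem: "A \<otimes>\<^bsub>\<pi>\<^sub>1\<^esub> inv\<^bsub>\<pi>\<^sub>1\<^esub> B \<in> carrier \<pi>\<^sub>1"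
    using AB by simp
  then obtain \<gamma> where \<gamma>: "based_loop X x0 \<gamma>" "A \<otimes>\<^bsub>\<pi>\<^sub>1\<^esub> inv\<^bsub>\<pi>\<^sub>1\<^esub> B = loop_class X x0 \<gamma>"
    unfolding carrier_fundamental_group by blast
  have "A \<otimes>\<^bsub>\<pi>\<^sub>1\<^esub> inv\<^bsub>\<pi>\<^sub>1\<^esub> B \<in> spanier_cover X x0 \<U>" if \<U>: "open_cover X \<U>" for \<U>
  proof -
    obtain \<C> where \<C>: "open_cover X \<C>" "\<And>C. C \<in> \<C> \<Longrightarrow> path_connectedin X C"
      "\<And>C D. \<lbrakk>C \<in> \<C>; D \<in> \<C>; C \<inter> D \<noteq> {}\<rbrakk> \<Longrightarrow> \<exists>U\<in>\<U>. C \<union> D \<subseteq> U"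
      using path_connected_pairwise_refinement[OF assms(1-3) \<U>] by blast
    interpret F: locally_trivial_functor "\<pi>\<^sub>1 Mod spanier_cover X x0 \<U>" X "quotient_elt \<U>" \<C>
      by (rule locally_trivial_quotient_elt[OF \<C>])
    obtain \<V> where \<V>: "open_cover X \<V>" "locally_finite_in X \<V>" "refines \<V> \<C>"
      using assms(1) \<C>(1) unfolding paracompact_space_def by blast
    obtain V0 where V0: "V0 \<in> \<V>" "x0 \<in> V0"
      using \<V>(1) base unfolding open_cover_def by blast
    then have cov: "(\<V>, V0) \<in> cov X x0"
      using \<V> by (simp add: cov_def)
    interpret V: pointed_cover X x0 \<V> V0
      by (rule pointed_cover.intro[OF assms(1,2) cov])
    interpret ind: group_hom \<pi>\<^sub>1 "nerve_group (\<V>, V0)" "induced_hom V.R V.e V.p"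
      by (intro group_hom.intro group_hom_axioms.intro G.is_group V.group_nerve_group V.induced_p_hom)
    have "induced_hom V.R V.e V.p A = induced_hom V.R V.e V.p B"
      using fun_cong[OF AB(3), of "(\<V>, V0)"] cov by (simp add: shape_hom_def)
    then have "induced_hom V.R V.e V.p (A \<otimes>\<^bsub>\<pi>\<^sub>1\<^esub> inv\<^bsub>\<pi>\<^sub>1\<^esub> B) = \<one>\<^bsub>nerve_group (\<V>, V0)\<^esub>"
      using AB(1,2) by simp
    then have "loop_class V.R V.e (V.p \<circ> \<gamma>) = loop_class V.R V.e (\<lambda>t. V.e)"
      by (simp add: \<gamma>(2) induced_hom_loop_class[OF V.continuous_map_p V.p_coordinate(3) \<gamma>(1)]
          nerve_group_def one_fundamental_group)
    then have "path_homotopic V.R (V.p \<circ> \<gamma>) (\<lambda>t. V.e)"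
      using loop_class_eq_iff[OF based_loop_compose[OF \<gamma>(1) V.continuous_map_p V.p_coordinate(3)]
          based_loop_const[OF V.e_in_topspace]] by simp
    then have "quotient_elt \<U> \<gamma> = \<one>\<^bsub>\<pi>\<^sub>1 Mod spanier_cover X x0 \<U>\<^esub>"
      by (rule F.functor_trivial_of_nerve_null[OF V.pointed_cover_axioms \<V>(3) \<gamma>(1)])
    then show ?thesis
      using quotient_elt_eq_one_iff[OF \<gamma>(1)] \<gamma>(2) by simp
  qed
  then have "A \<otimes>\<^bsub>\<pi>\<^sub>1\<^esub> inv\<^bsub>\<pi>\<^sub>1\<^esub> B = \<one>\<^bsub>\<pi>\<^sub>1\<^esub>"
    using assms(4) unfolding spanier_group_def by blast
  then show "A = B"
    using AB(1,2) by (metis G.inv_inv G.inv_closed G.inv_equality)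
qed


section \<open>Spanier groups and the quotient topology\<close>

lemma topspace_compact_open_topology: "topspace (compact_open_topology Y X) = map_space Y X"
proof -
  \<comment> \<open>An empty compact set imposes no condition, so the whole mapping space is
    subbasic.\<close>
  have "map_space Y X \<in> {{f \<in> map_space Y X. f ` K \<subseteq> W} | K W. compactin Y K \<and> openin X W}"
    by (intro CollectI exI[of _ "{}"]) auto
  then show ?thesis
    unfolding compact_open_topology_def topology_generated_by_topspace by blast
qed

lemma topspace_loop_space: "topspace (loop_space X x0) = loops X x0"
  by (auto simp: loop_space_def topspace_compact_open_topology loops_def)

lemma openin_pi1_qtop_iff:
  assumes "N \<subseteq> carrier (fundamental_group X x0)"
  shows "openin (pi1_qtop X x0) N \<longleftrightarrow> openin (loop_space X x0) {\<alpha> \<in> loops X x0. loop_class X x0 \<alpha> \<in> N}"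
  using assms by (simp add: pi1_qtop_def openin_quotient_topology topspace_loop_space fundamental_group_def)

lemma openin_compact_open_subbasic:
  "compactin Y K \<Longrightarrow> openin X W \<Longrightarrow> openin (compact_open_topology Y X) {f \<in> map_space Y X. f ` K \<subseteq> W}"
  unfolding compact_open_topology_def by (rule topology_generated_by_Basis) blast

lemma (in path_choice) spanier_cover_open:
  assumes "paracompact_space X" "Hausdorff_space X" "locally_path_connected_space X" "open_cover X \<U>"
  shows "openin (pi1_qtop X x0) (spanier_cover X x0 \<U>)"
proof -
  let ?N = "spanier_cover X x0 \<U>"
  interpret N: normal ?N \<pi>\<^sub>1
    by (rule spanier_cover_normal)
  obtain \<C> where \<C>: "open_cover X \<C>" "\<And>C. C \<in> \<C> \<Longrightarrow> path_connectedin X C"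
    "\<And>C D. \<lbrakk>C \<in> \<C>; D \<in> \<C>; C \<inter> D \<noteq> {}\<rbrakk> \<Longrightarrow> \<exists>U\<in>\<U>. C \<union> D \<subseteq> U"
    using path_connected_pairwise_refinement[OF assms] by blast
  interpret F: locally_trivial_functor "\<pi>\<^sub>1 Mod ?N" X "quotient_elt \<U>" \<C>
    by (rule locally_trivial_quotient_elt[OF \<C>])
  have nbhd: "\<exists>T. openin (loop_space X x0) T \<and> \<alpha> \<in> T \<and> T \<subseteq> {\<alpha> \<in> loops X x0. loop_class X x0 \<alpha> \<in> ?N}"
    if \<alpha>: "\<alpha> \<in> loops X x0" "loop_class X x0 \<alpha> \<in> ?N" for \<alpha>
  proof -
    have loop: "based_loop X x0 \<alpha>"
      by (rule loops_imp_based_loop[OF \<alpha>(1)])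
    then have path: "pathin X \<alpha>"
      by (simp add: based_loop_def)
    let ?\<T> = "{{t \<in> {0..1}. \<alpha> t \<in> C} | C. C \<in> \<C>}"
    have "\<exists>d>0. \<forall>t\<in>{0..1}. \<exists>T\<in>?\<T>. {0..1} \<inter> ball t d \<subseteq> T"
    proof (rule Lebesgue_number_ball[of "{0..1}" ?\<T>])
      show "\<exists>T\<in>?\<T>. t \<in> T" if t: "t \<in> {0..1}" for t
      proof -
        obtain C where "C \<in> \<C>" "\<alpha> t \<in> C"
          using pathin_in_topspace[OF path t] \<C>(1) unfolding open_cover_def by blast
        then show ?thesis
          using t by (intro bexI[of _ "{t \<in> {0..1}. \<alpha> t \<in> C}"]) auto
      qed
      show "openin (top_of_set {0..1}) T" if T: "T \<in> ?\<T>" for T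
      proof -
        obtain C where C: "C \<in> \<C>" "T = {t \<in> {0..1}. \<alpha> t \<in> C}"
          using T by blast
        then have "openin X C"
          using \<C>(1) by (simp add: open_cover_def)
        then show ?thesis
          using openin_continuous_map_preimage[OF path[unfolded pathin_def]] by (simp add: C(2))
      qed
    qed simp
    then obtain d where d: "d > 0" "\<forall>t\<in>{0..1}. \<exists>T\<in>?\<T>. {0..1} \<inter> ball t d \<subseteq> T"
      by (elim exE conjE)
    obtain n :: nat where n: "n > 0" "1 / n < d"
      using ex_inverse_less[OF d(1)] .
    have "\<forall>i\<in>{..<n}. \<exists>C. C \<in> \<C> \<and> \<alpha> ` {i / n..Suc i / n} \<subseteq> C"
    proof
      fix i assume i: "i \<in> {..<n}"
      then have le: "0 \<le> i / n" "i / n \<le> 1" "Suc i / n \<le> 1"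
        by (auto simp: divide_simps)
      then obtain T where T: "T \<in> ?\<T>" "{0..1} \<inter> ball (i / n) d \<subseteq> T"
        using bspec[OF d(2), of "i / n"] by auto
      then obtain C where C: "C \<in> \<C>" "T = {t \<in> {0..1}. \<alpha> t \<in> C}"
        by blast
      have "{i / n..Suc i / n} \<subseteq> {0..1} \<inter> ball (i / n) d"
        using le n(2) by (auto simp: dist_real_def add_divide_distrib)
      then have "{i / n..Suc i / n} \<subseteq> T"
        using T(2) by (rule order_trans)
      then show "\<exists>C. C \<in> \<C> \<and> \<alpha> ` {i / n..Suc i / n} \<subseteq> C"
        using C by (intro exI[of _ C]) auto
    qed
    from bchoice[OF this] obtain C where C: "\<forall>i\<in>{..<n}. C i \<in> \<C> \<and> \<alpha> ` {i / n..Suc i / n} \<subseteq> C i" ..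
    \<comment> \<open>Loops that stay in \<open>C i\<close> during the \<open>i\<close>-th segment,
      as \<alpha> does; this is the closeness demanded by
      \<open>functor_eq_of_close\<close>.\<close>
    let ?T = "(\<Inter>i\<in>{..<n}. {\<beta> \<in> map_space unit_space X. \<beta> ` {i / n..Suc i / n} \<subseteq> C i}) \<inter> loops X x0"
    have "openin (compact_open_topology unit_space X)
        (\<Inter>i\<in>{..<n}. {\<beta> \<in> map_space unit_space X. \<beta> ` {i / n..Suc i / n} \<subseteq> C i})"
    \<comment> \<open>Since \<open>n > 0\<close> the index set is nonempty; an intersection over the
      empty set would be all functions instead of the mapping space.\<close>
    proof (rule openin_INT2)
      fix i assume i: "i \<in> {..<n}"
      have "{i / n..Suc i / n} \<subseteq> {0..1}"
        using i by (auto simp: divide_simps)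
      then have "compactin unit_space {i / n..Suc i / n}"
        by (simp add: compactin_subtopology)
      moreover have "openin X (C i)"
        using bspec[OF C i] \<C>(1) by (simp add: open_cover_def)
      ultimately show "openin (compact_open_topology unit_space X)
          {\<beta> \<in> map_space unit_space X. \<beta> ` {i / n..Suc i / n} \<subseteq> C i}"
        by (rule openin_compact_open_subbasic)
    qed (use n(1) in auto)
    then have "openin (loop_space X x0) ?T"
      by (auto simp: loop_space_def openin_subtopology)
    moreover have "\<alpha> \<in> ?T"
      using \<alpha>(1) bspec[OF C] by (simp add: loops_def)
    moreover have "\<beta> \<in> loops X x0 \<and> loop_class X x0 \<beta> \<in> ?N" if \<beta>: "\<beta> \<in> ?T" for \<beta>
    proof -
      have \<beta>_loop: "\<beta> \<in> loops X x0"
        using \<beta> by (rule IntD2)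
      note \<beta>_based = loops_imp_based_loop[OF \<beta>_loop]
      have "quotient_elt \<U> \<alpha> = quotient_elt \<U> \<beta>"
      proof (rule F.functor_eq_of_close[OF _ _ _ _ n(1)])
        show "\<exists>D\<in>\<C>. \<alpha> ` {i / n..Suc i / n} \<union> \<beta> ` {i / n..Suc i / n} \<subseteq> D" if i: "i < n" for i
        proof (rule bexI[of _ "C i"])
          show "C i \<in> \<C>"
            using bspec[OF C, of i] i by simp
          show "\<alpha> ` {i / n..Suc i / n} \<union> \<beta> ` {i / n..Suc i / n} \<subseteq> C i"
            using bspec[OF C, of i] i \<beta> by simp
        qed
      qed (use loop \<beta>_based in \<open>auto simp: based_loop_def\<close>)
      then show ?thesis
        using quotient_elt_eq_one_iff[OF loop, of \<U>] quotient_elt_eq_one_iff[OF \<beta>_based, of \<U>] \<alpha>(2) \<beta>_loop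
        by simp
    qed
    ultimately show ?thesis
      by (intro exI[of _ ?T]) auto
  qed
  have "openin (loop_space X x0) {\<alpha> \<in> loops X x0. loop_class X x0 \<alpha> \<in> ?N}"
    by (subst openin_subopen) (use nbhd in simp)
  then show ?thesis
    by (simp add: openin_pi1_qtop_iff N.subset)
qed

text \<open>This is continuity of \<open>based\<close> at the constant loop, with the tail to
  \<open>x\<close> held fixed. Only the noose varies, so a subbasic condition constrains it only if
  its compact set meets the time interval of the noose.\<close>

lemma (in path_choice) lasso_neighbourhood:
  assumes x: "x \<in> topspace X" and T: "openin (compact_open_topology unit_space X) T"
    and mem: "restrict (based (\<lambda>t. x)) {0..1} \<in> T"
  shows "\<exists>W. openin X W \<and> x \<in> W \<and>
    (\<forall>\<gamma>. pathin X \<gamma> \<and> \<gamma> \<in> {0..1} \<rightarrow> W \<and> \<gamma> 0 = x \<and> \<gamma> 1 = x \<longrightarrow> restrict (based \<gamma>) {0..1} \<in> T)"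
proof -
  have "generate_topology_on {{f \<in> map_space unit_space X. f ` K \<subseteq> W} | K W. compactin unit_space K \<and> openin X W} T"
    using T by (simp add: compact_open_topology_def openin_topology_generated_by)
  then show ?thesis
    using mem
  proof induction
    case (Int A B)
    let ?P = "\<lambda>W D. openin X W \<and> x \<in> W \<and>
      (\<forall>\<gamma>. pathin X \<gamma> \<and> \<gamma> \<in> {0..1} \<rightarrow> W \<and> \<gamma> 0 = x \<and> \<gamma> 1 = x \<longrightarrow> restrict (based \<gamma>) {0..1} \<in> D)"
    obtain W W' where W: "?P W A" "?P W' B"
      using Int.IH Int.prems by (elim IntE) blast
    show ?case
    proof (intro exI[of _ "W \<inter> W'"] conjI allI impI)
      fix \<gamma> assume \<gamma>: "pathin X \<gamma> \<and> \<gamma> \<in> {0..1} \<rightarrow> W \<inter> W' \<and> \<gamma> 0 = x \<and> \<gamma> 1 = x"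
      then have "\<gamma> \<in> {0..1} \<rightarrow> W" "\<gamma> \<in> {0..1} \<rightarrow> W'"
        by auto
      then show "restrict (based \<gamma>) {0..1} \<in> A \<inter> B"
        using W \<gamma> by blast
    qed (use W in \<open>simp_all add: openin_Int\<close>)
  next
    case (UN \<K>)
    from UN.prems obtain A where A: "A \<in> \<K>" "restrict (based (\<lambda>t. x)) {0..1} \<in> A"
      by (elim UnionE)
    have sub: "A \<subseteq> \<Union>\<K>"
      using A(1) by (rule Union_upper)
    from UN.IH[OF A] obtain W where W: "openin X W" "x \<in> W"
      "\<forall>\<gamma>. pathin X \<gamma> \<and> \<gamma> \<in> {0..1} \<rightarrow> W \<and> \<gamma> 0 = x \<and> \<gamma> 1 = x \<longrightarrow> restrict (based \<gamma>) {0..1} \<in> A"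
      by (elim exE conjE)
    show ?case
    proof (intro exI[of _ W] conjI allI impI W(1,2))
      fix \<gamma> assume "pathin X \<gamma> \<and> \<gamma> \<in> {0..1} \<rightarrow> W \<and> \<gamma> 0 = x \<and> \<gamma> 1 = x"
      with W(3) have "restrict (based \<gamma>) {0..1} \<in> A"
        by (elim allE impE)
      with sub show "restrict (based \<gamma>) {0..1} \<in> \<Union>\<K>"
        by (rule subsetD)
    qed
  next
    case (Basis A)
    then obtain K W where KW: "A = {f \<in> map_space unit_space X. f ` K \<subseteq> W}" "compactin unit_space K" "openin X W"
      by blast
    have K: "K \<subseteq> {0..1}"
      using compactin_subset_topspace[OF KW(2)] by simp
    \<comment> \<open>If \<open>x\<close> is outside \<open>W\<close>, then \<open>K\<close> misses
      the time interval of the noose, and the noose is unconstrained.\<close>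
    let ?W = "if x \<in> W then W else topspace X"
    show ?case
    proof (intro exI[of _ ?W] conjI allI impI)
      fix \<gamma> assume \<gamma>: "pathin X \<gamma> \<and> \<gamma> \<in> {0..1} \<rightarrow> ?W \<and> \<gamma> 0 = x \<and> \<gamma> 1 = x"
      have "restrict (based \<gamma>) {0..1} \<in> map_space unit_space X"
        using based_loop_restrict[OF based_loop_based] \<gamma> by (simp add: loops_def)
      moreover have "based \<gamma> t \<in> W" if t: "t \<in> K" for t
      proof -
        have t01: "t \<in> {0..1}"
          using K t by blast
        have const: "based (\<lambda>t. x) t \<in> W"
          using Basis.prems KW(1) t t01 by (auto simp: image_subset_iff)
        show ?thesis
        \<comment> \<open>The inner join occupies the first half, so the noose is run for
          \<open>t\<close> between 1/4 and 1/2, with parameter \<open>4 * t - 1\<close>.\<close>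
        proof (cases "1/4 < t \<and> t \<le> 1/2")
          case True
          then have "x \<in> W" "based \<gamma> t = \<gamma> (4 * t - 1)" "4 * t - 1 \<in> {0..1}"
            using const by (auto simp: based_def path_join_def)
          then show ?thesis
            using \<gamma> by (auto simp: Pi_iff)
        next
          case False
          then have "based \<gamma> t = based (\<lambda>t. x) t"
            using \<gamma> by (auto simp: based_def path_join_def)
          then show ?thesis
            using const by simp
        qed
      qed
      ultimately show "restrict (based \<gamma>) {0..1} \<in> A"
        using K by (auto simp: KW(1) image_subset_iff)
    qed (use x KW(3) in auto)
  qed simp
qed

lemma (in path_choice) spanier_cover_subset_of_open_normal:
  assumes "locally_path_connected_space X" "N \<lhd> \<pi>\<^sub>1" "openin (pi1_qtop X x0) N"
  obtains \<U> where "open_cover X \<U>" "spanier_cover X x0 \<U> \<subseteq> N"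
proof -
  interpret N: normal N \<pi>\<^sub>1
    by fact
  obtain T where T: "openin (compact_open_topology unit_space X) T"
    "{\<alpha> \<in> loops X x0. loop_class X x0 \<alpha> \<in> N} = T \<inter> loops X x0"
    using assms(3) by (auto simp: openin_pi1_qtop_iff[OF N.subset] loop_space_def openin_subtopology)
  have class_restrict: "loop_class X x0 (restrict (based \<gamma>) {0..1}) = path_elt \<gamma>" if "pathin X \<gamma>" for \<gamma>
    unfolding path_elt_def
    using loop_class_cong[OF based_loop_based[OF that] path_homotopic_restrict[OF based_loop_based[OF that]]]
    by simp
  have in_T: "restrict (based \<gamma>) {0..1} \<in> T \<longleftrightarrow> path_elt \<gamma> \<in> N" if "pathin X \<gamma>" for \<gamma>
    using T(2) class_restrict[OF that] based_loop_restrict[OF based_loop_based[OF that]]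
    by (metis (mono_tags, lifting) IntD1 IntI mem_Collect_eq)
  have "\<exists>U. openin X U \<and> path_connectedin X U \<and> x \<in> U \<and>
      (\<forall>\<gamma>. pathin X \<gamma> \<and> \<gamma> \<in> {0..1} \<rightarrow> U \<and> \<gamma> 0 = x \<and> \<gamma> 1 = x \<longrightarrow> path_elt \<gamma> \<in> N)"
    if x: "x \<in> topspace X" for x
  proof -
    have "path_elt (\<lambda>t. x) \<in> N"
      using G.functor_const[OF x] N.one_closed by simp
    then have "restrict (based (\<lambda>t. x)) {0..1} \<in> T"
      using in_T[of "\<lambda>t. x"] x by simp
    from lasso_neighbourhood[OF x T(1) this] obtain W where W: "openin X W" "x \<in> W"
      "\<And>\<gamma>. pathin X \<gamma> \<Longrightarrow> \<gamma> \<in> {0..1} \<rightarrow> W \<Longrightarrow> \<gamma> 0 = x \<Longrightarrow> \<gamma> 1 = x \<Longrightarrow> restrict (based \<gamma>) {0..1} \<in> T"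
      by auto
    obtain U where U: "openin X U" "path_connectedin X U" "x \<in> U" "U \<subseteq> W"
      using assms(1)[unfolded locally_path_connected_space, rule_format, of W x] W(1,2) by auto
    have "path_elt \<gamma> \<in> N" if "pathin X \<gamma> \<and> \<gamma> \<in> {0..1} \<rightarrow> U \<and> \<gamma> 0 = x \<and> \<gamma> 1 = x" for \<gamma>
    proof -
      have "\<gamma> \<in> {0..1} \<rightarrow> W"
        using that U(4) by auto
      then show ?thesis
        using W(3)[of \<gamma>] in_T[of \<gamma>] that by simp
    qed
    then show ?thesis
      using U by (intro exI[of _ U]) simp
  qed
  then have "\<forall>x\<in>topspace X. \<exists>U. openin X U \<and> path_connectedin X U \<and> x \<in> U \<and>
      (\<forall>\<gamma>. pathin X \<gamma> \<and> \<gamma> \<in> {0..1} \<rightarrow> U \<and> \<gamma> 0 = x \<and> \<gamma> 1 = x \<longrightarrow> path_elt \<gamma> \<in> N)"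
    by simp
  from bchoice[OF this] obtain U where U: "\<forall>x\<in>topspace X. openin X (U x) \<and> path_connectedin X (U x) \<and> x \<in> U x \<and>
      (\<forall>\<gamma>. pathin X \<gamma> \<and> \<gamma> \<in> {0..1} \<rightarrow> U x \<and> \<gamma> 0 = x \<and> \<gamma> 1 = x \<longrightarrow> path_elt \<gamma> \<in> N)" ..
  have sub: "U x \<subseteq> topspace X" if "x \<in> topspace X" for x
    using bspec[OF U that] by (intro openin_subset) simp
  have "open_cover X (U ` topspace X)"
    unfolding open_cover_def
  proof (intro conjI ballI subset_antisym)
    show "topspace X \<subseteq> \<Union>(U ` topspace X)"
    proof
      fix x assume x: "x \<in> topspace X"
      then show "x \<in> \<Union>(U ` topspace X)"
        using bspec[OF U x] by blast
    qed
  qed (use bspec[OF U] sub in auto)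
  moreover have "spanier_generators (U ` topspace X) \<subseteq> N"
  proof
    fix g assume "g \<in> spanier_generators (U ` topspace X)"
    then obtain \<alpha> \<gamma> x where g: "g = path_elt \<alpha> \<otimes>\<^bsub>\<pi>\<^sub>1\<^esub> path_elt \<gamma> \<otimes>\<^bsub>\<pi>\<^sub>1\<^esub> inv\<^bsub>\<pi>\<^sub>1\<^esub> path_elt \<alpha>"
      and \<alpha>: "pathin X \<alpha>" "\<alpha> 0 = x0" and x: "x \<in> topspace X"
      and \<gamma>: "pathin X \<gamma>" "\<gamma> \<in> {0..1} \<rightarrow> U x" "\<gamma> 0 = \<alpha> 1" "\<gamma> 1 = \<alpha> 1"
      by (auto simp: spanier_generators_def pathin_subtopology)
    have "\<gamma> 0 \<in> U x"
      using funcset_mem[OF \<gamma>(2), of 0] by simp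
    \<comment> \<open>Membership in \<open>N\<close> is known only for nooses based at the centre
      \<open>x\<close>, so \<delta> carries the noose there.\<close>
    then obtain \<delta> where \<delta>: "pathin X \<delta>" "\<delta> \<in> {0..1} \<rightarrow> U x" "\<delta> 0 = x" "\<delta> 1 = \<gamma> 0"
      using bspec[OF U x] unfolding path_connectedin by blast
    let ?\<epsilon> = "path_join (path_join \<delta> \<gamma>) (path_rev \<delta>)"
    have \<epsilon>: "pathin X ?\<epsilon>"
      using \<delta> \<gamma> by (intro pathin_join pathin_rev) auto
    have "?\<epsilon> \<in> {0..1} \<rightarrow> U x"
      using \<delta>(2) \<gamma>(2) by (auto simp: path_join_def path_rev_def Pi_iff)
    then have "path_elt ?\<epsilon> \<in> N"
      using bspec[OF U x] \<epsilon> \<delta>(3) by simp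
    moreover have "path_elt ?\<epsilon> = path_elt \<delta> \<otimes>\<^bsub>\<pi>\<^sub>1\<^esub> path_elt \<gamma> \<otimes>\<^bsub>\<pi>\<^sub>1\<^esub> inv\<^bsub>\<pi>\<^sub>1\<^esub> path_elt \<delta>"
      using \<delta> \<gamma> by (simp add: G.functor_join G.functor_rev pathin_join pathin_rev)
    \<comment> \<open>Normality undoes the conjugation by \<delta>, and then permits conjugation by
      the arbitrary tail \<alpha>.\<close>
    moreover have "inv\<^bsub>\<pi>\<^sub>1\<^esub> path_elt \<delta> \<otimes>\<^bsub>\<pi>\<^sub>1\<^esub> (path_elt \<delta> \<otimes>\<^bsub>\<pi>\<^sub>1\<^esub> path_elt \<gamma> \<otimes>\<^bsub>\<pi>\<^sub>1\<^esub> inv\<^bsub>\<pi>\<^sub>1\<^esub> path_elt \<delta>) \<otimes>\<^bsub>\<pi>\<^sub>1\<^esub> path_elt \<delta>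
        = path_elt \<gamma>"
      using \<delta>(1) \<gamma>(1) by (simp add: G.m_assoc G.inv_solve_left')
    ultimately have "path_elt \<gamma> \<in> N"
      using N.inv_op_closed1[of "path_elt \<delta>" "path_elt ?\<epsilon>"] \<delta>(1) by simp
    then show "g \<in> N"
      using N.inv_op_closed2[of "path_elt \<alpha>" "path_elt \<gamma>"] \<alpha>(1) by (simp add: g)
  qed
  then have "spanier_cover X x0 (U ` topspace X) \<subseteq> N"
    unfolding spanier_cover_eq by (rule G.generate_subgroup_incl[OF _ N.subgroup_axioms])
  ultimately show ?thesis
    by (rule that)
qed

theorem theorem26:
  fixes X :: "'a topology" and x0 :: 'a
  assumes "path_connected_space X"
    and "locally_path_connected_space X"
    and "paracompact_space X"
    and "Hausdorff_space X"
    and "x0 \<in> topspace X"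
  shows "(pi1_shape_injective X x0 \<longleftrightarrow>
            spanier_group X x0 = {\<one>\<^bsub>fundamental_group X x0\<^esub>}) \<and>
         (spanier_group X x0 = {\<one>\<^bsub>fundamental_group X x0\<^esub>} \<longleftrightarrow>
            invariantly_separated (fundamental_group X x0) (pi1_qtop X x0))"
proof -
  let ?G = "fundamental_group X x0"
  obtain \<tau> where "path_choice X x0 \<tau>"
    using path_choice_exists[OF assms(1,5)] by blast
  then interpret path_choice X x0 \<tau> .
  \<comment> \<open>The homomorphism half of \<open>mon\<close> holds for every space considered,
    which leaves injectivity.\<close>
  have "pi1_shape_injective X x0 \<longleftrightarrow> inj_on (shape_hom X x0) (carrier ?G)"
    using shape_hom_hom[OF assms(3,4)] by (simp add: pi1_shape_injective_def mon_def)
  also have "\<dots> \<longleftrightarrow> spanier_group X x0 = {\<one>\<^bsub>?G\<^esub>}"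
    using spanier_trivial_of_shape_injective[OF assms(3,4,5)]
      shape_injective_of_spanier_trivial[OF assms(3,4,2)] by blast
  finally have shape: "pi1_shape_injective X x0 \<longleftrightarrow> spanier_group X x0 = {\<one>\<^bsub>?G\<^esub>}" .
  have "invariantly_separated ?G (pi1_qtop X x0)" if trivial: "spanier_group X x0 = {\<one>\<^bsub>?G\<^esub>}"
    unfolding invariantly_separated_def
  proof (intro ballI impI)
    fix g assume "g \<in> carrier ?G" "g \<noteq> \<one>\<^bsub>?G\<^esub>"
    then obtain \<U> where "open_cover X \<U>" "g \<notin> spanier_cover X x0 \<U>"
      using trivial by (auto simp: spanier_group_def)
    then show "\<exists>N. N \<lhd> ?G \<and> openin (pi1_qtop X x0) N \<and> g \<notin> N"
      using spanier_cover_normal spanier_cover_open[OF assms(3,4,2)] by blast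
  qed
  moreover have "spanier_group X x0 = {\<one>\<^bsub>?G\<^esub>}" if sep: "invariantly_separated ?G (pi1_qtop X x0)"
  proof (rule subset_antisym)
    show "{\<one>\<^bsub>?G\<^esub>} \<subseteq> spanier_group X x0"
      by (auto simp: spanier_group_def spanier_cover_def intro: generate.one)
    show "spanier_group X x0 \<subseteq> {\<one>\<^bsub>?G\<^esub>}"
    proof (rule subsetI, rule ccontr)
      fix g assume g: "g \<in> spanier_group X x0" "g \<notin> {\<one>\<^bsub>?G\<^esub>}"
      \<comment> \<open>Separation concerns elements of the carrier only; the one-member cover shows
        that \<open>g\<close> is one.\<close>
      have "open_cover X {topspace X}"
        by (simp add: open_cover_def)
      then have "g \<in> spanier_cover X x0 {topspace X}"
        using g(1) by (auto simp: spanier_group_def)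
      then have "g \<in> carrier ?G"
        using normal_imp_subgroup[OF spanier_cover_normal] subgroup.subset by blast
      then obtain N where N: "N \<lhd> ?G" "openin (pi1_qtop X x0) N" "g \<notin> N"
        using sep g(2) unfolding invariantly_separated_def by blast
      obtain \<U> where "open_cover X \<U>" "spanier_cover X x0 \<U> \<subseteq> N"
        by (rule spanier_cover_subset_of_open_normal[OF assms(2) N(1,2)])
      then show False
        using g(1) N(3) unfolding spanier_group_def by blast
    qed
  qed
  ultimately show ?thesis
    using shape by blast
qed

end
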